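(* Let $S$ be an inverse semigroup with zero and let $\theta\colon S\to T$ be a homomorphism to a weakly boolean inverse semigroup $T$ with the property that the inverse image under $\theta$ of each prime filter in $T$ is a filter in $S$. Let $\mathsf{B}(S)=\mathsf{KB}(\mathsf{G}_u(S))$ be the inverse semigroup of compact-open bisections of the universal groupoid of $S$, and let $\beta\colon S\to\mathsf{B}(S)$ be given by $\beta(s)=U_s$. Then there is a unique homomorphism of distributive inverse semigroups $\bar\theta\colon\mathsf{B}(S)\to T$ such that $\bar\theta\beta=\theta$.
   Context: Inverse semigroups carry their natural partial order. Elements $s,t$ are compatible if $s^{-1}t$ and $st^{-1}$ are idempotents. A distributive inverse semigroup is an inverse semigroup in which finite compatible subsets have joins (so it has a zero) and multiplication distributes over them; homomorphisms of distributive inverse semigroups are semigroup homomorphisms preserving finite compatible joins. A weakly boolean inverse semigroup is a distributive inverse semigroup whose semilattice of idempotents is a boolean algebra (not necessarily with top element). A filter is a non-empty, upward closed subset $F$ such that for $a,b\in F$ there is $c\in F$ with $c\le a,b$; all filters are proper ($0\notin F$). A filter in a distributive inverse semigroup is prime if $a\vee b\in F$ implies $a\in F$ or $b\in F$. Filters are composed as follows: $\mathbf{d}(A)=(A^{-1}A)^{\uparrow}$, $\mathbf{r}(A)=(AA^{-1})^{\uparrow}$ (upward closures), and $A\cdot B=(AB)^{\uparrow}$ is defined iff $\mathbf{d}(A)=\mathbf{r}(B)$. The universal groupoid $\mathsf{G}_u(S)$ is the groupoid of all filters on $S$ with the topology whose basis consists of the sets $U_{x;x_1,\dots,x_n}=U_x\cap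 U_{x_1}^c\cap\dots\cap U_{x_n}^c$ with $x_1,\dots,x_n\le x$ in $S$, where $U_x$ is the set of all filters containing $x$ and $^c$ denotes complement; it is an étale groupoid. For an étale groupoid $G$ with set of identities $G_o$, a bisection is a subset $A$ with $A^{-1}A,AA^{-1}\subseteq G_o$, and $\mathsf{KB}(G)$ is the set of compact-open bisections under subset multiplication; $\mathsf{KB}(\mathsf{G}_u(S))$ is a weakly boolean inverse semigroup. *)

theory Defs
  imports "HOL-Algebra.Lattice" "HOL-Analysis.Abstract_Topology"
begin

section \<open>Inverse semigroups\<close>

record 'a semigrp = "'a partial_object" +
  mul :: "'a \<Rightarrow> 'a \<Rightarrow> 'a" (infixl "\<cdot>\<index>" 70)

locale inverse_semigroup =
  fixes S (structure)
  assumes mul_closed: "\<lbrakk>s \<in> carrier S; t \<in> carrier S\<rbrakk> \<Longrightarrow> s \<cdot> t \<in> carrier S"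
    and mul_assoc: "\<lbrakk>s \<in> carrier S; t \<in> carrier S; u \<in> carrier S\<rbrakk>
      \<Longrightarrow> (s \<cdot> t) \<cdot> u = s \<cdot> (t \<cdot> u)"
    and unique_inverse: "s \<in> carrier S
      \<Longrightarrow> \<exists>!t. t \<in> carrier S \<and> s \<cdot> t \<cdot> s = s \<and> t \<cdot> s \<cdot> t = t"

definition sinv :: "('a, 'm) semigrp_scheme \<Rightarrow> 'a \<Rightarrow> 'a" where
  "sinv S s = (THE t. t \<in> carrier S \<and> s \<cdot>\<^bsub>S\<^esub> t \<cdot>\<^bsub>S\<^esub> s = s \<and> t \<cdot>\<^bsub>S\<^esub> s \<cdot>\<^bsub>S\<^esub> t = t)"

definition is_zero :: "('a, 'm) semigrp_scheme \<Rightarrow> 'a \<Rightarrow> bool" where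
  "is_zero S z \<longleftrightarrow> z \<in> carrier S \<and> (\<forall>s\<in>carrier S. z \<cdot>\<^bsub>S\<^esub> s = z \<and> s \<cdot>\<^bsub>S\<^esub> z = z)"

locale inverse_semigroup_with_zero = inverse_semigroup +
  assumes zero_exists: "\<exists>z. is_zero S z"

definition idempotents :: "('a, 'm) semigrp_scheme \<Rightarrow> 'a set" where
  "idempotents S = {e \<in> carrier S. e \<cdot>\<^bsub>S\<^esub> e = e}"

definition natural_order :: "('a, 'm) semigrp_scheme \<Rightarrow> 'a gorder" where
  "natural_order S = \<lparr>carrier = carrier S, eq = (=),
     le = (\<lambda>s t. \<exists>e\<in>idempotents S. s = t \<cdot>\<^bsub>S\<^esub> e)\<rparr>"

abbreviation natural_le :: "('a, 'm) semigrp_scheme \<Rightarrow> 'a \<Rightarrow> 'a \<Rightarrow> bool" where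
  "natural_le S s t \<equiv> s \<sqsubseteq>\<^bsub>natural_order S\<^esub> t"

abbreviation is_join :: "('a, 'm) semigrp_scheme \<Rightarrow> 'a \<Rightarrow> 'a set \<Rightarrow> bool" where
  "is_join S a A \<equiv> is_lub (natural_order S) a A"

definition compatible :: "('a, 'm) semigrp_scheme \<Rightarrow> 'a \<Rightarrow> 'a \<Rightarrow> bool" where
  "compatible S s t \<longleftrightarrow>
     sinv S s \<cdot>\<^bsub>S\<^esub> t \<in> idempotents S \<and> s \<cdot>\<^bsub>S\<^esub> sinv S t \<in> idempotents S"

definition finite_compatible :: "('a, 'm) semigrp_scheme \<Rightarrow> 'a set \<Rightarrow> bool" where
  "finite_compatible S A \<longleftrightarrow>
     A \<subseteq> carrier S \<and> finite A \<and> (\<forall>s\<in>A. \<forall>t\<in>A. compatible S s t)"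

text \<open>The empty set is a finite compatible subset; its join is the least element of the
  natural partial order, which is a zero.\<close>

locale distributive_inverse_semigroup = inverse_semigroup +
  assumes join_exists: "finite_compatible S A \<Longrightarrow> \<exists>a. is_join S a A"
    and mul_join_distrib_left: "\<lbrakk>finite_compatible S A; is_join S a A; s \<in> carrier S\<rbrakk>
      \<Longrightarrow> is_join S (s \<cdot> a) ((\<lambda>x. s \<cdot> x) ` A)"
    and mul_join_distrib_right: "\<lbrakk>finite_compatible S A; is_join S a A; s \<in> carrier S\<rbrakk>
      \<Longrightarrow> is_join S (a \<cdot> s) ((\<lambda>x. x \<cdot> s) ` A)"

text \<open>Boolean algebras that need not have a top element: distributive lattices with a
  bottom element and relative complements.\<close>

locale generalized_boolean_algebra = lattice L + weak_partial_order_bottom L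
  for L (structure) +
  assumes meet_join_distrib: "\<lbrakk>x \<in> carrier L; y \<in> carrier L; z \<in> carrier L\<rbrakk>
      \<Longrightarrow> x \<sqinter> (y \<squnion> z) = (x \<sqinter> y) \<squnion> (x \<sqinter> z)"
    and relative_complement: "\<lbrakk>x \<in> carrier L; y \<in> carrier L; x \<sqsubseteq> y\<rbrakk>
      \<Longrightarrow> \<exists>z\<in>carrier L. x \<sqinter> z = \<bottom> \<and> x \<squnion> z = y"

locale weakly_boolean_inverse_semigroup = distributive_inverse_semigroup +
  assumes idempotents_boolean:
    "generalized_boolean_algebra ((natural_order S)\<lparr>carrier := idempotents S\<rparr>)"

definition semigroup_hom ::
  "('a, 'm) semigrp_scheme \<Rightarrow> ('b, 'n) semigrp_scheme \<Rightarrow> ('a \<Rightarrow> 'b) set" where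
  "semigroup_hom S T = {h \<in> carrier S \<rightarrow> carrier T.
     \<forall>s\<in>carrier S. \<forall>t\<in>carrier S. h (s \<cdot>\<^bsub>S\<^esub> t) = h s \<cdot>\<^bsub>T\<^esub> h t}"

definition distributive_hom ::
  "('a, 'm) semigrp_scheme \<Rightarrow> ('b, 'n) semigrp_scheme \<Rightarrow> ('a \<Rightarrow> 'b) set" where
  "distributive_hom S T = {h \<in> semigroup_hom S T.
     \<forall>A a. finite_compatible S A \<and> is_join S a A \<longrightarrow> is_join T (h a) (h ` A)}"

section \<open>Filters\<close>

definition is_proper_filter :: "('a, 'm) semigrp_scheme \<Rightarrow> 'a set \<Rightarrow> bool" where
  "is_proper_filter S F \<longleftrightarrow> F \<subseteq> carrier S \<and> F \<noteq> {}
     \<and> (\<forall>a\<in>F. \<forall>b\<in>carrier S. natural_le S a b \<longrightarrow> b \<in> F)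
     \<and> (\<forall>a\<in>F. \<forall>b\<in>F. \<exists>c\<in>F. natural_le S c a \<and> natural_le S c b)
     \<and> (\<forall>z. is_zero S z \<longrightarrow> z \<notin> F)"

definition is_prime_filter :: "('a, 'm) semigrp_scheme \<Rightarrow> 'a set \<Rightarrow> bool" where
  "is_prime_filter S F \<longleftrightarrow> is_proper_filter S F
     \<and> (\<forall>a\<in>carrier S. \<forall>b\<in>carrier S. \<forall>c. is_join S c {a, b} \<and> c \<in> F \<longrightarrow> a \<in> F \<or> b \<in> F)"

definition up_closure :: "('a, 'm) semigrp_scheme \<Rightarrow> 'a set \<Rightarrow> 'a set" where
  "up_closure S A = {s \<in> carrier S. \<exists>a\<in>A. natural_le S a s}"

definition set_mul :: "('a, 'm) semigrp_scheme \<Rightarrow> 'a set \<Rightarrow> 'a set \<Rightarrow> 'a set" where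
  "set_mul S A B = {a \<cdot>\<^bsub>S\<^esub> b | a b. a \<in> A \<and> b \<in> B}"

section \<open>Topological groupoids and compact-open bisections\<close>

text \<open>The value \<open>gcomp G a b\<close> is only meaningful if \<open>gdom G a = gran G b\<close>.\<close>

record 'g top_groupoid = "'g partial_object" +
  gdom :: "'g \<Rightarrow> 'g"
  gran :: "'g \<Rightarrow> 'g"
  gcomp :: "'g \<Rightarrow> 'g \<Rightarrow> 'g"
  ginv :: "'g \<Rightarrow> 'g"
  gtop :: "'g topology"

definition identities :: "('g, 'm) top_groupoid_scheme \<Rightarrow> 'g set" where
  "identities G = gdom G ` carrier G"

definition subset_mul :: "('g, 'm) top_groupoid_scheme \<Rightarrow> 'g set \<Rightarrow> 'g set \<Rightarrow> 'g set" where
  "subset_mul G A B = {gcomp G a b | a b. a \<in> A \<and> b \<in> B \<and> gdom G a = gran G b}"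

definition bisection :: "('g, 'm) top_groupoid_scheme \<Rightarrow> 'g set \<Rightarrow> bool" where
  "bisection G A \<longleftrightarrow> A \<subseteq> carrier G
     \<and> subset_mul G (ginv G ` A) A \<subseteq> identities G
     \<and> subset_mul G A (ginv G ` A) \<subseteq> identities G"

definition KB :: "('g, 'm) top_groupoid_scheme \<Rightarrow> 'g set semigrp" where
  "KB G = \<lparr>carrier = {A. bisection G A \<and> openin (gtop G) A \<and> compactin (gtop G) A},
           mul = subset_mul G\<rparr>"

section \<open>The universal groupoid\<close>

definition filters_at :: "('a, 'm) semigrp_scheme \<Rightarrow> 'a \<Rightarrow> 'a set set" where
  "filters_at S x = {F. is_proper_filter S F \<and> x \<in> F}"

definition universal_basis :: "('a, 'm) semigrp_scheme \<Rightarrow> 'a set set set" where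
  "universal_basis S = {filters_at S x - (\<Union>y\<in>Y. filters_at S y) | x Y.
     x \<in> carrier S \<and> finite Y \<and> Y \<subseteq> carrier S \<and> (\<forall>y\<in>Y. natural_le S y x)}"

definition universal_groupoid :: "('a, 'm) semigrp_scheme \<Rightarrow> 'a set top_groupoid" where
  "universal_groupoid S =
     \<lparr>carrier = {F. is_proper_filter S F},
      gdom = (\<lambda>A. up_closure S (set_mul S (sinv S ` A) A)),
      gran = (\<lambda>A. up_closure S (set_mul S A (sinv S ` A))),
      gcomp = (\<lambda>A B. up_closure S (set_mul S A B)),
      ginv = (\<lambda>A. sinv S ` A),
      gtop = topology_generated_by (universal_basis S)\<rparr>"

definition booleanization :: "('a, 'm) semigrp_scheme \<Rightarrow> 'a set set semigrp" where
  "booleanization S = KB (universal_groupoid S)"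

definition beta :: "('a, 'm) semigrp_scheme \<Rightarrow> 'a \<Rightarrow> 'a set set" where
  "beta S s = filters_at S s"

end

theory Submission
  imports Defs "HOL-Analysis.Function_Topology"
begin

text \<open>
  Every prime filter \<open>P\<close> of \<open>T\<close> determines the filter \<open>\<theta>\<^sup>-\<^sup>1 P\<close> of \<open>S\<close>, a point of the universal groupoid.
  Say that \<open>t\<close> represents a set \<open>A\<close> of filters if \<open>t \<in> P\<close> exactly when \<open>\<theta>\<^sup>-\<^sup>1 P \<in> A\<close>, for all prime \<open>P\<close>. Elements of
  \<open>T\<close> are separated by prime filters (Zorn), so representing elements are unique. The element
  \<open>\<theta> s\<close> represents \<open>U\<^sub>s\<close>; relative complements in \<open>T\<close> yield representatives of the basic open sets;
  products and inverses of representatives represent products and inverses of the sets. In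
  particular the representatives of the pieces of a bisection are compatible, and their join
  represents the union. As every compact-open bisection is a finite union of basic open sets, it has
  a unique representative, which defines the extension; and any homomorphism extending \<open>\<theta>\<close> sends a
  compact-open bisection to a representative of it.
\<close>

section \<open>Inverse semigroups\<close>

text \<open>Behind representation is a map of groupoids: \<open>P \<mapsto> pre P\<close> sends
  prime filters of \<open>T\<close> to filters of \<open>S\<close>, and the representative of
  \<open>A\<close> is the element of \<open>T\<close> whose prime filters form the inverse image of
  \<open>A\<close>. Phrasing this as a membership condition on elements of \<open>T\<close> avoids
  building a groupoid of prime filters. The hypothesis on \<open>\<theta>\<close> says exactly that
  the map lands in the universal groupoid. The obstacle is multiplication: if \<open>pre P\<close>
  is a product in \<open>S\<close>, then \<open>P\<close> has to be a product in \<open>T\<close>.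
  It is, because a filter containing a product of \<open>x\<close> and \<open>z\<close> factors in
  exactly one way through \<open>x\<close> and \<open>z\<close>, in \<open>S\<close> as well as in
  \<open>T\<close>, so factorizations lift along the map. That the sets \<open>U\<^sub>s\<close> and
  all products of compact-open bisections are compact rests on compactness of the basic open sets,
  which comes from Alexander's subbase theorem applied to a finer topology.\<close>

context inverse_semigroup
begin

abbreviation inv_elt :: "'a \<Rightarrow> 'a" ("\<iota>") where "\<iota> \<equiv> sinv S"
abbreviation ord_le :: "'a \<Rightarrow> 'a \<Rightarrow> bool" (infix "\<preceq>" 50) where "s \<preceq> t \<equiv> natural_le S s t"
abbreviation idems :: "'a set" ("\<E>") where "\<E> \<equiv> idempotents S"

lemma natural_le_iff: "s \<preceq> t \<longleftrightarrow> (\<exists>e\<in>\<E>. s = t \<cdot> e)"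
  by (simp add: natural_order_def)

lemma sinv_props:
  assumes "s \<in> carrier S"
  shows "\<iota> s \<in> carrier S" "s \<cdot> \<iota> s \<cdot> s = s" "\<iota> s \<cdot> s \<cdot> \<iota> s = \<iota> s"
  using theI'[OF unique_inverse[OF assms]] unfolding sinv_def by auto

lemma sinv_closed [simp, intro]: "s \<in> carrier S \<Longrightarrow> \<iota> s \<in> carrier S"
  by (rule sinv_props)

lemma sinv_eqI:
  assumes "s \<in> carrier S" "t \<in> carrier S" "s \<cdot> t \<cdot> s = s" "t \<cdot> s \<cdot> t = t"
  shows "\<iota> s = t"
  using unique_inverse[OF assms(1)] sinv_props[OF assms(1)] assms by blast

lemma idem_closed [simp]: "e \<in> \<E> \<Longrightarrow> e \<in> carrier S"
  by (simp add: idempotents_def)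

lemma idem_idem: "e \<in> \<E> \<Longrightarrow> e \<cdot> e = e"
  unfolding idempotents_def by blast

lemma idemI: "\<lbrakk>e \<in> carrier S; e \<cdot> e = e\<rbrakk> \<Longrightarrow> e \<in> \<E>"
  unfolding idempotents_def by blast

declare mul_closed [simp, intro]

lemma mul_sinv_cancel:
  assumes "s \<in> carrier S"
  shows "s \<cdot> (\<iota> s \<cdot> s) = s" "\<iota> s \<cdot> (s \<cdot> \<iota> s) = \<iota> s"
  using sinv_props[OF assms] assms by (simp_all add: mul_assoc)

lemma mul_sinv_cancel_left:
  assumes "s \<in> carrier S" "t \<in> carrier S"
  shows "s \<cdot> (\<iota> s \<cdot> (s \<cdot> t)) = s \<cdot> t" "\<iota> s \<cdot> (s \<cdot> (\<iota> s \<cdot> t)) = \<iota> s \<cdot> t"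
  using sinv_props[OF assms(1)] assms by (metis mul_assoc mul_closed)+

lemma idem_idem_left: "\<lbrakk>e \<in> \<E>; t \<in> carrier S\<rbrakk> \<Longrightarrow> e \<cdot> (e \<cdot> t) = e \<cdot> t"
  by (metis idem_closed idem_idem mul_assoc)

lemma sinv_sinv [simp]: "s \<in> carrier S \<Longrightarrow> \<iota> (\<iota> s) = s"
  by (rule sinv_eqI) (use sinv_props in auto)

lemma sinv_idem: "e \<in> \<E> \<Longrightarrow> \<iota> e = e"
  by (rule sinv_eqI) (auto simp: idem_idem)

text \<open>With \<open>x\<close> the inverse of \<open>e \<cdot> f\<close>, the element
  \<open>f \<cdot> x \<cdot> e\<close> is an inverse of \<open>e \<cdot> f\<close> as well, so
  uniqueness of inverses gives \<open>x = f \<cdot> x \<cdot> e\<close>. This makes \<open>x\<close>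
  idempotent, hence its own inverse, hence equal to \<open>e \<cdot> f\<close>.\<close>

lemma idem_mul_closed:
  assumes e: "e \<in> \<E>" and f: "f \<in> \<E>"
  shows "e \<cdot> f \<in> \<E>"
proof -
  define x where "x = \<iota> (e \<cdot> f)"
  note [simp] = idem_closed[OF e] idem_closed[OF f]
  have x [simp]: "x \<in> carrier S" by (simp add: x_def)
  have ef: "e \<cdot> f \<in> carrier S" by simp
  have c1: "e \<cdot> (f \<cdot> (x \<cdot> (e \<cdot> f))) = e \<cdot> f"
    using sinv_props(2)[OF ef] by (simp add: x_def[symmetric] mul_assoc)
  have c2: "x \<cdot> (e \<cdot> (f \<cdot> x)) = x"
    using sinv_props(3)[OF ef] by (simp add: x_def[symmetric] mul_assoc)
  have c2': "x \<cdot> (e \<cdot> (f \<cdot> (x \<cdot> e))) = x \<cdot> e"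
    using arg_cong[OF c2, of "\<lambda>y. y \<cdot> e"] by (simp add: mul_assoc)
  have "\<iota> (e \<cdot> f) = f \<cdot> x \<cdot> e"
    by (rule sinv_eqI)
      (simp_all add: mul_assoc idem_idem_left[OF e] idem_idem_left[OF f] c1 c2')
  then have fxe: "f \<cdot> (x \<cdot> e) = x" by (simp add: x_def[symmetric] mul_assoc)
  have "x \<cdot> x = (f \<cdot> (x \<cdot> e)) \<cdot> (f \<cdot> (x \<cdot> e))" by (simp add: fxe)
  also have "\<dots> = f \<cdot> (x \<cdot> (e \<cdot> (f \<cdot> (x \<cdot> e))))" by (simp add: mul_assoc)
  also have "\<dots> = x" unfolding c2' by (rule fxe)
  finally have "x \<in> \<E>" using x by (rule idemI[rotated])
  then have "\<iota> x = x" by (rule sinv_idem)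
  then have "e \<cdot> f = x" using sinv_sinv[OF ef] by (simp add: x_def)
  then show ?thesis using \<open>x \<in> \<E>\<close> by simp
qed

text \<open>Both products are idempotent, which makes \<open>f \<cdot> e\<close> an inverse of
  \<open>e \<cdot> f\<close>; but an idempotent is its own inverse.\<close>

lemma idem_commute:
  assumes e: "e \<in> \<E>" and f: "f \<in> \<E>"
  shows "e \<cdot> f = f \<cdot> e"
proof -
  note [simp] = idem_closed[OF e] idem_closed[OF f]
  have 1: "e \<cdot> (f \<cdot> (e \<cdot> f)) = e \<cdot> f" "f \<cdot> (e \<cdot> (f \<cdot> e)) = f \<cdot> e"
    using idem_idem[OF idem_mul_closed[OF e f]] idem_idem[OF idem_mul_closed[OF f e]]
    by (simp_all add: mul_assoc)
  have "\<iota> (e \<cdot> f) = f \<cdot> e"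
    by (rule sinv_eqI) (simp_all add: mul_assoc idem_idem_left[OF e] idem_idem_left[OF f] 1)
  then show ?thesis using sinv_idem[OF idem_mul_closed[OF e f]] by simp
qed

lemma idem_left_commute:
  "\<lbrakk>e \<in> \<E>; f \<in> \<E>; t \<in> carrier S\<rbrakk> \<Longrightarrow> e \<cdot> (f \<cdot> t) = f \<cdot> (e \<cdot> t)"
  by (metis idem_closed idem_commute mul_assoc)

lemma sinv_mul_idem [simp]: "s \<in> carrier S \<Longrightarrow> \<iota> s \<cdot> s \<in> \<E>"
  by (rule idemI) (simp_all add: mul_assoc mul_sinv_cancel_left)

lemma mul_sinv_idem [simp]: "s \<in> carrier S \<Longrightarrow> s \<cdot> \<iota> s \<in> \<E>"
  by (rule idemI) (simp_all add: mul_assoc mul_sinv_cancel_left)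

lemma sinv_mul:
  assumes s: "s \<in> carrier S" and t: "t \<in> carrier S"
  shows "\<iota> (s \<cdot> t) = \<iota> t \<cdot> \<iota> s"
proof (rule sinv_eqI)
  note [simp] = s t
  \<comment> \<open>These two idempotents meet in the middle of both sandwich products; commuting
    them is the whole argument.\<close>
  have c: "(t \<cdot> \<iota> t) \<cdot> (\<iota> s \<cdot> s) = (\<iota> s \<cdot> s) \<cdot> (t \<cdot> \<iota> t)"
    by (rule idem_commute) simp_all
  have "s \<cdot> t \<cdot> (\<iota> t \<cdot> \<iota> s) \<cdot> (s \<cdot> t) = s \<cdot> ((t \<cdot> \<iota> t) \<cdot> (\<iota> s \<cdot> s)) \<cdot> t"
    by (simp add: mul_assoc)
  also have "\<dots> = s \<cdot> t"
    unfolding c by (simp add: mul_assoc mul_sinv_cancel mul_sinv_cancel_left)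
  finally show "s \<cdot> t \<cdot> (\<iota> t \<cdot> \<iota> s) \<cdot> (s \<cdot> t) = s \<cdot> t" .
  have "\<iota> t \<cdot> \<iota> s \<cdot> (s \<cdot> t) \<cdot> (\<iota> t \<cdot> \<iota> s) = \<iota> t \<cdot> ((\<iota> s \<cdot> s) \<cdot> (t \<cdot> \<iota> t)) \<cdot> \<iota> s"
    by (simp add: mul_assoc)
  also have "\<dots> = \<iota> t \<cdot> \<iota> s"
    unfolding c[symmetric] by (simp add: mul_assoc mul_sinv_cancel mul_sinv_cancel_left)
  finally show "\<iota> t \<cdot> \<iota> s \<cdot> (s \<cdot> t) \<cdot> (\<iota> t \<cdot> \<iota> s) = \<iota> t \<cdot> \<iota> s" .
qed (use s t in auto)

lemma idem_conj:
  assumes e: "e \<in> \<E>" and s: "s \<in> carrier S"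
  shows "s \<cdot> (e \<cdot> \<iota> s) \<in> \<E>"
proof -
  note [simp] = idem_closed[OF e] s
  have "(s \<cdot> (e \<cdot> \<iota> s)) \<cdot> (s \<cdot> (e \<cdot> \<iota> s)) = s \<cdot> (e \<cdot> ((\<iota> s \<cdot> s) \<cdot> (e \<cdot> \<iota> s)))"
    by (simp add: mul_assoc)
  also have "\<dots> = s \<cdot> (e \<cdot> \<iota> s)"
    using e idem_left_commute[of "\<iota> s \<cdot> s" e "\<iota> s"]
    by (simp add: idem_idem_left mul_assoc mul_sinv_cancel)
  finally show ?thesis by (intro idemI) simp_all
qed

text \<open>Moves an idempotent from the right of \<open>s\<close> to its left, as the conjugate of
  \<open>e\<close> by \<open>s\<close>. The natural order is defined by right multiplication only,
  and this is what makes it two-sided.\<close>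

lemma mul_idem_swap:
  assumes e: "e \<in> \<E>" and s: "s \<in> carrier S"
  shows "s \<cdot> e = s \<cdot> (e \<cdot> \<iota> s) \<cdot> s"
proof -
  note [simp] = idem_closed[OF e] s
  have "s \<cdot> e = s \<cdot> ((\<iota> s \<cdot> s) \<cdot> e)"
    by (simp add: mul_assoc mul_sinv_cancel_left)
  also have "(\<iota> s \<cdot> s) \<cdot> e = e \<cdot> (\<iota> s \<cdot> s)" using e by (intro idem_commute) simp_all
  finally show ?thesis by (simp add: mul_assoc)
qed

section \<open>The natural partial order\<close>

lemma leI_right: "e \<in> \<E> \<Longrightarrow> t \<cdot> e \<preceq> t"
  by (auto simp: natural_le_iff)

lemma leI_left:
  assumes e: "e \<in> \<E>" and t: "t \<in> carrier S"
  shows "e \<cdot> t \<preceq> t"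
proof -
  have "e \<cdot> t = t \<cdot> (\<iota> t \<cdot> (e \<cdot> \<iota> (\<iota> t)))"
    using mul_idem_swap[OF mul_sinv_idem[OF t], of e] e t
      idem_left_commute[OF e mul_sinv_idem[OF t] t]
    by (simp add: mul_assoc mul_sinv_cancel)
  then show ?thesis
    using idem_conj[OF e sinv_closed[OF t]] by (auto simp: natural_le_iff)
qed

text \<open>The existential witness of \<open>s \<preceq> t\<close> can always be taken to be
  \<open>\<iota> s \<cdot> s\<close>: if \<open>s = t \<cdot> e\<close>, this is the product of
  \<open>e\<close> and \<open>\<iota> t \<cdot> t\<close>, and \<open>t\<close> absorbs the
  latter.\<close>

lemma le_right:
  assumes "s \<preceq> t" "t \<in> carrier S"
  shows "t \<cdot> (\<iota> s \<cdot> s) = s"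
proof -
  from assms obtain e where e: "e \<in> \<E>" and s: "s = t \<cdot> e" by (auto simp: natural_le_iff)
  note [simp] = idem_closed[OF e] assms(2)
  have "t \<cdot> (\<iota> s \<cdot> s) = t \<cdot> (e \<cdot> ((\<iota> t \<cdot> t) \<cdot> e))"
    by (simp add: s sinv_mul sinv_idem[OF e] mul_assoc)
  also have "e \<cdot> ((\<iota> t \<cdot> t) \<cdot> e) = (\<iota> t \<cdot> t) \<cdot> e"
    using idem_left_commute[OF e sinv_mul_idem[OF assms(2)], of e] idem_idem[OF e] by simp
  also have "t \<cdot> (\<iota> t \<cdot> t \<cdot> e) = t \<cdot> e"
    by (simp add: mul_assoc mul_sinv_cancel_left)
  finally show ?thesis by (simp add: s)
qed

lemma le_closed: "\<lbrakk>s \<preceq> t; t \<in> carrier S\<rbrakk> \<Longrightarrow> s \<in> carrier S"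
  by (auto simp: natural_le_iff)

lemma le_refl [simp]: "s \<in> carrier S \<Longrightarrow> s \<preceq> s"
  using leI_right[of "\<iota> s \<cdot> s" s] by (simp add: mul_sinv_cancel)

lemma le_trans: "\<lbrakk>s \<preceq> t; t \<preceq> u; u \<in> carrier S\<rbrakk> \<Longrightarrow> s \<preceq> u"
  by (auto simp: natural_le_iff mul_assoc intro: idem_mul_closed)

lemma le_antisym:
  assumes "s \<preceq> t" "t \<preceq> s" "t \<in> carrier S"
  shows "s = t"
proof -
  from assms obtain e f where e: "e \<in> \<E>" "s = t \<cdot> e" and f: "f \<in> \<E>" "t = s \<cdot> f"
    by (auto simp: natural_le_iff)
  note [simp] = idem_closed[OF e(1)] idem_closed[OF f(1)] assms(3)
  have s [simp]: "s \<in> carrier S" using le_closed assms by blast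
  have "t \<cdot> f = s \<cdot> (f \<cdot> f)" using arg_cong[OF f(2), of "\<lambda>x. x \<cdot> f"] by (simp add: mul_assoc)
  then have tf: "t \<cdot> f = t" using f idem_idem by simp
  have "t = t \<cdot> (e \<cdot> f)" using trans[OF f(2) arg_cong[OF e(2), of "\<lambda>x. x \<cdot> f"]] by (simp add: mul_assoc)
  also have "\<dots> = (t \<cdot> f) \<cdot> e" using e(1) f(1) by (simp add: idem_commute mul_assoc)
  finally show ?thesis using e(2) tf by simp
qed

lemma le_mul_left: "\<lbrakk>s \<preceq> t; t \<in> carrier S; u \<in> carrier S\<rbrakk> \<Longrightarrow> u \<cdot> s \<preceq> u \<cdot> t"
  by (auto simp: natural_le_iff mul_assoc[symmetric])

lemma le_mul_right:
  assumes "s \<preceq> t" "t \<in> carrier S" "u \<in> carrier S"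
  shows "s \<cdot> u \<preceq> t \<cdot> u"
proof -
  from assms obtain e where e: "e \<in> \<E>" and s: "s = t \<cdot> e" by (auto simp: natural_le_iff)
  show ?thesis
    using le_mul_left[OF leI_left[OF e assms(3)] _ assms(2)] e assms by (simp add: s mul_assoc)
qed

lemma le_mul: "\<lbrakk>s \<preceq> t; u \<preceq> v; t \<in> carrier S; v \<in> carrier S\<rbrakk> \<Longrightarrow> s \<cdot> u \<preceq> t \<cdot> v"
  by (meson le_closed le_mul_left le_mul_right le_trans mul_closed)

lemma le_sinv:
  assumes "s \<preceq> t" "t \<in> carrier S"
  shows "\<iota> s \<preceq> \<iota> t"
proof -
  from assms obtain e where e: "e \<in> \<E>" and s: "s = t \<cdot> e" by (auto simp: natural_le_iff)
  then show ?thesis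
    using leI_left[OF e sinv_closed[OF assms(2)]] assms by (simp add: sinv_mul sinv_idem)
qed

text \<open>Inversion preserves the order, so this is \<open>le_right\<close> for
  \<open>\<iota> s\<close> and \<open>\<iota> t\<close>, inverted once more.\<close>

lemma le_left:
  assumes "s \<preceq> t" "t \<in> carrier S"
  shows "s \<cdot> (\<iota> s \<cdot> t) = s"
proof -
  have s: "s \<in> carrier S" using assms by (rule le_closed)
  have "\<iota> t \<cdot> (s \<cdot> \<iota> s) = \<iota> s"
    using le_right[OF le_sinv[OF assms]] assms s by simp
  from arg_cong[OF this, of \<iota>] show ?thesis
    using assms s by (simp add: sinv_mul mul_assoc)
qed

lemma idem_le:
  assumes "s \<preceq> e" "e \<in> \<E>"
  shows "s \<in> \<E>"
  using assms by (auto simp: natural_le_iff intro: idem_mul_closed)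

lemma le_cancel_left: "\<lbrakk>s \<in> carrier S; t \<in> carrier S\<rbrakk> \<Longrightarrow> s \<cdot> (\<iota> s \<cdot> t) \<preceq> t"
  using leI_left[OF mul_sinv_idem, of s t] by (simp add: mul_assoc)

lemma le_cancel_left': "\<lbrakk>s \<in> carrier S; t \<in> carrier S\<rbrakk> \<Longrightarrow> \<iota> s \<cdot> (s \<cdot> t) \<preceq> t"
  using le_cancel_left[of "\<iota> s" t] by simp

lemma le_cancel_right: "\<lbrakk>s \<in> carrier S; t \<in> carrier S\<rbrakk> \<Longrightarrow> t \<cdot> (\<iota> s \<cdot> s) \<preceq> t"
  by (rule leI_right) simp

lemma le_cancel_right': "\<lbrakk>s \<in> carrier S; t \<in> carrier S\<rbrakk> \<Longrightarrow> t \<cdot> (s \<cdot> \<iota> s) \<preceq> t"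
  by (rule leI_right) simp

text \<open>The product \<open>\<iota> s \<cdot> t\<close> lies below
  \<open>\<iota> u \<cdot> u\<close>, likewise on the other side, and below an idempotent there are
  only idempotents.\<close>

lemma le_imp_compatible:
  assumes "s \<preceq> u" "t \<preceq> u" "u \<in> carrier S"
  shows "compatible S s t"
proof -
  have "\<iota> s \<cdot> t \<preceq> \<iota> u \<cdot> u" "s \<cdot> \<iota> t \<preceq> u \<cdot> \<iota> u"
    using le_mul[OF le_sinv[OF assms(1,3)] assms(2)] le_mul[OF assms(1) le_sinv[OF assms(2,3)]]
      assms(3) by simp_all
  then show ?thesis
    using idem_le sinv_mul_idem mul_sinv_idem assms(3) unfolding compatible_def by blast
qed

lemma is_join_iff:
  "A \<subseteq> carrier S \<Longrightarrow> is_join S a A \<longleftrightarrow> a \<in> carrier S \<and> (\<forall>x\<in>A. x \<preceq> a) \<and>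
     (\<forall>b\<in>carrier S. (\<forall>x\<in>A. x \<preceq> b) \<longrightarrow> a \<preceq> b)"
proof -
  assume A: "A \<subseteq> carrier S"
  have c: "carrier (natural_order S) = carrier S" by (simp add: natural_order_def)
  have "Upper (natural_order S) A = {b \<in> carrier S. \<forall>x\<in>A. x \<preceq> b}"
    unfolding Upper_def c using A by blast
  then show ?thesis by (auto simp: least_def c)
qed

lemma is_zero_least: "\<lbrakk>is_zero S z; s \<in> carrier S\<rbrakk> \<Longrightarrow> z \<preceq> s"
  unfolding is_zero_def natural_le_iff idempotents_def by (metis (mono_tags, lifting) mem_Collect_eq)

lemma le_zero: "\<lbrakk>s \<preceq> z; is_zero S z\<rbrakk> \<Longrightarrow> s = z"
  unfolding is_zero_def natural_le_iff by auto

end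

section \<open>Bisections of a groupoid\<close>

text \<open>The record \<open>top_groupoid\<close> carries data only; these are the groupoid laws,
  with composition restricted to composable pairs. The calculus of bisections is developed from them
  alone, without reference to filters.\<close>

locale small_groupoid =
  fixes G :: "('g, 'm) top_groupoid_scheme"
  assumes gdom_closed [simp]: "a \<in> carrier G \<Longrightarrow> gdom G a \<in> carrier G"
    and gran_closed [simp]: "a \<in> carrier G \<Longrightarrow> gran G a \<in> carrier G"
    and ginv_closed [simp]: "a \<in> carrier G \<Longrightarrow> ginv G a \<in> carrier G"
    and gcomp_closed [simp]: "\<lbrakk>a \<in> carrier G; b \<in> carrier G; gdom G a = gran G b\<rbrakk>
      \<Longrightarrow> gcomp G a b \<in> carrier G"
    and gdom_gdom [simp]: "a \<in> carrier G \<Longrightarrow> gdom G (gdom G a) = gdom G a"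
    and gran_gdom [simp]: "a \<in> carrier G \<Longrightarrow> gran G (gdom G a) = gdom G a"
    and gdom_gcomp [simp]: "\<lbrakk>a \<in> carrier G; b \<in> carrier G; gdom G a = gran G b\<rbrakk>
      \<Longrightarrow> gdom G (gcomp G a b) = gdom G b"
    and gran_gcomp [simp]: "\<lbrakk>a \<in> carrier G; b \<in> carrier G; gdom G a = gran G b\<rbrakk>
      \<Longrightarrow> gran G (gcomp G a b) = gran G a"
    and gcomp_assoc: "\<lbrakk>a \<in> carrier G; b \<in> carrier G; c \<in> carrier G;
        gdom G a = gran G b; gdom G b = gran G c\<rbrakk>
      \<Longrightarrow> gcomp G (gcomp G a b) c = gcomp G a (gcomp G b c)"
    and gcomp_gdom [simp]: "a \<in> carrier G \<Longrightarrow> gcomp G a (gdom G a) = a"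
    and gran_gcomp_id [simp]: "a \<in> carrier G \<Longrightarrow> gcomp G (gran G a) a = a"
    and gdom_ginv [simp]: "a \<in> carrier G \<Longrightarrow> gdom G (ginv G a) = gran G a"
    and gran_ginv [simp]: "a \<in> carrier G \<Longrightarrow> gran G (ginv G a) = gdom G a"
    and ginv_gcomp [simp]: "a \<in> carrier G \<Longrightarrow> gcomp G (ginv G a) a = gdom G a"
    and gcomp_ginv [simp]: "a \<in> carrier G \<Longrightarrow> gcomp G a (ginv G a) = gran G a"


context small_groupoid
begin

lemma identities_iff: "i \<in> identities G \<longleftrightarrow> i \<in> carrier G \<and> gdom G i = i"
  unfolding identities_def by (auto simp: image_iff) (metis)

lemma gdom_in_identities: "a \<in> carrier G \<Longrightarrow> gdom G a \<in> identities G"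
  by (simp add: identities_iff)

lemma gran_in_identities: "a \<in> carrier G \<Longrightarrow> gran G a \<in> identities G"
  using gdom_in_identities[of "ginv G a"] by simp

lemma gdom_gran [simp]: "a \<in> carrier G \<Longrightarrow> gdom G (gran G a) = gran G a"
  using gran_in_identities by (simp add: identities_iff)

lemma gran_identity: "i \<in> identities G \<Longrightarrow> gran G i = i"
  by (metis identities_iff gran_gdom)

lemma ginv_ginv [simp]: "a \<in> carrier G \<Longrightarrow> ginv G (ginv G a) = a"
proof -
  assume a: "a \<in> carrier G"
  define x where "x = ginv G (ginv G a)"
  have x: "x \<in> carrier G" "gdom G x = gdom G a" using a by (simp_all add: x_def)
  have "x = gcomp G x (gcomp G (ginv G a) a)" using a x by (metis ginv_gcomp gcomp_gdom)
  also have "\<dots> = gcomp G (gcomp G x (ginv G a)) a" using a x by (simp add: gcomp_assoc)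
  also have "gcomp G x (ginv G a) = gran G a"
    unfolding x_def using a by (metis gdom_ginv ginv_closed ginv_gcomp)
  finally show ?thesis using a by (simp add: x_def)
qed

text \<open>Composing the sandwich equation with \<open>ginv G a\<close> on the right gives
  \<open>gcomp G a b = gran G a\<close>, and composing that on the left isolates
  \<open>b\<close>.\<close>

lemma gcomp_sandwich:
  assumes a: "a \<in> carrier G" and b: "b \<in> carrier G"
    and ab: "gdom G a = gran G b" and ba: "gdom G b = gran G a"
    and eq: "gcomp G (gcomp G a b) a = a"
  shows "b = ginv G a"
proof -
  have "gcomp G a b = gcomp G (gcomp G (gcomp G a b) a) (ginv G a)"
    using a b ab by (simp add: gcomp_assoc flip: ba)
  also have "\<dots> = gran G a" using a by (simp add: eq)
  finally have 1: "gcomp G a b = gran G a" .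
  have "b = gcomp G (gcomp G (ginv G a) a) b" using a b ab by simp
  also have "\<dots> = gcomp G (ginv G a) (gcomp G a b)" using a b ab by (intro gcomp_assoc) simp_all
  also have "\<dots> = ginv G a" using a by (metis 1 gcomp_gdom gdom_ginv ginv_closed)
  finally show ?thesis .
qed

lemma subset_mulI:
  "\<lbrakk>a \<in> A; b \<in> B; gdom G a = gran G b\<rbrakk> \<Longrightarrow> gcomp G a b \<in> subset_mul G A B"
  unfolding subset_mul_def by blast

lemma subset_mulE:
  assumes "x \<in> subset_mul G A B"
  obtains a b where "a \<in> A" "b \<in> B" "gdom G a = gran G b" "x = gcomp G a b"
  using assms unfolding subset_mul_def by blast

lemma bisection_subset: "bisection G A \<Longrightarrow> A \<subseteq> carrier G"
  unfolding bisection_def by blast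

text \<open>The composite of \<open>a\<close> with the inverse of \<open>b\<close> is an identity,
  hence its own domain, which is \<open>gran G b\<close>. Composing with \<open>b\<close> on the
  right gives \<open>a\<close> when the inverse is cancelled, and \<open>b\<close> when the identity
  is.\<close>

lemma bisection_gdom_inj:
  assumes A: "A \<subseteq> carrier G" "subset_mul G A (ginv G ` A) \<subseteq> identities G"
    and ab: "a \<in> A" "b \<in> A" "gdom G a = gdom G b"
  shows "a = b"
proof -
  have c: "a \<in> carrier G" "b \<in> carrier G" using A ab by auto
  have "gcomp G a (ginv G b) \<in> subset_mul G A (ginv G ` A)"
    unfolding subset_mul_def using ab c by force
  then have i: "gcomp G a (ginv G b) \<in> identities G" using A by blast
  then have "gcomp G a (ginv G b) = gdom G (gcomp G a (ginv G b))" by (simp add: identities_iff)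
  then have 1: "gcomp G a (ginv G b) = gran G b" using c ab by simp
  have "a = gcomp G a (gcomp G (ginv G b) b)" using c ab by (metis gcomp_gdom ginv_gcomp)
  also have "\<dots> = gcomp G (gcomp G a (ginv G b)) b" using c ab by (simp add: gcomp_assoc)
  finally show "a = b" using 1 c by simp
qed

lemma bisection_gran_inj:
  assumes A: "A \<subseteq> carrier G" "subset_mul G (ginv G ` A) A \<subseteq> identities G"
    and ab: "a \<in> A" "b \<in> A" "gran G a = gran G b"
  shows "a = b"
proof -
  have c: "a \<in> carrier G" "b \<in> carrier G" using A ab by auto
  have "gcomp G (ginv G a) b \<in> subset_mul G (ginv G ` A) A"
    unfolding subset_mul_def using ab c by force
  then have i: "gcomp G (ginv G a) b \<in> identities G" using A by blast
  then have "gcomp G (ginv G a) b = gran G (gcomp G (ginv G a) b)" by (simp add: gran_identity)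
  then have 1: "gcomp G (ginv G a) b = gdom G a" using c ab by simp
  have "b = gcomp G (gcomp G a (ginv G a)) b" using c ab by simp
  also have "\<dots> = gcomp G a (gcomp G (ginv G a) b)" using c ab by (intro gcomp_assoc) simp_all
  finally show "a = b" using 1 c by simp
qed

text \<open>The working form of the notion: an element of a bisection is identified by either of its
  ends, so computations with products reduce to comparing ends.\<close>

lemma bisection_iff:
  "bisection G A \<longleftrightarrow> A \<subseteq> carrier G \<and> inj_on (gdom G) A \<and> inj_on (gran G) A"
proof
  assume "bisection G A"
  then show "A \<subseteq> carrier G \<and> inj_on (gdom G) A \<and> inj_on (gran G) A"
    unfolding bisection_def inj_on_def using bisection_gdom_inj bisection_gran_inj by blast
next
  assume *: "A \<subseteq> carrier G \<and> inj_on (gdom G) A \<and> inj_on (gran G) A"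
  then have C: "\<And>a. a \<in> A \<Longrightarrow> a \<in> carrier G" by blast
  have "gcomp G (ginv G a) b \<in> identities G" if "a \<in> A" "b \<in> A" "gdom G (ginv G a) = gran G b" for a b
  proof -
    have "a = b" by (rule inj_onD[of "gran G" A]) (use that C[OF that(1)] * in simp_all)
    then show ?thesis using C[OF that(1)] by (simp add: gdom_in_identities)
  qed
  moreover have "gcomp G a (ginv G b) \<in> identities G"
    if "a \<in> A" "b \<in> A" "gdom G a = gran G (ginv G b)" for a b
  proof -
    have "a = b" by (rule inj_onD[of "gdom G" A]) (use that C[OF that(2)] * in simp_all)
    then show ?thesis using C[OF that(2)] by (simp add: gran_in_identities)
  qed
  ultimately show "bisection G A"
    unfolding bisection_def subset_mul_def using * by blast
qed

lemma bisection_injD: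
  assumes "bisection G A" "a \<in> A" "b \<in> A" "gran G a = gran G b \<or> gdom G a = gdom G b"
  shows "a = b"
  using assms unfolding bisection_iff inj_on_def by blast

lemma subset_mul_mono: "\<lbrakk>A \<subseteq> A'; B \<subseteq> B'\<rbrakk> \<Longrightarrow> subset_mul G A B \<subseteq> subset_mul G A' B'"
  unfolding subset_mul_def by blast

lemma subset_mul_Union:
  "subset_mul G (\<Union>\<A>) (\<Union>\<B>) = \<Union>((\<lambda>(A, B). subset_mul G A B) ` (\<A> \<times> \<B>))" (is "?L = ?R")
proof (intro equalityI subsetI)
  fix x assume "x \<in> ?L"
  then obtain a b where ab: "a \<in> \<Union>\<A>" "b \<in> \<Union>\<B>" "gdom G a = gran G b" "x = gcomp G a b"
    by (rule subset_mulE)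
  then obtain A B where "A \<in> \<A>" "B \<in> \<B>" "a \<in> A" "b \<in> B" by blast
  then have "x \<in> subset_mul G A B" "(A, B) \<in> \<A> \<times> \<B>" using ab subset_mulI by auto
  then show "x \<in> ?R" by (intro UN_I[of "(A, B)"]) simp_all
next
  fix x assume "x \<in> ?R"
  then obtain A B where AB: "A \<in> \<A>" "B \<in> \<B>" "x \<in> subset_mul G A B" by auto
  then have "subset_mul G A B \<subseteq> ?L" by (intro subset_mul_mono) auto
  then show "x \<in> ?L" using AB(3) by blast
qed

lemma subset_mul_closed:
  "\<lbrakk>A \<subseteq> carrier G; B \<subseteq> carrier G\<rbrakk> \<Longrightarrow> subset_mul G A B \<subseteq> carrier G"
  unfolding subset_mul_def by (auto simp: subset_iff)

lemma bisection_subset_mul: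
  assumes A: "bisection G A" and B: "bisection G B"
  shows "bisection G (subset_mul G A B)"
proof -
  have C: "\<And>a. a \<in> A \<Longrightarrow> a \<in> carrier G" "\<And>b. b \<in> B \<Longrightarrow> b \<in> carrier G"
    using assms bisection_subset by auto
  \<comment> \<open>The domain of a composite is that of its right factor, so equal domains give
    \<open>b = b'\<close>; the range of \<open>b\<close> is the domain of both left factors, which
    gives \<open>a = a'\<close>. Ranges work from the other side.\<close>
  have inj: "gcomp G a b = gcomp G a' b'"
    if "a \<in> A" "b \<in> B" "gdom G a = gran G b" "a' \<in> A" "b' \<in> B" "gdom G a' = gran G b'"
      "gdom G (gcomp G a b) = gdom G (gcomp G a' b') \<or> gran G (gcomp G a b) = gran G (gcomp G a' b')"
    for a b a' b'
    using that(7)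
  proof
    assume "gdom G (gcomp G a b) = gdom G (gcomp G a' b')"
    then have "b = b'" using that C by (intro bisection_injD[OF B]) auto
    moreover from this have "a = a'" using that by (intro bisection_injD[OF A]) auto
    ultimately show ?thesis by simp
  next
    assume "gran G (gcomp G a b) = gran G (gcomp G a' b')"
    then have "a = a'" using that C by (intro bisection_injD[OF A]) auto
    moreover from this have "b = b'" using that by (intro bisection_injD[OF B]) auto
    ultimately show ?thesis by simp
  qed
  show ?thesis
    unfolding bisection_iff
  proof (intro conjI inj_onI)
    show "subset_mul G A B \<subseteq> carrier G" by (rule subset_mul_closed) (use C in auto)
  next
    fix x y assume "x \<in> subset_mul G A B" "y \<in> subset_mul G A B" and d: "gdom G x = gdom G y"
    then obtain a b a' b' where ab: "a \<in> A" "b \<in> B" "gdom G a = gran G b" "a' \<in> A" "b' \<in> B"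
        "gdom G a' = gran G b'" and xy: "x = gcomp G a b" "y = gcomp G a' b'"
      unfolding subset_mul_def by blast
    show "x = y" unfolding xy by (rule inj[OF ab disjI1[OF d[unfolded xy]]])
  next
    fix x y assume "x \<in> subset_mul G A B" "y \<in> subset_mul G A B" and d: "gran G x = gran G y"
    then obtain a b a' b' where ab: "a \<in> A" "b \<in> B" "gdom G a = gran G b" "a' \<in> A" "b' \<in> B"
        "gdom G a' = gran G b'" and xy: "x = gcomp G a b" "y = gcomp G a' b'"
      unfolding subset_mul_def by blast
    show "x = y" unfolding xy by (rule inj[OF ab disjI2[OF d[unfolded xy]]])
  qed
qed

lemma bisection_ginv:
  assumes A: "bisection G A"
  shows "bisection G (ginv G ` A)"
  using A unfolding bisection_iff inj_on_def by (auto simp: subset_iff)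

lemma subset_mul_identities_right:
  assumes "A \<subseteq> carrier G" "E \<subseteq> identities G"
  shows "subset_mul G A E \<subseteq> A"
proof
  fix x assume "x \<in> subset_mul G A E"
  then obtain a e where ae: "a \<in> A" "e \<in> E" "gdom G a = gran G e" "x = gcomp G a e"
    by (rule subset_mulE)
  then have "e = gdom G a" using assms gran_identity[of e] by auto
  then show "x \<in> A" using ae assms by auto
qed

text \<open>Inside a bisection, the inverse of \<open>A\<close> times \<open>A\<close> is the set of
  domains of \<open>A\<close>, and multiplying \<open>B\<close> by it keeps just the elements of
  \<open>B\<close> with these domains. This supplies the idempotent that turns inclusion into the
  natural order.\<close>

lemma subset_mul_restrict:
  assumes B: "bisection G B" and A: "A \<subseteq> B"
  shows "subset_mul G B (subset_mul G (ginv G ` A) A) = A"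
proof -
  have inj: "a = b" if "a \<in> B" "b \<in> B" "gran G a = gran G b \<or> gdom G a = gdom G b" for a b
    using bisection_injD[OF B] that by blast
  have AC: "a \<in> carrier G" if "a \<in> B" for a using bisection_subset[OF B] that by blast
  have 1: "subset_mul G (ginv G ` A) A = gdom G ` A"
  proof (intro equalityI subsetI)
    fix x assume "x \<in> subset_mul G (ginv G ` A) A"
    then obtain a b where ab: "a \<in> A" "b \<in> A" "gdom G (ginv G a) = gran G b" "x = gcomp G (ginv G a) b"
      by (auto elim: subset_mulE)
    have "a = b" by (rule inj) (use ab A AC in auto)
    then show "x \<in> gdom G ` A" using ab AC A by auto
  next
    fix x assume "x \<in> gdom G ` A"
    then obtain a where a: "a \<in> A" "x = gdom G a" by blast
    then have "gcomp G (ginv G a) a \<in> subset_mul G (ginv G ` A) A"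
      using A AC by (intro subset_mulI) auto
    then show "x \<in> subset_mul G (ginv G ` A) A" using a A AC by auto
  qed
  show ?thesis
    unfolding 1
  proof (intro equalityI subsetI)
    fix x assume "x \<in> subset_mul G B (gdom G ` A)"
    then obtain b a where ab: "b \<in> B" "a \<in> A" "gdom G b = gran G (gdom G a)" "x = gcomp G b (gdom G a)"
      by (auto elim: subset_mulE)
    have "b = a" by (rule inj) (use ab A AC in auto)
    then show "x \<in> A" using ab AC A by auto
  next
    fix a assume a: "a \<in> A"
    then have "gcomp G a (gdom G a) \<in> subset_mul G B (gdom G ` A)"
      using A AC by (intro subset_mulI) auto
    then show "a \<in> subset_mul G B (gdom G ` A)" using a A AC by auto
  qed
qed

text \<open>If \<open>a\<close> is the composite of \<open>b\<close> and \<open>c\<close>, all in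
  \<open>A\<close>, then \<open>b\<close> shares the range of \<open>a\<close> and \<open>c\<close>
  its domain, so both equal \<open>a\<close>; a groupoid element that squares to itself is an
  identity.\<close>

lemma subset_mul_idem_imp_identities:
  assumes A: "bisection G A" and eq: "subset_mul G A A = A"
  shows "A \<subseteq> identities G"
proof
  fix a assume a: "a \<in> A"
  have inj: "a = b" if "a \<in> A" "b \<in> A" "gran G a = gran G b \<or> gdom G a = gdom G b" for a b
    using bisection_injD[OF A] that by blast
  from a obtain b c where bc: "b \<in> A" "c \<in> A" "gdom G b = gran G c" "a = gcomp G b c"
    using eq by (metis subset_mulE)
  have C: "a \<in> carrier G" "b \<in> carrier G" "c \<in> carrier G" using bisection_subset[OF A] a bc by auto
  have "a = b" "a = c" by (rule inj; use a bc C in auto)+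
  then have aa: "gcomp G a a = a" "gdom G a = gran G a" using bc by auto
  then have "gcomp G (ginv G a) (gcomp G a a) = gdom G a" using C by simp
  moreover have "gcomp G (ginv G a) (gcomp G a a) = gcomp G (gcomp G (ginv G a) a) a"
    using C aa by (intro gcomp_assoc[symmetric]) simp_all
  ultimately have "a = gdom G a" using C aa by simp
  then show "a \<in> identities G" using C by (simp add: identities_iff)
qed

lemma subset_mul_identities:
  assumes "E \<subseteq> identities G"
  shows "subset_mul G E E = E"
proof
  have E: "E \<subseteq> carrier G" using assms identities_iff by blast
  show "subset_mul G E E \<subseteq> E" by (rule subset_mul_identities_right[OF E assms])
  have "e = gcomp G e e \<and> gdom G e = gran G e" if "e \<in> E" for e
    using that assms by (metis gcomp_gdom gran_identity identities_iff subsetD)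
  then show "E \<subseteq> subset_mul G E E" using subset_mulI[of _ E _ E] by (metis subsetI)
qed

text \<open>One of the two inclusions behind uniqueness of inverses among bisections. When
  \<open>a\<close> is a composite of \<open>a'\<close>, \<open>b\<close> and \<open>a''\<close>,
  injectivity forces \<open>a' = a'' = a\<close>, and the sandwich equation then determines
  \<open>b\<close>.\<close>

lemma subset_mul_sandwich_subset:
  assumes A: "bisection G A" and B: "B \<subseteq> carrier G"
    and eq: "subset_mul G (subset_mul G A B) A = A"
  shows "ginv G ` A \<subseteq> B"
proof
  fix x assume "x \<in> ginv G ` A"
  then obtain a where a: "a \<in> A" "x = ginv G a" by blast
  have inj: "a = b" if "a \<in> A" "b \<in> A" "gran G a = gran G b \<or> gdom G a = gdom G b" for a b
    using bisection_injD[OF A] that by blast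
  from a eq obtain u a'' where u: "u \<in> subset_mul G A B" "a'' \<in> A" "gdom G u = gran G a''"
    "a = gcomp G u a''"
    by (metis subset_mulE)
  then obtain a' b where b: "a' \<in> A" "b \<in> B" "gdom G a' = gran G b" "u = gcomp G a' b"
    by (metis subset_mulE)
  have C: "a' \<in> carrier G" "b \<in> carrier G" "a'' \<in> carrier G" "a \<in> carrier G"
    using bisection_subset[OF A] B a b u by auto
  have "a = a'" "a = a''" by (rule inj; use a b u C in auto)+
  then have "b = ginv G a" using u b C by (intro gcomp_sandwich) auto
  then show "x \<in> B" using a b by simp
qed

lemma subset_mul_ginv_sandwich:
  assumes A: "bisection G A"
  shows "subset_mul G (subset_mul G A (ginv G ` A)) A = A"
    and "subset_mul G (subset_mul G (ginv G ` A) A) (ginv G ` A) = ginv G ` A"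
proof -
  have *: "subset_mul G (subset_mul G A (ginv G ` A)) A = A" if A: "bisection G A" for A
  proof -
    have inj: "a = b" if "a \<in> A" "b \<in> A" "gran G a = gran G b \<or> gdom G a = gdom G b" for a b
      using bisection_injD[OF A] that by blast
    have AC: "a \<in> carrier G" if "a \<in> A" for a using bisection_subset[OF A] that by blast
    show ?thesis
    proof (intro equalityI subsetI)
      fix x assume "x \<in> subset_mul G (subset_mul G A (ginv G ` A)) A"
      then obtain a b c where abc: "a \<in> A" "b \<in> A" "c \<in> A" "gdom G a = gran G (ginv G b)"
          "gdom G (gcomp G a (ginv G b)) = gran G c" "x = gcomp G (gcomp G a (ginv G b)) c"
        by (auto elim!: subset_mulE)
      have 1: "a = b" by (rule inj) (use abc AC in auto)
      have "a = c" by (rule inj) (use 1 abc AC in auto)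
      then show "x \<in> A" using 1 abc AC by simp
    next
      fix a assume a: "a \<in> A"
      then have "gcomp G (gcomp G a (ginv G a)) a \<in> subset_mul G (subset_mul G A (ginv G ` A)) A"
        using AC by (intro subset_mulI) auto
      then show "a \<in> subset_mul G (subset_mul G A (ginv G ` A)) A" using a AC by simp
    qed
  qed
  show "subset_mul G (subset_mul G A (ginv G ` A)) A = A" by (rule *[OF A])
  have "ginv G ` ginv G ` A = A"
    using bisection_subset[OF A] by (force simp: image_iff)
  then show "subset_mul G (subset_mul G (ginv G ` A) A) (ginv G ` A) = ginv G ` A"
    using *[OF bisection_ginv[OF A]] by simp
qed

lemma bisection_Union:
  assumes A: "\<And>A. A \<in> \<A> \<Longrightarrow> bisection G A"
    and AB: "\<And>A B. \<lbrakk>A \<in> \<A>; B \<in> \<A>\<rbrakk> \<Longrightarrow> subset_mul G (ginv G ` A) B \<subseteq> identities G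
      \<and> subset_mul G A (ginv G ` B) \<subseteq> identities G"
  shows "bisection G (\<Union>\<A>)"
  unfolding bisection_def
proof (intro conjI)
  show "\<Union>\<A> \<subseteq> carrier G" using A bisection_subset by blast
  show "subset_mul G (ginv G ` \<Union>\<A>) (\<Union>\<A>) \<subseteq> identities G"
    using AB unfolding subset_mul_def by blast
  show "subset_mul G (\<Union>\<A>) (ginv G ` \<Union>\<A>) \<subseteq> identities G"
    using AB unfolding subset_mul_def by blast
qed

lemma KB_iff: "A \<in> carrier (KB G) \<longleftrightarrow> bisection G A \<and> openin (gtop G) A \<and> compactin (gtop G) A"
  by (simp add: KB_def)

lemma mul_KB [simp]: "mul (KB G) = subset_mul G"
  by (simp add: KB_def)

end

section \<open>The semigroup of compact-open bisections\<close>

text \<open>Closure under products and inverses depends on the topology and is therefore assumed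
  here; for the universal groupoid it is derived from closure of the basis under these
  operations.\<close>

locale KB_groupoid = small_groupoid +
  assumes KB_mul_closed: "\<lbrakk>A \<in> carrier (KB G); B \<in> carrier (KB G)\<rbrakk>
      \<Longrightarrow> subset_mul G A B \<in> carrier (KB G)"
    and KB_ginv_closed: "A \<in> carrier (KB G) \<Longrightarrow> ginv G ` A \<in> carrier (KB G)"
begin

lemma KB_bisection: "A \<in> carrier (KB G) \<Longrightarrow> bisection G A"
  by (simp add: KB_iff)

lemma KB_subset: "A \<in> carrier (KB G) \<Longrightarrow> A \<subseteq> carrier G"
  by (simp add: KB_bisection bisection_subset)

lemma idempotents_KB: "E \<in> idempotents (KB G) \<longleftrightarrow> E \<in> carrier (KB G) \<and> E \<subseteq> identities G"
  unfolding idempotents_def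
  using subset_mul_identities subset_mul_idem_imp_identities KB_bisection by auto

text \<open>Since \<open>sinv\<close> is a definite description, the inverse has to be shown unique:
  any inverse \<open>B\<close> of \<open>A\<close> contains \<open>ginv G\<close>
  A\<open>, and by symmetry\<close>A\<open>contains\<close>ginv G \<open>B\<close>; inverting the
  second inclusion gives equality.\<close>

lemma sinv_KB:
  assumes A: "A \<in> carrier (KB G)"
  shows "sinv (KB G) A = ginv G ` A"
  unfolding sinv_def mul_KB
proof (rule the_equality)
  show "ginv G ` A \<in> carrier (KB G) \<and> subset_mul G (subset_mul G A (ginv G ` A)) A = A
    \<and> subset_mul G (subset_mul G (ginv G ` A) A) (ginv G ` A) = ginv G ` A"
    using A KB_ginv_closed subset_mul_ginv_sandwich[OF KB_bisection[OF A]] by simp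
next
  fix B assume B: "B \<in> carrier (KB G) \<and> subset_mul G (subset_mul G A B) A = A
    \<and> subset_mul G (subset_mul G B A) B = B"
  have "ginv G ` A \<subseteq> B"
    using subset_mul_sandwich_subset[OF KB_bisection[OF A]] B KB_subset by blast
  moreover have "ginv G ` B \<subseteq> A"
    using subset_mul_sandwich_subset[OF KB_bisection] B A KB_subset by blast
  then have "ginv G ` ginv G ` B \<subseteq> ginv G ` A" by blast
  moreover have "ginv G ` ginv G ` B = B"
    using KB_subset[of B] B by (force simp: image_iff)
  ultimately show "B = ginv G ` A" by (metis subset_antisym)
qed

text \<open>Multiplying by a set of identities can only shrink \<open>B\<close>, and
  \<open>subset_mul_restrict\<close> realises every smaller compact-open bisection in this
  way.\<close>

lemma natural_le_KB:
  assumes B: "B \<in> carrier (KB G)"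
  shows "natural_le (KB G) A B \<longleftrightarrow> A \<in> carrier (KB G) \<and> A \<subseteq> B"
proof
  assume "natural_le (KB G) A B"
  then obtain E where E: "E \<in> idempotents (KB G)" "A = subset_mul G B E"
    by (auto simp: natural_order_def)
  then show "A \<in> carrier (KB G) \<and> A \<subseteq> B"
    using subset_mul_identities_right[OF KB_subset[OF B]] KB_mul_closed B by (simp add: idempotents_KB)
next
  assume A: "A \<in> carrier (KB G) \<and> A \<subseteq> B"
  have "subset_mul G (ginv G ` A) A \<in> idempotents (KB G)"
    using A KB_mul_closed KB_ginv_closed KB_bisection[of A] by (simp add: idempotents_KB bisection_def)
  then show "natural_le (KB G) A B"
    using subset_mul_restrict[OF KB_bisection[OF B], of A] A by (auto simp: natural_order_def)
qed

lemma compatible_KB: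
  assumes "A \<in> carrier (KB G)" "B \<in> carrier (KB G)"
  shows "compatible (KB G) A B \<longleftrightarrow> subset_mul G (ginv G ` A) B \<subseteq> identities G
    \<and> subset_mul G A (ginv G ` B) \<subseteq> identities G"
  using assms KB_mul_closed KB_ginv_closed by (simp add: compatible_def sinv_KB idempotents_KB)

lemma compatible_KB_subset:
  assumes A: "A \<in> carrier (KB G)" and B: "B \<in> carrier (KB G)" and C: "bisection G C"
    and sub: "A \<subseteq> C" "B \<subseteq> C"
  shows "compatible (KB G) A B"
proof -
  have "subset_mul G (ginv G ` A) B \<subseteq> subset_mul G (ginv G ` C) C"
    "subset_mul G A (ginv G ` B) \<subseteq> subset_mul G C (ginv G ` C)"
    using sub by (intro subset_mul_mono image_mono; simp)+
  then show ?thesis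
    using C unfolding compatible_KB[OF A B] bisection_def by blast
qed

lemma Union_KB_closed:
  assumes "finite_compatible (KB G) \<A>"
  shows "\<Union>\<A> \<in> carrier (KB G)"
proof -
  have sub: "A \<in> carrier (KB G)" if "A \<in> \<A>" for A
    using that assms unfolding finite_compatible_def by blast
  have "bisection G (\<Union>\<A>)"
  proof (rule bisection_Union)
    show "bisection G A" if "A \<in> \<A>" for A using sub KB_bisection that by blast
    show "subset_mul G (ginv G ` A) B \<subseteq> identities G \<and> subset_mul G A (ginv G ` B) \<subseteq> identities G"
      if "A \<in> \<A>" "B \<in> \<A>" for A B
      using assms that sub compatible_KB unfolding finite_compatible_def by blast
  qed
  moreover have "openin (gtop G) (\<Union>\<A>)"
    using sub unfolding KB_iff by blast
  moreover have "compactin (gtop G) (\<Union>\<A>)"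
    using assms sub unfolding KB_iff finite_compatible_def by (intro compactin_Union) auto
  ultimately show ?thesis by (simp add: KB_iff)
qed

text \<open>The order is inclusion and \<open>\<Union>\<A>\<close> is itself a compact-open
  bisection, so the least upper bound cannot be larger. Preservation of joins thereby becomes a
  statement about finite unions.\<close>

lemma is_join_KB:
  assumes "finite_compatible (KB G) \<A>"
  shows "is_join (KB G) A \<A> \<longleftrightarrow> A = \<Union>\<A>"
proof -
  have sub: "\<A> \<subseteq> carrier (KB G)" using assms unfolding finite_compatible_def by blast
  have U: "\<Union>\<A> \<in> carrier (KB G)" by (rule Union_KB_closed[OF assms])
  have c: "carrier (natural_order (KB G)) = carrier (KB G)" by (simp add: natural_order_def)
  have "Upper (natural_order (KB G)) \<A> = {B \<in> carrier (KB G). \<Union>\<A> \<subseteq> B}"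
  proof -
    have "(\<forall>A. A \<in> \<A> \<inter> carrier (KB G) \<longrightarrow> natural_le (KB G) A B) \<longleftrightarrow> \<Union>\<A> \<subseteq> B"
      if "B \<in> carrier (KB G)" for B
      unfolding natural_le_KB[OF that] using sub unfolding Sup_le_iff by blast
    then show ?thesis unfolding Upper_def c by auto
  qed
  then have "is_join (KB G) A \<A> \<longleftrightarrow> A \<in> carrier (KB G) \<and> \<Union>\<A> \<subseteq> A
      \<and> (\<forall>B\<in>carrier (KB G). \<Union>\<A> \<subseteq> B \<longrightarrow> A \<subseteq> B)"
    by (auto simp: least_def c natural_le_KB)
  then show ?thesis using U by blast
qed

end

section \<open>The groupoid of filters\<close>

context inverse_semigroup
begin

abbreviation pfilter :: "'a set \<Rightarrow> bool" where "pfilter \<equiv> is_proper_filter S"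
abbreviation dm :: "'a set \<Rightarrow> 'a set" where "dm \<equiv> gdom (universal_groupoid S)"
abbreviation rn :: "'a set \<Rightarrow> 'a set" where "rn \<equiv> gran (universal_groupoid S)"
abbreviation cp :: "'a set \<Rightarrow> 'a set \<Rightarrow> 'a set" (infixl "\<odot>" 70)
  where "F \<odot> G \<equiv> gcomp (universal_groupoid S) F G"

lemma filter_closed: "\<lbrakk>pfilter F; a \<in> F\<rbrakk> \<Longrightarrow> a \<in> carrier S"
  unfolding is_proper_filter_def by blast

lemma filter_nonempty: "pfilter F \<Longrightarrow> \<exists>a. a \<in> F"
  unfolding is_proper_filter_def by blast

lemma filter_up: "\<lbrakk>pfilter F; a \<in> F; a \<preceq> b; b \<in> carrier S\<rbrakk> \<Longrightarrow> b \<in> F"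
  unfolding is_proper_filter_def by blast

lemma filter_directed: "\<lbrakk>pfilter F; a \<in> F; b \<in> F\<rbrakk> \<Longrightarrow> \<exists>c\<in>F. c \<preceq> a \<and> c \<preceq> b"
  unfolding is_proper_filter_def by blast

lemma filter_zero: "\<lbrakk>pfilter F; is_zero S z\<rbrakk> \<Longrightarrow> z \<notin> F"
  unfolding is_proper_filter_def by blast

lemma filterI:
  assumes "F \<subseteq> carrier S" "a \<in> F"
    and "\<And>a b. \<lbrakk>a \<in> F; b \<in> carrier S; a \<preceq> b\<rbrakk> \<Longrightarrow> b \<in> F"
    and "\<And>a b. \<lbrakk>a \<in> F; b \<in> F\<rbrakk> \<Longrightarrow> \<exists>c\<in>F. c \<preceq> a \<and> c \<preceq> b"
    and "\<And>z. is_zero S z \<Longrightarrow> z \<notin> F"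
  shows "pfilter F"
  unfolding is_proper_filter_def using assms by blast

text \<open>A common lower bound \<open>h \<in> F\<close> of the three elements satisfies \<open>h =
  h \<cdot> (\<iota> h \<cdot> h) \<preceq> a \<cdot> (\<iota> b \<cdot> c)\<close>. This coset-like
  property is the main computational rule for filters.\<close>

lemma filter_triple:
  assumes F: "pfilter F" and abc: "a \<in> F" "b \<in> F" "c \<in> F"
  shows "a \<cdot> (\<iota> b \<cdot> c) \<in> F"
proof -
  have abc_S: "a \<in> carrier S" "b \<in> carrier S" "c \<in> carrier S"
    using abc filter_closed[OF F] by auto
  obtain h' where h': "h' \<in> F" "h' \<preceq> a" "h' \<preceq> b" using filter_directed[OF F] abc by blast
  obtain h where h: "h \<in> F" "h \<preceq> h'" "h \<preceq> c" using filter_directed[OF F h'(1) abc(3)] by blast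
  have hS: "h \<in> carrier S" by (rule filter_closed[OF F h(1)])
  have "h \<preceq> a" "h \<preceq> b" using h(2) h'(2,3) abc_S by (blast intro: le_trans)+
  then have "h \<cdot> (\<iota> h \<cdot> h) \<preceq> a \<cdot> (\<iota> b \<cdot> c)"
    using h abc_S by (intro le_mul le_sinv) auto
  then show ?thesis
    using filter_up[OF F h(1)] abc_S hS by (simp add: mul_sinv_cancel)
qed

text \<open>If \<open>c \<in> F\<close> is below \<open>x \<cdot> a\<close> and
  \<open>x \<cdot> b\<close>, then \<open>\<iota> x \<cdot> c\<close> is below \<open>a\<close> and
  \<open>b\<close>. It belongs to the translate because \<open>c\<close>, being below a multiple of
  \<open>x\<close>, satisfies \<open>x \<cdot> (\<iota> x \<cdot> c) = c\<close>. The element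
  \<open>y\<close> makes the translate non-empty.\<close>

lemma left_translate_filter:
  assumes F: "pfilter F" and x: "x \<in> carrier S" and y: "y \<in> carrier S" "x \<cdot> y \<in> F"
  shows "pfilter {y \<in> carrier S. x \<cdot> y \<in> F}"
proof (rule filterI)
  fix a b
  assume a: "a \<in> {y \<in> carrier S. x \<cdot> y \<in> F}" and b: "b \<in> carrier S" "a \<preceq> b"
  then show "b \<in> {y \<in> carrier S. x \<cdot> y \<in> F}"
    using filter_up[OF F, of "x \<cdot> a" "x \<cdot> b"] le_mul_left x by auto
next
  fix a b
  assume ab: "a \<in> {y \<in> carrier S. x \<cdot> y \<in> F}" "b \<in> {y \<in> carrier S. x \<cdot> y \<in> F}"
  then obtain c where c: "c \<in> F" "c \<preceq> x \<cdot> a" "c \<preceq> x \<cdot> b"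
    using filter_directed[OF F] by blast
  have cS: "c \<in> carrier S" by (rule filter_closed[OF F c(1)])
  have *: "\<iota> x \<cdot> c \<preceq> d" if "d \<in> carrier S" "c \<preceq> x \<cdot> d" for d
    using le_trans[OF le_mul_left le_cancel_left'] that x by simp
  obtain e where e: "e \<in> \<E>" "c = x \<cdot> a \<cdot> e" using c(2) by (auto simp: natural_le_iff)
  then have "x \<cdot> (\<iota> x \<cdot> c) = c" using ab x by (simp add: mul_assoc mul_sinv_cancel_left)
  then show "\<exists>c\<in>{y \<in> carrier S. x \<cdot> y \<in> F}. c \<preceq> a \<and> c \<preceq> b"
    using * c cS ab x by (intro bexI[of _ "\<iota> x \<cdot> c"]) auto
next
  fix z assume "is_zero S z"
  then show "z \<notin> {y \<in> carrier S. x \<cdot> y \<in> F}"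
    using filter_zero[OF F] x unfolding is_zero_def by force
qed (use y in auto)

lemma right_translate_filter:
  assumes F: "pfilter F" and x: "x \<in> carrier S" and y: "y \<in> carrier S" "y \<cdot> x \<in> F"
  shows "pfilter {y \<in> carrier S. y \<cdot> x \<in> F}"
proof (rule filterI)
  fix a b
  assume a: "a \<in> {y \<in> carrier S. y \<cdot> x \<in> F}" and b: "b \<in> carrier S" "a \<preceq> b"
  then show "b \<in> {y \<in> carrier S. y \<cdot> x \<in> F}"
    using filter_up[OF F, of "a \<cdot> x" "b \<cdot> x"] le_mul_right x by auto
next
  fix a b
  assume ab: "a \<in> {y \<in> carrier S. y \<cdot> x \<in> F}" "b \<in> {y \<in> carrier S. y \<cdot> x \<in> F}"
  then obtain c where c: "c \<in> F" "c \<preceq> a \<cdot> x" "c \<preceq> b \<cdot> x"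
    using filter_directed[OF F] by blast
  have cS: "c \<in> carrier S" by (rule filter_closed[OF F c(1)])
  have *: "c \<cdot> \<iota> x \<preceq> d" if "d \<in> carrier S" "c \<preceq> d \<cdot> x" for d
    using le_trans[OF le_mul_right[OF that(2)] _ that(1), of "\<iota> x"] le_cancel_right'[of x d] that x
    by (simp add: mul_assoc)
  \<comment> \<open>Mirror image of the absorption on the left. The order multiplies by idempotents
    on the right, so \<open>c\<close> has to be rewritten with \<open>x\<close> as its last factor
    before \<open>\<iota> x \<cdot> x\<close> can be absorbed.\<close>
  have "c = c \<cdot> (\<iota> c \<cdot> (a \<cdot> x))" using le_left[OF c(2)] ab x by simp
  then have "c \<cdot> (\<iota> x \<cdot> x) = c \<cdot> (\<iota> c \<cdot> (a \<cdot> (x \<cdot> (\<iota> x \<cdot> x))))"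
    using ab x cS by (metis (no_types, lifting) mem_Collect_eq mul_assoc mul_closed sinv_closed)
  also have "\<dots> = c" using le_left[OF c(2)] ab x by (simp add: mul_sinv_cancel)
  finally have "c \<cdot> \<iota> x \<cdot> x = c" using cS x by (simp add: mul_assoc)
  then show "\<exists>c\<in>{y \<in> carrier S. y \<cdot> x \<in> F}. c \<preceq> a \<and> c \<preceq> b"
    using * c cS ab x by (intro bexI[of _ "c \<cdot> \<iota> x"]) auto
next
  fix z assume "is_zero S z"
  then show "z \<notin> {y \<in> carrier S. y \<cdot> x \<in> F}"
    using filter_zero[OF F] x unfolding is_zero_def by force
qed (use y in auto)

lemma sinv_zero: "is_zero S z \<Longrightarrow> \<iota> z = z"
  by (rule sinv_idem) (auto simp: is_zero_def intro: idemI)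

lemma sinv_image: "F \<subseteq> carrier S \<Longrightarrow> \<iota> ` F = {y \<in> carrier S. \<iota> y \<in> F}"
  by (force simp: image_iff)

lemma sinv_filter:
  assumes F: "pfilter F"
  shows "pfilter (\<iota> ` F)"
proof -
  have FS: "F \<subseteq> carrier S" using filter_closed[OF F] by blast
  obtain p where p: "p \<in> F" using filter_nonempty[OF F] by blast
  show ?thesis
  proof (rule filterI)
    show "\<iota> ` F \<subseteq> carrier S" using FS by auto
    show "\<iota> p \<in> \<iota> ` F" using p by simp
  next
    fix a b assume "a \<in> \<iota> ` F" "b \<in> carrier S" "a \<preceq> b"
    then show "b \<in> \<iota> ` F"
      using filter_up[OF F, of "\<iota> a" "\<iota> b"] le_sinv by (auto simp: sinv_image[OF FS])
  next
    fix a b assume "a \<in> \<iota> ` F" "b \<in> \<iota> ` F"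
    then obtain a' b' where ab: "a' \<in> F" "b' \<in> F" "a = \<iota> a'" "b = \<iota> b'" by blast
    then obtain c where "c \<in> F" "c \<preceq> a'" "c \<preceq> b'" using filter_directed[OF F] by blast
    then show "\<exists>c\<in>\<iota> ` F. c \<preceq> a \<and> c \<preceq> b"
      using ab FS le_sinv by (intro bexI[of _ "\<iota> c"]) auto
  next
    fix z assume "is_zero S z"
    then show "z \<notin> \<iota> ` F"
      using filter_zero[OF F] sinv_zero by (simp add: sinv_image[OF FS])
  qed
qed

section \<open>Domain, range and composite of filters as membership tests\<close>

lemma gdom_universal_iff:
  "x \<in> dm F \<longleftrightarrow> x \<in> carrier S \<and> (\<exists>a\<in>F. \<exists>b\<in>F. \<iota> a \<cdot> b \<preceq> x)"
  unfolding universal_groupoid_def up_closure_def set_mul_def top_groupoid.simps by blast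

lemma gran_universal_iff:
  "x \<in> rn F \<longleftrightarrow> x \<in> carrier S \<and> (\<exists>a\<in>F. \<exists>b\<in>F. a \<cdot> \<iota> b \<preceq> x)"
  unfolding universal_groupoid_def up_closure_def set_mul_def top_groupoid.simps by blast

lemma gcomp_universal_iff:
  "x \<in> F \<odot> G \<longleftrightarrow> x \<in> carrier S \<and> (\<exists>a\<in>F. \<exists>b\<in>G. a \<cdot> b \<preceq> x)"
  unfolding universal_groupoid_def up_closure_def set_mul_def top_groupoid.simps by blast

text \<open>One member \<open>p\<close> replaces the upward closure:
  \<open>\<iota> a \<cdot> b \<preceq> x\<close> puts \<open>p \<cdot> (\<iota> a \<cdot> b)\<close>
  into \<open>F\<close> and below \<open>p \<cdot> x\<close>, and conversely
  \<open>\<iota> p \<cdot> (p \<cdot> x) \<preceq> x\<close>. The groupoid laws are then proved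
  mostly by rewriting under membership.\<close>

lemma gdom_filter:
  assumes F: "pfilter F" and p: "p \<in> F"
  shows "dm F = {x \<in> carrier S. p \<cdot> x \<in> F}"
proof -
  have pS: "p \<in> carrier S" by (rule filter_closed[OF F p])
  have "p \<cdot> x \<in> F" if x: "x \<in> carrier S" and ab: "a \<in> F" "b \<in> F" "\<iota> a \<cdot> b \<preceq> x" for x a b
    using filter_up[OF F filter_triple[OF F p ab(1,2)] le_mul_left[OF ab(3) x pS]] pS x by simp
  moreover have "\<exists>a\<in>F. \<exists>b\<in>F. \<iota> a \<cdot> b \<preceq> x" if "x \<in> carrier S" "p \<cdot> x \<in> F" for x
    using that p le_cancel_left'[OF pS] by blast
  ultimately show ?thesis
    unfolding set_eq_iff mem_Collect_eq gdom_universal_iff by blast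
qed

lemma gran_filter:
  assumes F: "pfilter F" and p: "p \<in> F"
  shows "rn F = {x \<in> carrier S. x \<cdot> p \<in> F}"
proof -
  have pS: "p \<in> carrier S" by (rule filter_closed[OF F p])
  have "x \<cdot> p \<in> F" if x: "x \<in> carrier S" and ab: "a \<in> F" "b \<in> F" "a \<cdot> \<iota> b \<preceq> x" for x a b
  proof -
    have "a \<in> carrier S" "b \<in> carrier S" using ab filter_closed[OF F] by auto
    then show ?thesis
      using filter_up[OF F filter_triple[OF F ab(1,2) p], of "x \<cdot> p"] le_mul_right[OF ab(3) x pS] pS x
      by (simp add: mul_assoc)
  qed
  moreover have "\<exists>a\<in>F. \<exists>b\<in>F. a \<cdot> \<iota> b \<preceq> x" if "x \<in> carrier S" "x \<cdot> p \<in> F" for x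
    using that p le_cancel_right'[OF pS that(1)] pS mul_assoc[of x p "\<iota> p"]
    by (intro bexI[of _ "x \<cdot> p"] bexI[of _ p]) auto
  ultimately show ?thesis
    unfolding set_eq_iff mem_Collect_eq gran_universal_iff by blast
qed

text \<open>Composability enters through \<open>\<iota> f \<cdot> a\<close>: it lies in the domain
  of \<open>F\<close>, hence in the range of \<open>G\<close>, and so carries
  \<open>b \<in> G\<close> to \<open>\<iota> f \<cdot> a \<cdot> b \<in> G\<close>, which is below
  \<open>\<iota> f \<cdot> x\<close>.\<close>

lemma gcomp_filter_left:
  assumes F: "pfilter F" and G: "pfilter G" and FG: "dm F = rn G" and f: "f \<in> F"
  shows "F \<odot> G = {x \<in> carrier S. \<iota> f \<cdot> x \<in> G}"
proof -
  have fS: "f \<in> carrier S" by (rule filter_closed[OF F f])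
  have "\<iota> f \<cdot> x \<in> G" if x: "x \<in> carrier S" and ab: "a \<in> F" "b \<in> G" "a \<cdot> b \<preceq> x" for x a b
  proof -
    have abS: "a \<in> carrier S" "b \<in> carrier S" using ab filter_closed[OF F] filter_closed[OF G] by auto
    have "\<iota> f \<cdot> a \<in> dm F"
      using filter_triple[OF F f f ab(1)] fS abS by (simp add: gdom_filter[OF F f])
    then have "\<iota> f \<cdot> a \<cdot> b \<in> G" by (simp add: FG gran_filter[OF G ab(2)])
    moreover have "\<iota> f \<cdot> a \<cdot> b \<preceq> \<iota> f \<cdot> x"
      using le_mul_left[OF ab(3) x, of "\<iota> f"] abS fS by (simp add: mul_assoc)
    ultimately show ?thesis using filter_up[OF G] fS x by blast
  qed
  moreover have "\<exists>a\<in>F. \<exists>b\<in>G. a \<cdot> b \<preceq> x" if "x \<in> carrier S" "\<iota> f \<cdot> x \<in> G" for x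
    using that f le_cancel_left[OF fS] by blast
  ultimately show ?thesis
    unfolding set_eq_iff mem_Collect_eq gcomp_universal_iff by blast
qed

lemma gcomp_filter_right:
  assumes F: "pfilter F" and G: "pfilter G" and FG: "dm F = rn G" and g: "g \<in> G"
  shows "F \<odot> G = {x \<in> carrier S. x \<cdot> \<iota> g \<in> F}"
proof -
  have gS: "g \<in> carrier S" by (rule filter_closed[OF G g])
  have "x \<cdot> \<iota> g \<in> F" if x: "x \<in> carrier S" and ab: "a \<in> F" "b \<in> G" "a \<cdot> b \<preceq> x" for x a b
  proof -
    have abS: "a \<in> carrier S" "b \<in> carrier S" using ab filter_closed[OF F] filter_closed[OF G] by auto
    have "b \<cdot> \<iota> g \<in> rn G"
      using filter_triple[OF G ab(2) g g] gS abS by (simp add: gran_filter[OF G g] mul_assoc)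
    then have "a \<cdot> (b \<cdot> \<iota> g) \<in> F" by (simp add: FG[symmetric] gdom_filter[OF F ab(1)])
    moreover have "a \<cdot> (b \<cdot> \<iota> g) \<preceq> x \<cdot> \<iota> g"
      using le_mul_right[OF ab(3) x, of "\<iota> g"] abS gS by (simp add: mul_assoc)
    ultimately show ?thesis using filter_up[OF F] gS x by blast
  qed
  moreover have "\<exists>a\<in>F. \<exists>b\<in>G. a \<cdot> b \<preceq> x" if "x \<in> carrier S" "x \<cdot> \<iota> g \<in> F" for x
    using that g le_cancel_right[OF gS that(1)] gS mul_assoc[of x "\<iota> g" g]
    by (intro bexI[of _ "x \<cdot> \<iota> g"] bexI[of _ g]) auto
  ultimately show ?thesis
    unfolding set_eq_iff mem_Collect_eq gcomp_universal_iff by blast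
qed

lemma ginv_universal [simp]: "ginv (universal_groupoid S) F = \<iota> ` F"
  by (simp add: universal_groupoid_def)

lemma carrier_universal [simp]: "F \<in> carrier (universal_groupoid S) \<longleftrightarrow> pfilter F"
  by (simp add: universal_groupoid_def)

lemma sinv_mul_in_gdom: "\<lbrakk>pfilter F; p \<in> F\<rbrakk> \<Longrightarrow> \<iota> p \<cdot> p \<in> dm F"
  by (simp add: gdom_filter filter_closed mul_sinv_cancel)

lemma mul_sinv_in_gran: "\<lbrakk>pfilter F; p \<in> F\<rbrakk> \<Longrightarrow> p \<cdot> \<iota> p \<in> rn F"
  by (simp add: gran_filter filter_closed mul_sinv_cancel mul_assoc)

lemma gdom_is_filter: assumes "pfilter F" shows "pfilter (dm F)"
proof -
  obtain p where p: "p \<in> F" using filter_nonempty assms by blast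
  show ?thesis
    unfolding gdom_filter[OF assms p]
    by (rule left_translate_filter[of _ _ "\<iota> p \<cdot> p"])
      (use assms p filter_closed[OF assms p] in \<open>auto simp: mul_sinv_cancel\<close>)
qed

lemma gran_is_filter: assumes "pfilter F" shows "pfilter (rn F)"
proof -
  obtain p where p: "p \<in> F" using filter_nonempty assms by blast
  show ?thesis
    unfolding gran_filter[OF assms p]
    by (rule right_translate_filter[of _ _ "p \<cdot> \<iota> p"])
      (use assms p filter_closed[OF assms p] in \<open>auto simp: mul_sinv_cancel mul_assoc\<close>)
qed

lemma mul_in_gcomp:
  assumes "pfilter F" "pfilter G" "dm F = rn G" "f \<in> F" "g \<in> G"
  shows "f \<cdot> g \<in> F \<odot> G"
proof -
  have "f \<in> carrier S" "g \<in> carrier S" using assms filter_closed by blast+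
  moreover have "\<iota> f \<cdot> f \<in> rn G" using sinv_mul_in_gdom assms by metis
  ultimately show ?thesis
    using assms by (simp add: gcomp_filter_left gran_filter[OF assms(2,5)] mul_assoc)
qed

lemma gcomp_is_filter:
  assumes F: "pfilter F" and G: "pfilter G" and FG: "dm F = rn G"
  shows "pfilter (F \<odot> G)"
proof -
  obtain f g where fg: "f \<in> F" "g \<in> G" using filter_nonempty assms by metis
  show ?thesis
    unfolding gcomp_filter_left[OF F G FG fg(1)]
    by (rule left_translate_filter[of _ _ "f \<cdot> g"])
      (use mul_in_gcomp[OF F G FG fg] filter_closed[OF F fg(1)] F G FG fg in
        \<open>auto simp: gcomp_filter_left filter_closed\<close>)
qed

lemma sinv_in_gdom:
  assumes F: "pfilter F" and x: "x \<in> dm F"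
  shows "\<iota> x \<in> dm F"
proof -
  obtain p where p: "p \<in> F" using filter_nonempty F by blast
  have pS: "p \<in> carrier S" by (rule filter_closed[OF F p])
  have x: "x \<in> carrier S" "p \<cdot> x \<in> F" using x by (auto simp: gdom_filter[OF F p])
  \<comment> \<open>This triple product equals
    \<open>p \<cdot> \<iota> x \<cdot> (\<iota> p \<cdot> p)\<close>, which lies below the wanted
    \<open>p \<cdot> \<iota> x\<close>.\<close>
  have "p \<cdot> (\<iota> (p \<cdot> x) \<cdot> p) \<in> F" by (rule filter_triple[OF F p x(2) p])
  moreover have "p \<cdot> (\<iota> (p \<cdot> x) \<cdot> p) \<preceq> p \<cdot> \<iota> x"
    using le_mul_left[OF le_cancel_right[of p "\<iota> x"], of p] pS x by (simp add: sinv_mul mul_assoc)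
  ultimately show ?thesis
    using x pS filter_up[OF F] by (simp add: gdom_filter[OF F p])
qed

lemma sinv_in_gran:
  assumes F: "pfilter F" and x: "x \<in> rn F"
  shows "\<iota> x \<in> rn F"
proof -
  obtain p where p: "p \<in> F" using filter_nonempty F by blast
  have pS: "p \<in> carrier S" by (rule filter_closed[OF F p])
  have x: "x \<in> carrier S" "x \<cdot> p \<in> F" using x by (auto simp: gran_filter[OF F p])
  have "p \<cdot> (\<iota> (x \<cdot> p) \<cdot> p) \<in> F" by (rule filter_triple[OF F p x(2) p])
  moreover have "p \<cdot> (\<iota> (x \<cdot> p) \<cdot> p) \<preceq> \<iota> x \<cdot> p"
    using le_cancel_left[of p "\<iota> x \<cdot> p"] pS x by (simp add: sinv_mul mul_assoc)
  ultimately show ?thesis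
    using x pS filter_up[OF F] by (simp add: gran_filter[OF F p])
qed

text \<open>A filter is recovered from its domain and any one member \<open>p\<close>, as the set of
  \<open>x\<close> with \<open>\<iota> p \<cdot> x\<close> in the domain. Together with the version
  for ranges, this is why the filters through a fixed element form a bisection.\<close>

lemma filter_eqI_gdom:
  assumes F: "pfilter F" and G: "pfilter G" and d: "dm F = dm G" and p: "p \<in> F" "p \<in> G"
  shows "F = G"
proof -
  have pS: "p \<in> carrier S" by (rule filter_closed[OF F p(1)])
  have *: "H = {x \<in> carrier S. \<iota> p \<cdot> x \<in> dm H}" if H: "pfilter H" "p \<in> H" for H
  proof -
    have "p \<cdot> (\<iota> p \<cdot> x) \<in> H \<longleftrightarrow> x \<in> H" if "x \<in> carrier S" for x
      using filter_up[OF H(1) _ le_cancel_left[OF pS that] that] filter_triple[OF H(1) H(2) H(2)] by blast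
    then show ?thesis
      using filter_closed[OF H(1)] pS by (auto simp: gdom_filter[OF H])
  qed
  show ?thesis using *[OF F p(1)] *[OF G p(2)] d by simp
qed

lemma filter_eqI_gran:
  assumes F: "pfilter F" and G: "pfilter G" and d: "rn F = rn G" and p: "p \<in> F" "p \<in> G"
  shows "F = G"
proof -
  have pS: "p \<in> carrier S" by (rule filter_closed[OF F p(1)])
  have *: "H = {x \<in> carrier S. x \<cdot> \<iota> p \<in> rn H}" if H: "pfilter H" "p \<in> H" for H
  proof -
    have "x \<cdot> (\<iota> p \<cdot> p) \<in> H \<longleftrightarrow> x \<in> H" if "x \<in> carrier S" for x
      using filter_up[OF H(1) _ le_cancel_right[OF pS that] that] filter_triple[OF H(1) _ H(2) H(2)] by blast
    then show ?thesis
      using filter_closed[OF H(1)] pS by (auto simp: gran_filter[OF H] mul_assoc)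
  qed
  show ?thesis using *[OF F p(1)] *[OF G p(2)] d by simp
qed

lemma gdom_gdom_filter:
  assumes F: "pfilter F"
  shows "dm (dm F) = dm F" "rn (dm F) = dm F"
proof -
  obtain p where p: "p \<in> F" using filter_nonempty F by blast
  have pS: "p \<in> carrier S" by (rule filter_closed[OF F p])
  have "p \<cdot> (\<iota> p \<cdot> p \<cdot> x) = p \<cdot> x" if "x \<in> carrier S" for x
    using that pS by (simp add: mul_assoc mul_sinv_cancel_left)
  then show "dm (dm F) = dm F"
    using pS unfolding gdom_filter[OF gdom_is_filter[OF F] sinv_mul_in_gdom[OF F p]]
    by (auto simp: gdom_filter[OF F p])
  have "p \<cdot> (x \<cdot> (\<iota> p \<cdot> p)) \<in> F \<longleftrightarrow> p \<cdot> x \<in> F" if x: "x \<in> carrier S" for x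
    using filter_up[OF F _ le_mul_left[OF le_cancel_right[OF pS x] x pS]]
      filter_triple[OF F _ p p, of "p \<cdot> x"] x pS by (auto simp: mul_assoc)
  then show "rn (dm F) = dm F"
    using pS unfolding gran_filter[OF gdom_is_filter[OF F] sinv_mul_in_gdom[OF F p]]
    by (auto simp: gdom_filter[OF F p])
qed

text \<open>The domain is read off the description of the composite by a member of \<open>F\<close>,
  the range off the description by a member of \<open>G\<close>; each time composability supplies
  the idempotent to be inserted.\<close>

lemma gdom_gcomp_filter:
  assumes F: "pfilter F" and G: "pfilter G" and FG: "dm F = rn G"
  shows "dm (F \<odot> G) = dm G" "rn (F \<odot> G) = rn F"
proof -
  obtain f g where fg: "f \<in> F" "g \<in> G" using filter_nonempty assms by metis
  have S: "f \<in> carrier S" "g \<in> carrier S" using filter_closed F G fg by auto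
  note FGf = gcomp_is_filter[OF F G FG] mul_in_gcomp[OF F G FG fg]
  have "\<iota> f \<cdot> (f \<cdot> (g \<cdot> x)) \<in> G \<longleftrightarrow> g \<cdot> x \<in> G" if x: "x \<in> carrier S" for x
  proof
    assume "\<iota> f \<cdot> (f \<cdot> (g \<cdot> x)) \<in> G"
    then show "g \<cdot> x \<in> G"
      using filter_up[OF G _ le_cancel_left'[of f "g \<cdot> x"]] S x by auto
  next
    assume g': "g \<cdot> x \<in> G"
    have "\<iota> f \<cdot> f \<in> rn G" using sinv_mul_in_gdom[OF F fg(1)] FG by simp
    then show "\<iota> f \<cdot> (f \<cdot> (g \<cdot> x)) \<in> G"
      using S x by (simp add: gran_filter[OF G g'] mul_assoc)
  qed
  then show "dm (F \<odot> G) = dm G"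
    using S unfolding gdom_filter[OF FGf]
    unfolding gdom_filter[OF G fg(2)] gcomp_filter_left[OF F G FG fg(1)]
    by (auto simp: mul_assoc)
  have "x \<cdot> (f \<cdot> (g \<cdot> \<iota> g)) \<in> F \<longleftrightarrow> x \<cdot> f \<in> F" if x: "x \<in> carrier S" for x
  proof
    assume "x \<cdot> (f \<cdot> (g \<cdot> \<iota> g)) \<in> F"
    then show "x \<cdot> f \<in> F"
      using filter_up[OF F _ le_cancel_right'[of g "x \<cdot> f"]] S x by (auto simp: mul_assoc)
  next
    assume f': "x \<cdot> f \<in> F"
    have "g \<cdot> \<iota> g \<in> dm F" using mul_sinv_in_gran[OF G fg(2)] FG by simp
    then show "x \<cdot> (f \<cdot> (g \<cdot> \<iota> g)) \<in> F"
      using S x by (simp add: gdom_filter[OF F f'] mul_assoc)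
  qed
  then show "rn (F \<odot> G) = rn F"
    using S unfolding gran_filter[OF FGf]
    unfolding gran_filter[OF F fg(1)] gcomp_filter_right[OF F G FG fg(2)]
    by (auto simp: mul_assoc)
qed

text \<open>Members \<open>f\<close> and \<open>g\<close> reduce both sides to the set of
  \<open>x\<close> with \<open>\<iota> g \<cdot> (\<iota> f \<cdot> x) \<in> H\<close>.\<close>

lemma gcomp_assoc_filter:
  assumes F: "pfilter F" and G: "pfilter G" and H: "pfilter H"
    and FG: "dm F = rn G" and GH: "dm G = rn H"
  shows "F \<odot> G \<odot> H = F \<odot> (G \<odot> H)"
proof -
  obtain f g where fg: "f \<in> F" "g \<in> G" using filter_nonempty F G by metis
  have S: "f \<in> carrier S" "g \<in> carrier S" using filter_closed F G fg by auto
  have 1: "dm (F \<odot> G) = rn H" "dm F = rn (G \<odot> H)"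
    using gdom_gcomp_filter F G H FG GH by auto
  show ?thesis
    unfolding gcomp_filter_left[OF gcomp_is_filter[OF F G FG] H 1(1) mul_in_gcomp[OF F G FG fg]]
      gcomp_filter_left[OF F gcomp_is_filter[OF G H GH] 1(2) fg(1)]
    unfolding gcomp_filter_left[OF G H GH fg(2)]
    using S by (auto simp: sinv_mul mul_assoc)
qed

lemma gdom_sinv_filter:
  assumes F: "pfilter F"
  shows "dm (\<iota> ` F) = rn F" "rn (\<iota> ` F) = dm F"
proof -
  obtain p where p: "p \<in> F" using filter_nonempty F by blast
  have pS: "p \<in> carrier S" by (rule filter_closed[OF F p])
  have FS: "F \<subseteq> carrier S" using filter_closed F by blast
  have ip: "\<iota> p \<in> \<iota> ` F" using p by simp
  have "\<iota> x \<in> rn F \<longleftrightarrow> x \<in> rn F" if "x \<in> carrier S" for x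
    using sinv_in_gran[OF F] that by fastforce
  then show "dm (\<iota> ` F) = rn F"
    using pS unfolding gdom_filter[OF sinv_filter[OF F] ip] gran_filter[OF F p]
    by (auto simp: sinv_image[OF FS] sinv_mul)
  have "\<iota> x \<in> dm F \<longleftrightarrow> x \<in> dm F" if "x \<in> carrier S" for x
    using sinv_in_gdom[OF F] that by fastforce
  then show "rn (\<iota> ` F) = dm F"
    using pS unfolding gran_filter[OF sinv_filter[OF F] ip] gdom_filter[OF F p]
    by (auto simp: sinv_image[OF FS] sinv_mul)
qed

lemma gcomp_units_filter:
  assumes F: "pfilter F"
  shows "F \<odot> dm F = F" "rn F \<odot> F = F" "\<iota> ` F \<odot> F = dm F" "F \<odot> \<iota> ` F = rn F"
proof -
  obtain p where p: "p \<in> F" using filter_nonempty F by blast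
  have pS: "p \<in> carrier S" by (rule filter_closed[OF F p])
  have FS: "F \<subseteq> carrier S" using filter_closed F by blast
  have ip: "\<iota> p \<in> \<iota> ` F" using p by simp
  have r: "dm (rn F) = rn F"
    using gdom_gdom_filter(2)[OF sinv_filter[OF F]] gdom_gdom_filter(1)[OF sinv_filter[OF F]]
    by (simp add: gdom_sinv_filter[OF F])
  show i1: "\<iota> ` F \<odot> F = dm F"
    unfolding gcomp_filter_left[OF sinv_filter[OF F] F gdom_sinv_filter(1)[OF F] ip] gdom_filter[OF F p]
    using pS by simp
  show i2: "F \<odot> \<iota> ` F = rn F"
    unfolding gcomp_filter_right[OF F sinv_filter[OF F] gdom_sinv_filter(2)[OF F, symmetric] ip]
      gran_filter[OF F p]
    using pS by simp
  \<comment> \<open>Both filters have the same domain and share the member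
    \<open>p = p \<cdot> (\<iota> p \<cdot> p)\<close>, so they coincide.\<close>
  show "F \<odot> dm F = F"
  proof (rule filter_eqI_gdom)
    have d: "dm F = rn (dm F)" by (simp add: gdom_gdom_filter[OF F])
    show "pfilter (F \<odot> dm F)" by (rule gcomp_is_filter[OF F gdom_is_filter[OF F] d])
    show "dm (F \<odot> dm F) = dm F"
      by (simp add: gdom_gcomp_filter[OF F gdom_is_filter[OF F] d] gdom_gdom_filter[OF F])
    show "p \<in> F \<odot> dm F"
      using mul_in_gcomp[OF F gdom_is_filter[OF F] d p sinv_mul_in_gdom[OF F p]] pS
      by (simp add: mul_sinv_cancel)
  qed (use F p in auto)
  show "rn F \<odot> F = F"
  proof (rule filter_eqI_gdom)
    show "pfilter (rn F \<odot> F)" by (rule gcomp_is_filter[OF gran_is_filter[OF F] F r])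
    show "dm (rn F \<odot> F) = dm F"
      by (simp add: gdom_gcomp_filter[OF gran_is_filter[OF F] F r])
    show "p \<in> rn F \<odot> F"
      using mul_in_gcomp[OF gran_is_filter[OF F] F r mul_sinv_in_gran[OF F p] p] pS
      by (simp add: mul_sinv_cancel mul_assoc)
  qed (use F p in auto)
qed

end

sublocale inverse_semigroup \<subseteq> UG: small_groupoid "universal_groupoid S"
  by unfold_locales
    (simp_all add: gdom_is_filter gran_is_filter sinv_filter gcomp_is_filter gdom_gdom_filter
      gdom_gcomp_filter gcomp_assoc_filter gdom_sinv_filter gcomp_units_filter)

section \<open>The topology of the universal groupoid\<close>

context inverse_semigroup
begin

text \<open>That \<open>Y\<close> is finite and lies below \<open>x\<close> is left to
  \<open>universal_basis\<close>, so that set identities such as \<open>basic_Un\<close> hold for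
  arbitrary \<open>Y\<close>.\<close>

definition basic :: "'a \<Rightarrow> 'a set \<Rightarrow> 'a set set"
  where "basic x Y = filters_at S x - (\<Union>y\<in>Y. filters_at S y)"

abbreviation ftop :: "'a set topology"
  where "ftop \<equiv> gtop (universal_groupoid S)"

lemma filters_at_iff: "F \<in> filters_at S x \<longleftrightarrow> pfilter F \<and> x \<in> F"
  by (simp add: filters_at_def)

lemma basic_iff: "F \<in> basic x Y \<longleftrightarrow> pfilter F \<and> x \<in> F \<and> Y \<inter> F = {}"
  by (auto simp: basic_def filters_at_iff)

lemma basic_empty: "basic x {} = filters_at S x"
  by (simp add: basic_def)

lemma basic_Un: "basic x (Y \<union> Z) = basic x Y \<inter> basic x Z"
  by (auto simp: basic_def)

lemma ftop_def: "ftop = topology_generated_by (universal_basis S)"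
  by (simp add: universal_groupoid_def)

lemma universal_basis_iff:
  "D \<in> universal_basis S \<longleftrightarrow> (\<exists>x\<in>carrier S. \<exists>Y. finite Y \<and> (\<forall>y\<in>Y. y \<preceq> x) \<and> D = basic x Y)"
  unfolding universal_basis_def basic_def[symmetric] using le_closed by blast

lemma basicI: "\<lbrakk>x \<in> carrier S; finite Y; \<forall>y\<in>Y. y \<preceq> x\<rbrakk> \<Longrightarrow> basic x Y \<in> universal_basis S"
  unfolding universal_basis_iff by blast

lemma filters_at_basis: "x \<in> carrier S \<Longrightarrow> filters_at S x \<in> universal_basis S"
  using basicI[of x "{}"] by (simp add: basic_empty)

lemma basis_open: "D \<in> universal_basis S \<Longrightarrow> openin ftop D"
  by (simp add: ftop_def topology_generated_by_Basis)

lemma topspace_ftop: "topspace ftop = {F. pfilter F}"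
proof -
  have "\<Union>(universal_basis S) \<subseteq> {F. pfilter F}"
    unfolding universal_basis_def filters_at_def by blast
  moreover have "F \<in> \<Union>(universal_basis S)" if F: "pfilter F" for F
  proof -
    obtain x where x: "x \<in> F" using filter_nonempty[OF F] by blast
    then have "F \<in> filters_at S x" using F by (simp add: filters_at_iff)
    then show ?thesis using filters_at_basis[OF filter_closed[OF F x]] by blast
  qed
  ultimately show ?thesis by (auto simp: ftop_def)
qed

text \<open>Below \<open>x\<close> the meet of \<open>y\<close> and \<open>c\<close> is \<open>y \<cdot> (\<iota> c \<cdot> c)\<close>.\<close>

lemma basic_shrink:
  assumes F: "F \<in> basic x Y" and x: "x \<in> carrier S" and Y: "\<forall>y\<in>Y. y \<preceq> x"
    and c: "c \<in> F" "c \<preceq> x"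
  defines "Y' \<equiv> (\<lambda>y. y \<cdot> (\<iota> c \<cdot> c)) ` Y"
  shows "F \<in> basic c Y'" "basic c Y' \<subseteq> basic x Y" "\<forall>y\<in>Y'. y \<preceq> c"
proof -
  have cS: "c \<in> carrier S" using le_closed[OF c(2) x] .
  have mem: "y \<cdot> (\<iota> c \<cdot> c) \<in> G \<longleftrightarrow> y \<in> G" if "pfilter G" "c \<in> G" "y \<in> Y" for y G
  proof
    have yS: "y \<in> carrier S" using that Y le_closed x by blast
    show "y \<in> G" if "y \<cdot> (\<iota> c \<cdot> c) \<in> G"
      using filter_up[OF \<open>pfilter G\<close> that le_cancel_right[OF cS yS] yS] .
  qed (use that in \<open>blast intro: filter_triple\<close>)
  show "F \<in> basic c Y'"
    using F c mem unfolding basic_iff Y'_def by auto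
  show "basic c Y' \<subseteq> basic x Y"
  proof
    fix G assume "G \<in> basic c Y'"
    then have G: "pfilter G" "c \<in> G" "Y' \<inter> G = {}" unfolding basic_iff by auto
    then have "Y \<inter> G = {}" using mem unfolding Y'_def by auto
    then show "G \<in> basic x Y"
      unfolding basic_iff using G filter_up[OF G(1,2) c(2) x] by auto
  qed
  show "\<forall>y\<in>Y'. y \<preceq> c"
    unfolding Y'_def using le_mul_right[OF _ x, of _ "\<iota> c \<cdot> c"] Y le_right[OF c(2) x] cS by auto
qed

text \<open>\<open>topology_generated_by\<close> treats the basis as a subbasis; this induction
  shows that basic sets form a neighbourhood base. Directedness of \<open>F\<close> provides a
  common \<open>c\<close> for two basic sets, and also lets \<open>c\<close> be taken below a
  prescribed member \<open>x\<close>, which the compactness proof uses.\<close>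

lemma open_nbhd:
  assumes "openin ftop V" "F \<in> V" "x \<in> F"
  obtains c Y where "c \<in> F" "c \<preceq> x" "finite Y" "\<forall>y\<in>Y. y \<preceq> c" "F \<in> basic c Y" "basic c Y \<subseteq> V"
proof -
  have F: "pfilter F" using assms openin_subset topspace_ftop by fastforce
  have "generate_topology_on (universal_basis S) V"
    using assms(1) by (simp add: ftop_def openin_topology_generated_by_iff)
  then have "\<exists>c Y. c \<in> F \<and> c \<preceq> x \<and> finite Y \<and> (\<forall>y\<in>Y. y \<preceq> c) \<and> F \<in> basic c Y \<and> basic c Y \<subseteq> V"
    using assms(2)
  proof (induction rule: generate_topology_on.induct)
    case (Int V W)
    from Int.prems have FVW: "F \<in> V" "F \<in> W" by simp_all
    from Int.IH(1)[OF FVW(1)] obtain a A where a: "a \<in> F" "a \<preceq> x" "finite A" "\<forall>y\<in>A. y \<preceq> a"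
      "F \<in> basic a A" "basic a A \<subseteq> V" by (elim exE conjE)
    from Int.IH(2)[OF FVW(2)] obtain b B where b: "b \<in> F" "b \<preceq> x" "finite B" "\<forall>y\<in>B. y \<preceq> b"
      "F \<in> basic b B" "basic b B \<subseteq> W" by (elim exE conjE)
    obtain c where c: "c \<in> F" "c \<preceq> a" "c \<preceq> b" using filter_directed[OF F a(1) b(1)] by blast
    define Y where "Y = (\<lambda>y. y \<cdot> (\<iota> c \<cdot> c)) ` A \<union> (\<lambda>y. y \<cdot> (\<iota> c \<cdot> c)) ` B"
    note sa = basic_shrink[OF a(5) filter_closed[OF F a(1)] a(4) c(1,2)]
    note sb = basic_shrink[OF b(5) filter_closed[OF F b(1)] b(4) c(1,3)]
    have "basic c Y \<subseteq> V \<inter> W" "F \<in> basic c Y"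
      unfolding Y_def basic_Un using sa(1,2) sb(1,2) a(6) b(6) by blast+
    moreover have "\<forall>y\<in>Y. y \<preceq> c" "finite Y"
      unfolding Y_def using sa(3) sb(3) a(3) b(3) by blast+
    moreover have "c \<preceq> x" using le_trans[OF c(2) a(2)] filter_closed[OF F assms(3)] by blast
    ultimately show ?case using c(1) by blast
  next
    case (UN K)
    then obtain k where "k \<in> K" "F \<in> k" by blast
    from UN.IH[OF this] show ?case using \<open>k \<in> K\<close> by (meson Sup_upper subset_trans)
  next
    case (Basis D)
    then obtain z Z where z: "z \<in> carrier S" "finite Z" "\<forall>y\<in>Z. y \<preceq> z" "D = basic z Z"
      unfolding universal_basis_iff by blast
    then have "z \<in> F" using Basis unfolding z(4) basic_iff by blast
    then obtain c where c: "c \<in> F" "c \<preceq> x" "c \<preceq> z" using filter_directed[OF F assms(3)] by blast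
    have "F \<in> basic z Z" using Basis z(4) by blast
    from basic_shrink[OF this z(1,3) c(1,3)] show ?case
      using c z(2,4) by (intro exI[of _ c] exI[of _ "(\<lambda>y. y \<cdot> (\<iota> c \<cdot> c)) ` Z"]) blast
  qed simp
  then show ?thesis using that by blast
qed

section \<open>Compactness of the basic open sets\<close>

text \<open>Let \<open>Z\<close> be the elements whose complements occur in \<open>C\<close>; the
  upward closed set \<open>F\<close> generated by \<open>x\<close> and \<open>Z\<close> lies in none
  of these complements. If \<open>F\<close> is a filter in \<open>basic x Y\<close>, it is covered
  by some \<open>filters_at S z\<close>, so \<open>z\<close> is forced by finitely many elements of
  \<open>Z\<close>. Otherwise zero or some \<open>y \<in> Y\<close> is forced by finitely many.
  Either way finitely many members of \<open>C\<close> suffice.\<close>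

lemma generated_filter_cover:
  assumes x: "x \<in> carrier S" and Y: "\<forall>y\<in>Y. y \<preceq> x"
    and C: "C \<subseteq> {filters_at S z | z. z \<preceq> x} \<union> {- filters_at S z | z. z \<preceq> x}"
    and cov: "basic x Y \<subseteq> \<Union>C"
  shows "\<exists>C'. finite C' \<and> C' \<subseteq> C \<and> basic x Y \<subseteq> \<Union>C'"
proof -
  define Z where "Z = {z. z \<preceq> x \<and> - filters_at S z \<in> C}"
  \<comment> \<open>The elements below \<open>x\<close> that finitely many members of
    \<open>Z\<close>, together with \<open>x\<close>, force into every filter. This semantic form
    avoids iterated meets of finite subsets of \<open>Z\<close>.\<close>
  define M where "M = {c. c \<preceq> x \<and> (\<exists>Z0\<subseteq>Z. finite Z0 \<and> (\<forall>G. pfilter G \<longrightarrow> x \<in> G \<longrightarrow> Z0 \<subseteq> G \<longrightarrow> c \<in> G))}"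
  define F where "F = {s \<in> carrier S. \<exists>c\<in>M. c \<preceq> s}"
  have MS: "c \<in> carrier S" if "c \<in> M" for c
    using that le_closed[OF _ x] unfolding M_def by blast
  have MF: "c \<in> F" if "c \<in> M" for c
    using that MS[OF that] le_refl[OF MS[OF that]] unfolding F_def by blast
  have xM: "x \<in> M" unfolding M_def using x by (auto intro!: exI[of _ "{}"])
  have ZM: "z \<in> M" if "z \<in> Z" for z
    using that unfolding M_def by (auto simp: Z_def intro!: exI[of _ "{z}"])
  have Mdir: "\<exists>d\<in>M. d \<preceq> a \<and> d \<preceq> b" if ab: "a \<in> M" "b \<in> M" for a b
  proof -
    let ?d = "a \<cdot> (\<iota> b \<cdot> b)"
    note S = MS[OF ab(1)] MS[OF ab(2)]
    have le: "a \<preceq> x" "b \<preceq> x" using ab unfolding M_def by auto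
    have da: "?d \<preceq> a" using le_cancel_right[OF S(2,1)] .
    have "?d \<preceq> x \<cdot> (\<iota> b \<cdot> b)" using le_mul_right[OF le(1) x] S by simp
    then have db: "?d \<preceq> b" using le_right[OF le(2) x] by simp
    from ab obtain A B where "A \<subseteq> Z" "finite A" "\<forall>G. pfilter G \<longrightarrow> x \<in> G \<longrightarrow> A \<subseteq> G \<longrightarrow> a \<in> G"
      and "B \<subseteq> Z" "finite B" "\<forall>G. pfilter G \<longrightarrow> x \<in> G \<longrightarrow> B \<subseteq> G \<longrightarrow> b \<in> G"
      unfolding M_def by blast
    then have "A \<union> B \<subseteq> Z" "finite (A \<union> B)"
      "\<forall>G. pfilter G \<longrightarrow> x \<in> G \<longrightarrow> A \<union> B \<subseteq> G \<longrightarrow> ?d \<in> G"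
      by (auto intro!: filter_triple)
    then have "?d \<in> M" unfolding M_def using le_trans[OF da le(1) x] by blast
    then show ?thesis using da db by blast
  qed
  \<comment> \<open>A filter in \<open>basic x Y\<close> either contains all of \<open>Z0\<close>,
    hence \<open>c\<close>, and is covered by \<open>D\<close>, or it misses some
    \<open>z \<in> Z0\<close> and lies in the complement of \<open>filters_at S z\<close>, which is
    a member of \<open>C\<close>.\<close>
  have refuted: ?thesis if c: "c \<in> M" and D: "\<And>G. \<lbrakk>G \<in> basic x Y; c \<in> G\<rbrakk> \<Longrightarrow> G \<in> \<Union>D" "finite D" "D \<subseteq> C" for c D
  proof -
    from c obtain Z0 where Z0: "Z0 \<subseteq> Z" "finite Z0" "\<forall>G. pfilter G \<longrightarrow> x \<in> G \<longrightarrow> Z0 \<subseteq> G \<longrightarrow> c \<in> G"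
      unfolding M_def by blast
    let ?C = "D \<union> (\<lambda>z. - filters_at S z) ` Z0"
    have "G \<in> \<Union>?C" if G: "G \<in> basic x Y" for G
    proof (cases "Z0 \<subseteq> G")
      case True
      then have "c \<in> G" using Z0(3) G unfolding basic_iff by blast
      then show ?thesis using D(1)[OF G] by blast
    next
      case False
      then obtain z where "z \<in> Z0" "z \<notin> G" by blast
      then have "G \<in> - filters_at S z" "- filters_at S z \<in> ?C" by (auto simp: filters_at_iff)
      then show ?thesis by (rule UnionI[rotated])
    qed
    then have "basic x Y \<subseteq> \<Union>?C" by (rule subsetI)
    moreover have "finite ?C" "?C \<subseteq> C" using Z0(1,2) D(2,3) unfolding Z_def by auto
    ultimately show ?thesis by blast
  qed
  show ?thesis
  proof (cases "(\<exists>z. is_zero S z \<and> z \<in> F) \<or> Y \<inter> F \<noteq> {}")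
    case True
    then have "\<exists>c\<in>M. \<forall>G\<in>basic x Y. c \<notin> G"
    proof (elim disjE exE conjE)
      fix z assume z: "is_zero S z" "z \<in> F"
      then obtain c where c: "c \<in> M" "c \<preceq> z" unfolding F_def by blast
      have "c = z" by (rule le_zero[OF c(2) z(1)])
      moreover have "z \<notin> G" if "G \<in> basic x Y" for G
        using that filter_zero z(1) unfolding basic_iff by blast
      ultimately show ?thesis using c(1) by blast
    next
      assume "Y \<inter> F \<noteq> {}"
      then obtain y c where c: "y \<in> Y" "y \<in> carrier S" "c \<in> M" "c \<preceq> y" unfolding F_def by blast
      have "c \<notin> G" if "G \<in> basic x Y" for G
        using that filter_up[of G c y] c unfolding basic_iff by blast
      then show ?thesis using c(3) by blast
    qed
    then obtain c where c: "c \<in> M" "\<forall>G\<in>basic x Y. c \<notin> G" by blast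
    show ?thesis by (rule refuted[OF c(1), of "{}"]) (use c(2) in auto)
  next
    case False
    have F: "pfilter F"
    proof (rule filterI)
      show "x \<in> F" using xM MF by blast
      show "b \<in> F" if "a \<in> F" "b \<in> carrier S" "a \<preceq> b" for a b
        using that le_trans unfolding F_def by blast
      show "\<exists>c\<in>F. c \<preceq> a \<and> c \<preceq> b" if ab: "a \<in> F" "b \<in> F" for a b
      proof -
        from ab obtain a' b' where 1: "a' \<in> M" "b' \<in> M" "a' \<preceq> a" "b' \<preceq> b" "a \<in> carrier S" "b \<in> carrier S"
          unfolding F_def by blast
        then obtain d where "d \<in> M" "d \<preceq> a'" "d \<preceq> b'" using Mdir by blast
        then show ?thesis using 1 MF le_trans by blast
      qed
    qed (use False in \<open>auto simp: F_def\<close>)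
    then have "F \<in> basic x Y" unfolding basic_iff using False xM MF by blast
    then obtain D where D: "D \<in> C" "F \<in> D" using cov by blast
    then consider z where "z \<preceq> x" "D = filters_at S z" | z where "z \<preceq> x" "D = - filters_at S z"
      using C by blast
    then show ?thesis
    proof cases
      case 1
      then have "z \<in> F" using D by (simp add: filters_at_iff)
      then obtain c where c: "c \<in> M" "c \<preceq> z" "z \<in> carrier S" unfolding F_def by blast
      show ?thesis
      proof (rule refuted[OF c(1), of "{D}"])
        show "G \<in> \<Union>{D}" if "G \<in> basic x Y" "c \<in> G" for G
        proof -
          have "pfilter G" using that(1) unfolding basic_iff by blast
          then have "G \<in> D" using filter_up[OF _ that(2) c(2,3)] unfolding 1(2) filters_at_iff by blast
          then show ?thesis by simp
        qed
      qed (use D in auto)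
    next
      case 2
      then have "z \<in> Z" using D unfolding Z_def by simp
      then have "z \<in> F" using ZM MF by blast
      then show ?thesis using D(2) F unfolding 2(2) by (simp add: filters_at_iff)
    qed
  qed
qed

text \<open>Alexander's subbase theorem applies to the topology \<open>X\<close> on \<open>D\<close>
  whose subbase consists of the sets \<open>filters_at S z\<close> and their complements, for
  \<open>z \<preceq> x\<close>. As \<open>X\<close> refines the subspace topology, compactness
  passes to the latter.\<close>

lemma basis_compact:
  assumes "D \<in> universal_basis S"
  shows "compactin ftop D"
proof -
  obtain x Y where x: "x \<in> carrier S" and Y: "finite Y" "\<forall>y\<in>Y. y \<preceq> x" and D: "D = basic x Y"
    using assms unfolding universal_basis_iff by blast
  define \<B> where "\<B> = {filters_at S z | z. z \<preceq> x} \<union> {- filters_at S z | z. z \<preceq> x}"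
  define X where "X = topology (arbitrary union_of (finite intersection_of (\<lambda>x. x \<in> \<B>) relative_to D))"
  have openX: "openin X = arbitrary union_of (finite intersection_of (\<lambda>x. x \<in> \<B>) relative_to D)"
    unfolding X_def using istopology_subbase by (rule topology_inverse')
  have topX: "topspace X = D" unfolding X_def by (rule topspace_subbase)
  have "compact_space X"
  proof (rule Alexander_subbase_alt[OF _ _ X_def[symmetric]])
    have "filters_at S x \<in> \<B>" using x unfolding \<B>_def by auto
    then show "D \<subseteq> \<Union>\<B>" unfolding D basic_def by blast
    show "\<exists>C'. finite C' \<and> C' \<subseteq> C \<and> D \<subseteq> \<Union>C'" if "C \<subseteq> \<B>" "D \<subseteq> \<Union>C" for C
      using generated_filter_cover[OF x Y(2)] that unfolding \<B>_def D by blast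
  qed
  then have "compactin X D" using topX by (simp add: compact_space_def)
  moreover have "topspace X = topspace (subtopology ftop D)"
    using openin_subset[OF basis_open[OF assms]] topX by auto
  moreover have "openin X V" if V: "openin (subtopology ftop D) V" for V
  proof (subst openin_subopen, rule ballI)
    fix F assume F: "F \<in> V"
    obtain W where W: "openin ftop W" "V = W \<inter> D" using V by (auto simp: openin_subtopology)
    have FW: "F \<in> W" "x \<in> F" using F W(2) by (auto simp: D basic_iff)
    obtain c A where c: "c \<in> F" "c \<preceq> x" "finite A" "\<forall>y\<in>A. y \<preceq> c" "F \<in> basic c A" "basic c A \<subseteq> W"
      by (rule open_nbhd[OF W(1) FW])
    let ?\<U> = "insert (filters_at S c) ((\<lambda>a. - filters_at S a) ` A)"
    have "?\<U> \<subseteq> \<B>" using c le_trans[OF _ c(2) x] unfolding \<B>_def by auto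
    then have "(finite intersection_of (\<lambda>x. x \<in> \<B>)) (\<Inter>?\<U>)"
      unfolding intersection_of_def using c(3) by (intro exI[of _ ?\<U>]) auto
    then have "(finite intersection_of (\<lambda>x. x \<in> \<B>) relative_to D) (D \<inter> \<Inter>?\<U>)"
      by (rule relative_to_inc)
    then have "openin X (D \<inter> \<Inter>?\<U>)"
      unfolding openX by (rule arbitrary_union_of_inc)
    moreover have "\<Inter>?\<U> = basic c A" by (auto simp: basic_def)
    ultimately show "\<exists>T. openin X T \<and> F \<in> T \<and> T \<subseteq> V"
      using c F W by (intro exI[of _ "D \<inter> basic c A"]) auto
  qed
  ultimately have "compactin (subtopology ftop D) D" by (rule compactin_contractive)
  then show ?thesis by simp
qed

section \<open>Factorization of filters, and products of basic sets\<close>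

text \<open>Domain of \<open>F\<close> and range of \<open>G\<close> agree because both test whether
  \<open>x \<cdot> s \<cdot> z\<close> lies in \<open>H\<close>; the composite equals
  \<open>H\<close> because the two share the member \<open>x \<cdot> z\<close> and the
  domain.\<close>

lemma factor_filter:
  assumes H: "pfilter H" and x: "x \<in> carrier S" and z: "z \<in> carrier S" and xz: "x \<cdot> z \<in> H"
  defines "F \<equiv> {s \<in> carrier S. s \<cdot> z \<in> H}" and "G \<equiv> {s \<in> carrier S. x \<cdot> s \<in> H}"
  shows "pfilter F" "pfilter G" "dm F = rn G" "F \<odot> G = H" "x \<in> F" "z \<in> G"
proof -
  show F: "pfilter F" unfolding F_def by (rule right_translate_filter[OF H z x xz])
  show G: "pfilter G" unfolding G_def by (rule left_translate_filter[OF H x z xz])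
  show xF: "x \<in> F" and zG: "z \<in> G" unfolding F_def G_def using x z xz by auto
  show FG: "dm F = rn G"
    unfolding gdom_filter[OF F xF] gran_filter[OF G zG]
    using x z by (auto simp: F_def G_def mul_assoc)
  show "F \<odot> G = H"
  proof (rule filter_eqI_gdom[OF gcomp_is_filter[OF F G FG] H _ mul_in_gcomp[OF F G FG xF zG] xz])
    show "dm (F \<odot> G) = dm H"
      unfolding gdom_gcomp_filter(1)[OF F G FG] gdom_filter[OF G zG] gdom_filter[OF H xz]
      using x z by (auto simp: G_def mul_assoc)
  qed
qed

text \<open>Uniqueness for \<open>factor_filter\<close>: the factors are determined by the composite
  and one member of each. Since \<open>z \<cdot> \<iota> z\<close> lies in the range of
  \<open>G\<close>, hence in the domain of \<open>F\<close>, members of \<open>F\<close> can be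
  multiplied by it without leaving \<open>F\<close>; the other side is symmetric.\<close>

lemma gcomp_factors:
  assumes F: "pfilter F" and G: "pfilter G" and FG: "dm F = rn G" and x: "x \<in> F" and z: "z \<in> G"
  shows "F = {s \<in> carrier S. s \<cdot> z \<in> F \<odot> G}" "G = {s \<in> carrier S. x \<cdot> s \<in> F \<odot> G}"
proof -
  have S: "x \<in> carrier S" "z \<in> carrier S" using filter_closed F G x z by auto
  have "s \<cdot> (z \<cdot> \<iota> z) \<in> F \<longleftrightarrow> s \<in> F" if s: "s \<in> carrier S" for s
  proof
    assume "s \<cdot> (z \<cdot> \<iota> z) \<in> F"
    then show "s \<in> F" using filter_up[OF F _ le_cancel_right'[OF S(2) s] s] by blast
  next
    assume "s \<in> F"
    moreover have "z \<cdot> \<iota> z \<in> dm F" using mul_sinv_in_gran[OF G z] FG by simp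
    ultimately show "s \<cdot> (z \<cdot> \<iota> z) \<in> F" by (simp add: gdom_filter[OF F])
  qed
  then show "F = {s \<in> carrier S. s \<cdot> z \<in> F \<odot> G}"
    unfolding gcomp_filter_right[OF F G FG z] using S filter_closed[OF F] by (auto simp: mul_assoc)
  have "\<iota> x \<cdot> (x \<cdot> s) \<in> G \<longleftrightarrow> s \<in> G" if s: "s \<in> carrier S" for s
  proof
    assume "\<iota> x \<cdot> (x \<cdot> s) \<in> G"
    then show "s \<in> G" using filter_up[OF G _ le_cancel_left'[OF S(1) s] s] by blast
  next
    assume sG: "s \<in> G"
    have "\<iota> x \<cdot> x \<in> rn G" using sinv_mul_in_gdom[OF F x] FG by simp
    then show "\<iota> x \<cdot> (x \<cdot> s) \<in> G" using S s by (simp add: gran_filter[OF G sG] mul_assoc)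
  qed
  then show "G = {s \<in> carrier S. x \<cdot> s \<in> F \<odot> G}"
    unfolding gcomp_filter_left[OF F G FG x] using S filter_closed[OF G] by (auto simp: mul_assoc)
qed

abbreviation smul :: "'a set set \<Rightarrow> 'a set set \<Rightarrow> 'a set set"
  where "smul \<equiv> subset_mul (universal_groupoid S)"

text \<open>Unique factorization turns membership of \<open>y\<close> in the left factor into
  membership of \<open>y \<cdot> z\<close> in the composite, and likewise \<open>w\<close> on the
  right into \<open>x \<cdot> w\<close>, so the two families of excluded elements combine.\<close>

lemma basic_mul:
  assumes x: "x \<in> carrier S" and z: "z \<in> carrier S"
    and Y: "\<forall>y\<in>Y. y \<preceq> x" and W: "\<forall>w\<in>W. w \<preceq> z"
  shows "smul (basic x Y) (basic z W) = basic (x \<cdot> z) ((\<lambda>y. y \<cdot> z) ` Y \<union> (\<lambda>w. x \<cdot> w) ` W)"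
    (is "?L = ?R")
proof (intro equalityI subsetI)
  fix H assume "H \<in> ?L"
  then obtain F G where 1: "F \<in> basic x Y" "G \<in> basic z W" and FG: "dm F = rn G" and H: "H = F \<odot> G"
    by (rule UG.subset_mulE)
  have F: "pfilter F" "x \<in> F" "Y \<inter> F = {}" and G: "pfilter G" "z \<in> G" "W \<inter> G = {}"
    using 1 unfolding basic_iff by blast+
  have "y \<cdot> z \<notin> H" if "y \<in> Y" for y
    using gcomp_factors(1)[OF F(1) G(1) FG F(2) G(2)] that F(3) le_closed[of y x] Y x unfolding H by blast
  moreover have "x \<cdot> w \<notin> H" if "w \<in> W" for w
    using gcomp_factors(2)[OF F(1) G(1) FG F(2) G(2)] that G(3) le_closed[of w z] W z unfolding H by blast
  ultimately show "H \<in> ?R"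
    unfolding basic_iff using mul_in_gcomp[OF F(1) G(1) FG F(2) G(2)] gcomp_is_filter[OF F(1) G(1) FG]
    by (auto simp: H)
next
  fix H assume "H \<in> ?R"
  then have H: "pfilter H" "x \<cdot> z \<in> H" "\<forall>y\<in>Y. y \<cdot> z \<notin> H" "\<forall>w\<in>W. x \<cdot> w \<notin> H"
    unfolding basic_iff by blast+
  note f = factor_filter[OF H(1) x z H(2)]
  have "{s \<in> carrier S. s \<cdot> z \<in> H} \<in> basic x Y" "{s \<in> carrier S. x \<cdot> s \<in> H} \<in> basic z W"
    unfolding basic_iff using f H by auto
  from UG.subset_mulI[OF this f(3)] show "H \<in> ?L" unfolding f(4) .
qed

lemma basis_mul:
  assumes "D \<in> universal_basis S" "E \<in> universal_basis S"
  shows "smul D E \<in> universal_basis S"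
proof -
  obtain x Y where x: "x \<in> carrier S" and Y: "finite Y" "\<forall>y\<in>Y. y \<preceq> x" and D: "D = basic x Y"
    using assms unfolding universal_basis_iff by blast
  obtain z W where z: "z \<in> carrier S" and W: "finite W" "\<forall>w\<in>W. w \<preceq> z" and E: "E = basic z W"
    using assms unfolding universal_basis_iff by blast
  show ?thesis
    unfolding D E basic_mul[OF x z Y(2) W(2)]
    using x z Y W le_mul_right le_mul_left by (intro basicI) auto
qed

lemma sinv_image_image: "F \<subseteq> carrier S \<Longrightarrow> \<iota> ` \<iota> ` F = F"
  by (force simp: image_iff)

lemma basis_ginv:
  assumes "D \<in> universal_basis S"
  shows "(`) \<iota> ` D \<in> universal_basis S"
proof -
  obtain x Y where x: "x \<in> carrier S" and Y: "finite Y" "\<forall>y\<in>Y. y \<preceq> x" and D: "D = basic x Y"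
    using assms unfolding universal_basis_iff by blast
  have YS: "Y \<subseteq> carrier S" using Y(2) le_closed x by blast
  have *: "\<iota> ` F \<in> basic (\<iota> x) (\<iota> ` Y)" if F: "F \<in> basic x Y" and x: "x \<in> carrier S" and YS: "Y \<subseteq> carrier S"
    for F x Y
  proof -
    have F: "pfilter F" "x \<in> F" "Y \<inter> F = {}" using F unfolding basic_iff by blast+
    have FS: "F \<subseteq> carrier S" using filter_closed[OF F(1)] by blast
    have "\<iota> y \<notin> \<iota> ` F" if "y \<in> Y" for y
      using that F(3) subsetD[OF YS that] unfolding sinv_image[OF FS] by auto
    then show ?thesis using sinv_filter[OF F(1)] F(2) unfolding basic_iff by auto
  qed
  have "(`) \<iota> ` D = basic (\<iota> x) (\<iota> ` Y)"
  proof (intro equalityI subsetI)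
    fix F assume "F \<in> (`) \<iota> ` D"
    then show "F \<in> basic (\<iota> x) (\<iota> ` Y)" using *[OF _ x YS] unfolding D by blast
  next
    fix F assume F: "F \<in> basic (\<iota> x) (\<iota> ` Y)"
    then have "\<iota> ` F \<in> D"
      using *[OF F] x YS unfolding D by (auto simp: sinv_image_image)
    moreover have "F = \<iota> ` \<iota> ` F"
      using F filter_closed unfolding basic_iff by (subst sinv_image_image) auto
    ultimately show "F \<in> (`) \<iota> ` D" by blast
  qed
  then show ?thesis
    using x Y le_sinv by (auto intro!: basicI)
qed

lemma basis_bisection:
  assumes "D \<in> universal_basis S"
  shows "bisection (universal_groupoid S) D"
proof -
  obtain x Y where "D = basic x Y"
    using assms unfolding universal_basis_iff by blast
  then have D: "pfilter F \<and> x \<in> F" if "F \<in> D" for F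
    using that basic_iff by blast
  show ?thesis
    unfolding UG.bisection_iff
  proof (intro conjI inj_onI)
    show "D \<subseteq> carrier (universal_groupoid S)" using D by auto
  next
    fix F G assume "F \<in> D" "G \<in> D" "dm F = dm G"
    then show "F = G" using filter_eqI_gdom[of F G x] D[of F] D[of G] by simp
  next
    fix F G assume "F \<in> D" "G \<in> D" "rn F = rn G"
    then show "F = G" using filter_eqI_gran[of F G x] D[of F] D[of G] by simp
  qed
qed

lemma basis_KB: "D \<in> universal_basis S \<Longrightarrow> D \<in> carrier (KB (universal_groupoid S))"
  unfolding UG.KB_iff using basis_bisection basis_open basis_compact by blast

lemma compact_open_basis_Union:
  assumes "openin ftop A" "compactin ftop A"
  obtains \<D> where "finite \<D>" "\<D> \<subseteq> universal_basis S" "A = \<Union>\<D>"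
proof -
  let ?\<U> = "{D \<in> universal_basis S. D \<subseteq> A}"
  have "A \<subseteq> \<Union>?\<U>"
  proof
    fix F assume F: "F \<in> A"
    then have pF: "pfilter F" using assms(1) openin_subset topspace_ftop by fastforce
    then obtain x where "x \<in> F" using filter_nonempty by blast
    from open_nbhd[OF assms(1) F this] obtain c Y where c: "c \<in> F" "finite Y" "\<forall>y\<in>Y. y \<preceq> c"
      "F \<in> basic c Y" "basic c Y \<subseteq> A" by metis
    then have "basic c Y \<in> ?\<U>" using basicI[OF filter_closed[OF pF c(1)]] by blast
    then show "F \<in> \<Union>?\<U>" using c(4) by blast
  qed
  moreover have "\<forall>D\<in>?\<U>. openin ftop D" using basis_open by blast
  ultimately obtain \<D> where "finite \<D>" "\<D> \<subseteq> ?\<U>" "A \<subseteq> \<Union>\<D>"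
    using assms(2) unfolding compactin_def by meson
  then show ?thesis by (intro that[of \<D>]) blast+
qed

end

sublocale inverse_semigroup \<subseteq> UG: KB_groupoid "universal_groupoid S"
proof
  \<comment> \<open>Products and inverses distribute over unions, so it is enough that finite unions
    of basic sets are compact-open.\<close>
  have topo: "openin ftop (\<Union>\<D>) \<and> compactin ftop (\<Union>\<D>)" if "finite \<D>" "\<D> \<subseteq> universal_basis S" for \<D>
    using that basis_open basis_compact by (intro conjI openin_Union compactin_Union) blast+
  fix A assume A: "A \<in> carrier (KB (universal_groupoid S))"
  then obtain \<A> where \<A>: "finite \<A>" "\<A> \<subseteq> universal_basis S" "A = \<Union>\<A>"
    unfolding UG.KB_iff using compact_open_basis_Union by metis
  have "(`) \<iota> ` A = \<Union>((\<lambda>D. (`) \<iota> ` D) ` \<A>)" unfolding \<A>(3) by blast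
  moreover have "finite ((\<lambda>D. (`) \<iota> ` D) ` \<A>)" "(\<lambda>D. (`) \<iota> ` D) ` \<A> \<subseteq> universal_basis S"
    using \<A> basis_ginv by blast+
  ultimately have "openin ftop ((`) \<iota> ` A)" "compactin ftop ((`) \<iota> ` A)" using topo by metis+
  moreover have "ginv (universal_groupoid S) ` A = (`) \<iota> ` A" by simp
  moreover have "bisection (universal_groupoid S) (ginv (universal_groupoid S) ` A)"
    using A UG.bisection_ginv unfolding UG.KB_iff by blast
  ultimately show "ginv (universal_groupoid S) ` A \<in> carrier (KB (universal_groupoid S))"
    unfolding UG.KB_iff by metis
  fix B assume B: "B \<in> carrier (KB (universal_groupoid S))"
  then obtain \<B> where \<B>: "finite \<B>" "\<B> \<subseteq> universal_basis S" "B = \<Union>\<B>"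
    unfolding UG.KB_iff using compact_open_basis_Union by metis
  let ?\<C> = "(\<lambda>(D, E). smul D E) ` (\<A> \<times> \<B>)"
  have "smul A B = \<Union>?\<C>" unfolding \<A>(3) \<B>(3) by (rule UG.subset_mul_Union)
  moreover have "finite ?\<C>" "?\<C> \<subseteq> universal_basis S" using \<A> \<B> basis_mul by auto
  ultimately show "smul A B \<in> carrier (KB (universal_groupoid S))"
    using topo[of ?\<C>] A B UG.bisection_subset_mul unfolding UG.KB_iff by metis
qed

section \<open>Prime filters\<close>

context inverse_semigroup
begin

abbreviation prime :: "'a set \<Rightarrow> bool" where "prime \<equiv> is_prime_filter S"

lemma prime_filter: "prime P \<Longrightarrow> pfilter P"
  unfolding is_prime_filter_def by blast

lemma prime_join2:
  "\<lbrakk>prime P; a \<in> carrier S; b \<in> carrier S; is_join S c {a, b}; c \<in> P\<rbrakk> \<Longrightarrow> a \<in> P \<or> b \<in> P"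
  unfolding is_prime_filter_def by blast

lemma is_join_closed: "\<lbrakk>A \<subseteq> carrier S; is_join S a A\<rbrakk> \<Longrightarrow> a \<in> carrier S"
  by (simp add: is_join_iff)

lemma is_join_upper: "\<lbrakk>A \<subseteq> carrier S; is_join S a A; x \<in> A\<rbrakk> \<Longrightarrow> x \<preceq> a"
  by (simp add: is_join_iff)

lemma is_join_least:
  "\<lbrakk>A \<subseteq> carrier S; is_join S a A; b \<in> carrier S; \<And>x. x \<in> A \<Longrightarrow> x \<preceq> b\<rbrakk> \<Longrightarrow> a \<preceq> b"
  by (simp add: is_join_iff)

lemma is_join_unique: "\<lbrakk>A \<subseteq> carrier S; is_join S a A; is_join S b A\<rbrakk> \<Longrightarrow> a = b"
  by (meson is_join_closed is_join_least is_join_upper le_antisym)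

lemma finite_compatible_bounded:
  assumes "A \<subseteq> carrier S" "finite A" "u \<in> carrier S" "\<And>a. a \<in> A \<Longrightarrow> a \<preceq> u"
  shows "finite_compatible S A"
  unfolding finite_compatible_def using assms le_imp_compatible by blast

lemma is_join_sinv:
  assumes A: "A \<subseteq> carrier S" and a: "is_join S a A"
  shows "is_join S (\<iota> a) (\<iota> ` A)"
proof -
  have aS: "a \<in> carrier S" by (rule is_join_closed[OF A a])
  have "\<iota> a \<preceq> b" if b: "b \<in> carrier S" "\<forall>x\<in>A. \<iota> x \<preceq> b" for b
  proof -
    have "x \<preceq> \<iota> b" if "x \<in> A" for x
      using le_sinv[of "\<iota> x" b] b that A by (auto simp: subset_iff)
    then have "a \<preceq> \<iota> b" using is_join_least[OF A a] b by blast
    then show ?thesis using le_sinv[of a "\<iota> b"] b by simp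
  qed
  moreover have "\<iota> x \<preceq> \<iota> a" if "x \<in> A" for x
    using le_sinv is_join_upper[OF A a that] aS by blast
  moreover have "\<iota> ` A \<subseteq> carrier S" using A by auto
  ultimately show ?thesis using aS by (simp add: is_join_iff)
qed

lemma prime_sinv:
  assumes P: "prime P"
  shows "prime (\<iota> ` P)"
proof -
  have F: "pfilter P" by (rule prime_filter[OF P])
  have PS: "P \<subseteq> carrier S" using filter_closed[OF F] by blast
  have "a \<in> \<iota> ` P \<or> b \<in> \<iota> ` P"
    if "a \<in> carrier S" "b \<in> carrier S" "is_join S c {a, b}" "c \<in> \<iota> ` P" for a b c
    using prime_join2[OF P, of "\<iota> a" "\<iota> b" "\<iota> c"] is_join_sinv[of "{a, b}" c] that
    unfolding sinv_image[OF PS] by simp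
  then show ?thesis unfolding is_prime_filter_def using sinv_filter[OF F] by blast
qed

lemma is_join_pair_iff:
  "\<lbrakk>a \<in> carrier S; b \<in> carrier S\<rbrakk> \<Longrightarrow> is_join S c {a, b} \<longleftrightarrow> c \<in> carrier S \<and> a \<preceq> c \<and> b \<preceq> c \<and>
     (\<forall>d\<in>carrier S. a \<preceq> d \<longrightarrow> b \<preceq> d \<longrightarrow> c \<preceq> d)"
  by (simp add: is_join_iff imp_conjL)

text \<open>An idempotent below \<open>j\<close> is also below \<open>\<iota> j \<cdot> j\<close>,
  so the join satisfies \<open>j \<preceq> \<iota> j \<cdot> j\<close>.\<close>

lemma is_join_idem:
  assumes A: "A \<subseteq> \<E>" and j: "is_join S j A"
  shows "j \<in> \<E>"
proof -
  have AS: "A \<subseteq> carrier S" using A by auto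
  have jS: "j \<in> carrier S" by (rule is_join_closed[OF AS j])
  have "x \<preceq> \<iota> j \<cdot> j" if "x \<in> A" for x
    using le_mul[OF le_sinv[OF is_join_upper[OF AS j that] jS] is_join_upper[OF AS j that]] jS
      that A sinv_idem[of x] idem_idem[of x] by (simp add: subset_iff)
  then have "j \<preceq> \<iota> j \<cdot> j" using is_join_least[OF AS j] jS by simp
  then show ?thesis using idem_le jS sinv_mul_idem by blast
qed

end

context distributive_inverse_semigroup
begin

text \<open>The empty set is compatible, and distributivity over its join says that this join
  absorbs multiplication on both sides.\<close>

lemma zero_exists: "\<exists>z. is_zero S z"
proof -
  have "finite_compatible S {}" by (simp add: finite_compatible_def)
  then obtain z where z: "is_join S z {}" using join_exists by blast
  have zS: "z \<in> carrier S" using is_join_closed[OF _ z] by simp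
  have "z \<cdot> s = z" "s \<cdot> z = z" if "s \<in> carrier S" for s
    using mul_join_distrib_right[OF \<open>finite_compatible S {}\<close> z that]
      mul_join_distrib_left[OF \<open>finite_compatible S {}\<close> z that] z
    by (auto intro: is_join_unique[of "{}"])
  then show ?thesis unfolding is_zero_def using zS by blast
qed

lemma is_join_mul_left:
  assumes "a \<in> carrier S" "b \<in> carrier S" "is_join S c {a, b}" "s \<in> carrier S"
  shows "is_join S (s \<cdot> c) {s \<cdot> a, s \<cdot> b}"
proof -
  have "finite_compatible S {a, b}"
    using assms is_join_pair_iff by (intro finite_compatible_bounded[of _ c]) auto
  from mul_join_distrib_left[OF this assms(3,4)] show ?thesis by simp
qed

lemma is_join_mul_right:
  assumes "a \<in> carrier S" "b \<in> carrier S" "is_join S c {a, b}" "s \<in> carrier S"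
  shows "is_join S (c \<cdot> s) {a \<cdot> s, b \<cdot> s}"
proof -
  have "finite_compatible S {a, b}"
    using assms is_join_pair_iff by (intro finite_compatible_bounded[of _ c]) auto
  from mul_join_distrib_right[OF this assms(3,4)] show ?thesis by simp
qed

lemma prime_left_translate:
  assumes P: "prime P" and x: "x \<in> carrier S" and y: "y \<in> carrier S" "x \<cdot> y \<in> P"
  shows "prime {s \<in> carrier S. x \<cdot> s \<in> P}"
proof -
  have "x \<cdot> a \<in> P \<or> x \<cdot> b \<in> P"
    if "a \<in> carrier S" "b \<in> carrier S" "is_join S c {a, b}" "x \<cdot> c \<in> P" for a b c
    using prime_join2[OF P _ _ is_join_mul_left[OF that(1-3) x] that(4)] that x by simp
  then show ?thesis
    unfolding is_prime_filter_def using left_translate_filter[OF prime_filter[OF P] x y] by blast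
qed

lemma prime_right_translate:
  assumes P: "prime P" and x: "x \<in> carrier S" and y: "y \<in> carrier S" "y \<cdot> x \<in> P"
  shows "prime {s \<in> carrier S. s \<cdot> x \<in> P}"
proof -
  have "a \<cdot> x \<in> P \<or> b \<cdot> x \<in> P"
    if "a \<in> carrier S" "b \<in> carrier S" "is_join S c {a, b}" "c \<cdot> x \<in> P" for a b c
    using prime_join2[OF P _ _ is_join_mul_right[OF that(1-3) x] that(4)] that x by simp
  then show ?thesis
    unfolding is_prime_filter_def using right_translate_filter[OF prime_filter[OF P] x y] by blast
qed

text \<open>Primeness speaks of two elements; induction extends it to finite families by splitting
  \<open>c\<close> into \<open>a\<close> and the join of the rest. The empty family is settled by
  properness, its join being zero.\<close>

lemma prime_join:
  assumes A: "finite_compatible S A" and c: "is_join S c A" and P: "prime P"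
  shows "c \<in> P \<longleftrightarrow> (\<exists>a\<in>A. a \<in> P)"
proof
  have AS: "A \<subseteq> carrier S" using A unfolding finite_compatible_def by blast
  note F = prime_filter[OF P]
  show "c \<in> P" if "\<exists>a\<in>A. a \<in> P"
    using that filter_up[OF F] is_join_upper[OF AS c] is_join_closed[OF AS c] by blast
  have "finite A" using A unfolding finite_compatible_def by blast
  then have "\<exists>a\<in>A. a \<in> P" if "finite_compatible S A" "is_join S c A" "c \<in> P"
    using that
  proof (induction A arbitrary: c)
    case empty
    obtain z where z: "is_zero S z" using zero_exists by blast
    then have "c \<preceq> z" using is_join_least[OF _ empty(2)] by (simp add: is_zero_def)
    then have "c = z" using le_zero z by blast
    then show ?case using filter_zero[OF F z] empty by blast
  next
    case (insert a A)
    have S: "a \<in> carrier S" "A \<subseteq> carrier S" and fc: "finite_compatible S A"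
      using insert.prems(1) unfolding finite_compatible_def by auto
    obtain b where b: "is_join S b A" using join_exists[OF fc] by blast
    have bS: "b \<in> carrier S" by (rule is_join_closed[OF S(2) b])
    have cS: "c \<in> carrier S" and ac: "a \<preceq> c" and Ac: "\<And>x. x \<in> A \<Longrightarrow> x \<preceq> c"
      using insert.prems(2) S by (auto simp: is_join_iff)
    have bc: "b \<preceq> c" by (rule is_join_least[OF S(2) b cS Ac])
    have "c \<preceq> d" if d: "d \<in> carrier S" "a \<preceq> d" "b \<preceq> d" for d
    proof (rule is_join_least[OF _ insert.prems(2) d(1)])
      show "insert a A \<subseteq> carrier S" using S by simp
      show "x \<preceq> d" if "x \<in> insert a A" for x
        using that d le_trans[OF is_join_upper[OF S(2) b] d(3) d(1)] by auto
    qed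
    then have "is_join S c {a, b}" using is_join_pair_iff[OF S(1) bS] cS ac bc by blast
    then have "a \<in> P \<or> b \<in> P" by (rule prime_join2[OF P S(1) bS _ insert.prems(3)])
    then show ?case using insert.IH[OF fc b] by blast
  qed
  then show "\<exists>a\<in>A. a \<in> P" if "c \<in> P" using that A c by blast
qed

section \<open>Separation by prime filters\<close>

text \<open>Suppose \<open>d \<in> M\<close> is a join of \<open>b\<close> and \<open>c\<close>,
  neither in \<open>M\<close>. After cutting down to some \<open>w \<in> M\<close> below
  \<open>a\<close> and \<open>d\<close>, maximality says that adjoining either part to
  \<open>M\<close> meets \<open>I\<close>. Some \<open>h \<in> M\<close> below both witnesses is
  then a join of two elements of \<open>I\<close>, so \<open>h \<in> I\<close>. The cut to
  \<open>w\<close> matters because arbitrary elements need not have meets, and because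
  \<open>join\<close> speaks only of joins below \<open>a\<close>.\<close>

lemma maximal_filter_prime:
  assumes M: "pfilter M" "a \<in> M" "M \<inter> I = {}"
    and zero: "\<And>z. is_zero S z \<Longrightarrow> z \<in> I"
    and down: "\<And>i j. \<lbrakk>i \<in> I; j \<preceq> i\<rbrakk> \<Longrightarrow> j \<in> I"
    and join: "\<And>i j k. \<lbrakk>i \<in> I; j \<in> I; i \<in> carrier S; j \<in> carrier S; k \<preceq> a; is_join S k {i, j}\<rbrakk> \<Longrightarrow> k \<in> I"
    and max: "\<And>F. \<lbrakk>pfilter F; M \<subseteq> F; F \<inter> I = {}\<rbrakk> \<Longrightarrow> F = M"
  shows "prime M"
proof -
  have aS: "a \<in> carrier S" using M filter_closed by blast
  have extend: "\<exists>f\<in>M. f \<preceq> w \<and> f \<cdot> (\<iota> x \<cdot> x) \<in> I" if w: "w \<in> M" and x: "x \<preceq> w" "x \<notin> M" for w x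
  proof -
    have S: "w \<in> carrier S" "x \<in> carrier S" using w x filter_closed[OF M(1)] le_closed by blast+
    define e where "e = \<iota> x \<cdot> x"
    have e: "e \<in> \<E>" "e \<in> carrier S" using S by (auto simp: e_def)
    have we: "w \<cdot> e = x" unfolding e_def by (rule le_right[OF x(1) S(1)])
    \<comment> \<open>For \<open>f \<preceq> w\<close> the product \<open>f \<cdot> e\<close> is the
      meet of \<open>f\<close> and \<open>x\<close>, so \<open>F\<close> is the upward closed set
      generated by \<open>M\<close> and \<open>x\<close> under meets.\<close>
    define F where "F = {y \<in> carrier S. \<exists>f\<in>M. f \<preceq> w \<and> f \<cdot> e \<preceq> y}"
    have xF: "x \<in> F" unfolding F_def using S w we by (auto intro!: bexI[of _ w])
    have MF: "M \<subseteq> F"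
    proof
      fix m assume m: "m \<in> M"
      then obtain f where f: "f \<in> M" "f \<preceq> w" "f \<preceq> m" using filter_directed[OF M(1) w] by blast
      have mS: "m \<in> carrier S" using m filter_closed[OF M(1)] by blast
      then show "m \<in> F" unfolding F_def using f le_trans[OF leI_right[OF e(1)] f(3)] by blast
    qed
    have "F \<inter> I \<noteq> {}"
    proof
      assume FI: "F \<inter> I = {}"
      have "pfilter F"
      proof (rule filterI[OF _ xF])
        show "F \<subseteq> carrier S" unfolding F_def by blast
        show "c \<in> F" if "b \<in> F" "c \<in> carrier S" "b \<preceq> c" for b c
          using that le_trans unfolding F_def by blast
        show "z \<notin> F" if "is_zero S z" for z using that zero FI by blast
        show "\<exists>d\<in>F. d \<preceq> b \<and> d \<preceq> c" if bc: "b \<in> F" "c \<in> F" for b c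
        proof -
          from bc obtain f g where f: "f \<in> M" "f \<preceq> w" "f \<cdot> e \<preceq> b" and g: "g \<in> M" "g \<preceq> w" "g \<cdot> e \<preceq> c"
            and bcS: "b \<in> carrier S" "c \<in> carrier S"
            unfolding F_def by blast
          obtain h where h: "h \<in> M" "h \<preceq> f" "h \<preceq> g" using filter_directed[OF M(1) f(1) g(1)] by blast
          note hS = filter_closed[OF M(1) f(1)] filter_closed[OF M(1) g(1)] filter_closed[OF M(1) h(1)]
          have "h \<preceq> w" by (rule le_trans[OF h(2) f(2) S(1)])
          then have "h \<cdot> e \<in> F" unfolding F_def using h(1) hS e by auto
          moreover have "h \<cdot> e \<preceq> b" by (rule le_trans[OF le_mul_right[OF h(2) hS(1) e(2)] f(3) bcS(1)])
          moreover have "h \<cdot> e \<preceq> c" by (rule le_trans[OF le_mul_right[OF h(3) hS(2) e(2)] g(3) bcS(2)])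
          ultimately show ?thesis by blast
        qed
      qed
      then have "F = M" using MF FI by (rule max)
      then show False using xF x by blast
    qed
    then show ?thesis unfolding F_def e_def[symmetric] using down by blast
  qed
  have "b \<in> M \<or> c \<in> M"
    if bc: "b \<in> carrier S" "c \<in> carrier S" and d: "is_join S d {b, c}" "d \<in> M" for b c d
  proof (rule ccontr)
    assume "\<not> (b \<in> M \<or> c \<in> M)"
    then have nM: "b \<notin> M" "c \<notin> M" by auto
    have dS: "d \<in> carrier S" using d filter_closed[OF M(1)] by blast
    obtain w where w: "w \<in> M" "w \<preceq> a" "w \<preceq> d" using filter_directed[OF M(1,2) d(2)] by blast
    have wS: "w \<in> carrier S" using w filter_closed[OF M(1)] by blast
    define e where "e = \<iota> w \<cdot> w"
    have e: "e \<in> \<E>" "e \<in> carrier S" using wS by (auto simp: e_def)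
    have "is_join S (d \<cdot> e) {b \<cdot> e, c \<cdot> e}" by (rule is_join_mul_right[OF bc d(1) e(2)])
    then have wj: "is_join S w {b \<cdot> e, c \<cdot> e}" using le_right[OF w(3) dS] by (simp add: e_def)
    have S: "b \<cdot> e \<in> carrier S" "c \<cdot> e \<in> carrier S" using bc e by auto
    have le: "b \<cdot> e \<preceq> w" "c \<cdot> e \<preceq> w" using wj is_join_pair_iff[OF S] by blast+
    have n: "b \<cdot> e \<notin> M" "c \<cdot> e \<notin> M"
      using nM filter_up[OF M(1) _ leI_right[OF e(1)]] bc by blast+
    obtain f where f: "f \<in> M" "f \<preceq> w" "f \<cdot> (\<iota> (b \<cdot> e) \<cdot> (b \<cdot> e)) \<in> I"
      using extend[OF w(1) le(1) n(1)] by blast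
    obtain g where g: "g \<in> M" "g \<preceq> w" "g \<cdot> (\<iota> (c \<cdot> e) \<cdot> (c \<cdot> e)) \<in> I"
      using extend[OF w(1) le(2) n(2)] by blast
    obtain h where h: "h \<in> M" "h \<preceq> f" "h \<preceq> g" using filter_directed[OF M(1) f(1) g(1)] by blast
    note hS = filter_closed[OF M(1) f(1)] filter_closed[OF M(1) g(1)] filter_closed[OF M(1) h(1)]
    have hw: "h \<preceq> w" by (rule le_trans[OF h(2) f(2) wS])
    obtain k where k: "k \<in> \<E>" "h = w \<cdot> k" using hw by (auto simp: natural_le_iff)
    have "h \<cdot> (\<iota> w \<cdot> w) = h"
      unfolding k(2) using k(1) wS idem_commute[OF k(1) sinv_mul_idem[OF wS]]
      by (simp add: mul_assoc) (simp add: mul_sinv_cancel_left)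
    then have hw': "h \<cdot> \<iota> w \<cdot> w = h" using hS wS by (simp add: mul_assoc)
    \<comment> \<open>Left multiplication by \<open>h \<cdot> \<iota> w\<close> takes
      \<open>w\<close> to \<open>h\<close> and every \<open>x\<close> below \<open>w\<close> to its
      meet with \<open>h\<close>; distributivity thus restricts the join \<open>w\<close> to
      \<open>h\<close>.\<close>
    have restr: "h \<cdot> \<iota> w \<cdot> x = h \<cdot> (\<iota> x \<cdot> x)" if x: "x \<preceq> w" for x
    proof -
      have xS: "x \<in> carrier S" by (rule le_closed[OF x wS])
      have "h \<cdot> \<iota> w \<cdot> x = h \<cdot> \<iota> w \<cdot> (w \<cdot> (\<iota> x \<cdot> x))" using le_right[OF x wS] by simp
      also have "\<dots> = h \<cdot> \<iota> w \<cdot> w \<cdot> (\<iota> x \<cdot> x)" using hS wS xS by (simp add: mul_assoc)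
      finally show ?thesis by (simp add: hw')
    qed
    have "is_join S h {h \<cdot> (\<iota> (b \<cdot> e) \<cdot> (b \<cdot> e)), h \<cdot> (\<iota> (c \<cdot> e) \<cdot> (c \<cdot> e))}"
      using is_join_mul_left[OF S wj, of "h \<cdot> \<iota> w"] hS wS by (simp add: restr le hw')
    moreover have "h \<cdot> (\<iota> (b \<cdot> e) \<cdot> (b \<cdot> e)) \<in> I"
      by (rule down[OF f(3)]) (intro le_mul_right h hS mul_closed sinv_closed S)
    moreover have "h \<cdot> (\<iota> (c \<cdot> e) \<cdot> (c \<cdot> e)) \<in> I"
      by (rule down[OF g(3)]) (intro le_mul_right h hS mul_closed sinv_closed S)
    ultimately have "h \<in> I"
      using join[of "h \<cdot> (\<iota> (b \<cdot> e) \<cdot> (b \<cdot> e))" "h \<cdot> (\<iota> (c \<cdot> e) \<cdot> (c \<cdot> e))" h]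
        le_trans[OF hw w(2) aS] hS S by blast
    then show False using h M by blast
  qed
  then show ?thesis unfolding is_prime_filter_def using M(1) by blast
qed

text \<open>Zorn's lemma on the filters through \<open>a\<close> that avoid \<open>I\<close>; the
  principal filter of \<open>a\<close> is one of them because \<open>I\<close> is down-closed and
  misses \<open>a\<close>.\<close>

lemma prime_filter_separation:
  assumes a: "a \<in> carrier S" "a \<notin> I"
    and below: "\<And>i. i \<in> I \<Longrightarrow> i \<preceq> a"
    and zero: "\<And>z. is_zero S z \<Longrightarrow> z \<in> I"
    and down: "\<And>i j. \<lbrakk>i \<in> I; j \<preceq> i\<rbrakk> \<Longrightarrow> j \<in> I"
    and join: "\<And>i j k. \<lbrakk>i \<in> I; j \<in> I; i \<in> carrier S; j \<in> carrier S; k \<preceq> a; is_join S k {i, j}\<rbrakk> \<Longrightarrow> k \<in> I"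
  obtains P where "prime P" "a \<in> P" "P \<inter> I = {}"
proof -
  define \<F> where "\<F> = {F. pfilter F \<and> a \<in> F \<and> F \<inter> I = {}}"
  have "\<exists>M\<in>\<F>. \<forall>F\<in>\<F>. M \<subseteq> F \<longrightarrow> F = M"
  proof (rule subset_Zorn_nonempty)
    let ?U = "{b \<in> carrier S. a \<preceq> b}"
    have UI: "?U \<inter> I = {}" using a below down by blast
    have "pfilter ?U"
    proof (rule filterI[of _ a])
      show "\<exists>c\<in>?U. c \<preceq> b \<and> c \<preceq> b'" if "b \<in> ?U" "b' \<in> ?U" for b b'
        using that a by (intro bexI[of _ a]) auto
      show "c \<in> ?U" if "b \<in> ?U" "c \<in> carrier S" "b \<preceq> c" for b c
        using that le_trans by blast
      show "z \<notin> ?U" if "is_zero S z" for z using UI zero[OF that] by blast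
    qed (use a in auto)
    then have "?U \<in> \<F>" unfolding \<F>_def using a UI by auto
    then show "\<F> \<noteq> {}" by blast
  next
    fix C assume C: "C \<noteq> {}" "subset.chain \<F> C"
    then have CF: "F \<in> \<F>" if "F \<in> C" for F using that by (auto simp: subset.chain_def)
    have CP: "pfilter F" "a \<in> F" "F \<inter> I = {}" if "F \<in> C" for F using CF[OF that] unfolding \<F>_def by auto
    obtain F0 where F0: "F0 \<in> C" using C by blast
    have "pfilter (\<Union>C)"
    proof (rule filterI[of _ a])
      show "\<Union>C \<subseteq> carrier S" using CP(1) filter_closed by blast
      show "a \<in> \<Union>C" using F0 CP(2) by blast
      show "c \<in> \<Union>C" if "b \<in> \<Union>C" "c \<in> carrier S" "b \<preceq> c" for b c
        using that CP(1) filter_up by blast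
      show "z \<notin> \<Union>C" if "is_zero S z" for z using that CP(1) filter_zero by blast
      show "\<exists>d\<in>\<Union>C. d \<preceq> b \<and> d \<preceq> c" if bc: "b \<in> \<Union>C" "c \<in> \<Union>C" for b c
      proof -
        from bc obtain F G where FG: "F \<in> C" "G \<in> C" "b \<in> F" "c \<in> G" by blast
        have "F \<subseteq> G \<or> G \<subseteq> F" using C(2) FG(1,2) by (auto simp: subset_chain_def)
        then obtain H where H: "H \<in> C" "b \<in> H" "c \<in> H" using FG by blast
        then show ?thesis using filter_directed[OF CP(1)[OF H(1)] H(2,3)] by blast
      qed
    qed
    then show "\<Union>C \<in> \<F>" unfolding \<F>_def using F0 CP(2,3) by blast
  qed
  then obtain M where "M \<in> \<F>" and Mmax: "\<And>F. \<lbrakk>F \<in> \<F>; M \<subseteq> F\<rbrakk> \<Longrightarrow> F = M" by blast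
  then have M: "pfilter M" "a \<in> M" "M \<inter> I = {}" unfolding \<F>_def by auto
  have "prime M"
  proof (rule maximal_filter_prime[OF M zero down join])
    show "F = M" if "pfilter F" "M \<subseteq> F" "F \<inter> I = {}" for F
      using that M(2) by (intro Mmax) (auto simp: \<F>_def)
  qed
  then show ?thesis using that M by blast
qed

lemma le_by_primes:
  assumes s: "s \<in> carrier S" and t: "t \<in> carrier S" and P: "\<And>P. \<lbrakk>prime P; s \<in> P\<rbrakk> \<Longrightarrow> t \<in> P"
  shows "s \<preceq> t"
proof (rule ccontr)
  assume n: "\<not> s \<preceq> t"
  \<comment> \<open>A filter that contains \<open>s\<close> and avoids all common lower bounds of
    \<open>s\<close> and \<open>t\<close> cannot contain \<open>t\<close>, by directedness.\<close>
  let ?I = "{c. c \<preceq> s \<and> c \<preceq> t}"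
  obtain P where P': "prime P" "s \<in> P" "P \<inter> ?I = {}"
  proof (rule prime_filter_separation[OF s, of ?I])
    show "z \<in> ?I" if "is_zero S z" for z using that is_zero_least s t by blast
    show "j \<in> ?I" if "i \<in> ?I" "j \<preceq> i" for i j using that le_trans s t by blast
    show "k \<in> ?I" if "i \<in> ?I" "j \<in> ?I" "i \<in> carrier S" "j \<in> carrier S" "is_join S k {i, j}" for i j k
      using that s t by (simp add: is_join_pair_iff)
  qed (use n in auto)
  then obtain c where "c \<in> P" "c \<preceq> s" "c \<preceq> t"
    using P filter_directed prime_filter by metis
  then show False using P'(3) by blast
qed

lemma eq_by_primes:
  assumes "s \<in> carrier S" "t \<in> carrier S" "\<And>P. prime P \<Longrightarrow> s \<in> P \<longleftrightarrow> t \<in> P"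
  shows "s = t"
  using assms by (intro le_antisym le_by_primes) auto

lemma idem_by_primes:
  assumes u: "u \<in> carrier S" and P: "\<And>P. \<lbrakk>prime P; u \<in> P\<rbrakk> \<Longrightarrow> \<exists>e\<in>\<E>. e \<in> P"
  shows "u \<in> \<E>"
proof (rule ccontr)
  assume n: "u \<notin> \<E>"
  \<comment> \<open>A filter containing \<open>u\<close> and some idempotent contains a common lower
    bound of both, which is an idempotent below \<open>u\<close>.\<close>
  let ?I = "{c \<in> \<E>. c \<preceq> u}"
  obtain Q where Q: "prime Q" "u \<in> Q" "Q \<inter> ?I = {}"
  proof (rule prime_filter_separation[OF u, of ?I])
    show "z \<in> ?I" if "is_zero S z" for z
      using that is_zero_least u unfolding is_zero_def by (auto intro: idemI)
    show "j \<in> ?I" if "i \<in> ?I" "j \<preceq> i" for i j using that le_trans u idem_le by blast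
    show "k \<in> ?I" if "i \<in> ?I" "j \<in> ?I" "k \<preceq> u" "is_join S k {i, j}" for i j k
      using that is_join_idem[of "{i, j}" k] by blast
  qed (use n in auto)
  obtain e where e: "e \<in> \<E>" "e \<in> Q" using P Q by blast
  then obtain c where "c \<in> Q" "c \<preceq> u" "c \<preceq> e" using Q filter_directed prime_filter by metis
  then show False using Q(3) idem_le[OF _ e(1)] by blast
qed

end

section \<open>Relative complements of arbitrary elements\<close>

context weakly_boolean_inverse_semigroup
begin

text \<open>Translates the lattice complement into semigroup terms. The product
  \<open>f \<cdot> z\<close> lies below the lattice meet and so is zero. The lattice join is least
  only among idempotents, so it is compared with the join \<open>j\<close> taken in
  \<open>S\<close>: from \<open>j \<preceq> e\<close> it follows that \<open>j\<close> is
  idempotent, whence \<open>e \<preceq> j\<close>.\<close>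

lemma idempotent_complement:
  assumes f: "f \<in> \<E>" and e: "e \<in> \<E>" and fe: "f \<preceq> e"
  obtains z where "z \<in> \<E>" "is_zero S (f \<cdot> z)" "is_join S e {f, z}"
proof -
  let ?L = "(natural_order S)\<lparr>carrier := \<E>\<rparr>"
  interpret L: generalized_boolean_algebra ?L by (rule idempotents_boolean)
  have c: "carrier ?L = \<E>" by simp
  have le: "x \<sqsubseteq>\<^bsub>?L\<^esub> y \<longleftrightarrow> x \<preceq> y" for x y by simp
  obtain z where z: "z \<in> \<E>" "f \<sqinter>\<^bsub>?L\<^esub> z = \<bottom>\<^bsub>?L\<^esub>" "f \<squnion>\<^bsub>?L\<^esub> z = e"
    using L.relative_complement[of f e] f e fe unfolding c le by blast
  obtain o' where o': "is_zero S o'" using zero_exists by blast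
  then have oE: "o' \<in> \<E>" unfolding is_zero_def by (auto intro: idemI)
  have fz: "f \<cdot> z \<in> \<E>" by (rule idem_mul_closed[OF f z(1)])
  have "f \<cdot> z \<preceq> f" "f \<cdot> z \<preceq> z" using leI_right[OF z(1)] leI_left[OF f] z(1) by auto
  then have "f \<cdot> z \<preceq> \<bottom>\<^bsub>?L\<^esub>"
    using L.meet_le[of "f \<cdot> z" f z] f z fz unfolding c le z(2) by blast
  moreover have "\<bottom>\<^bsub>?L\<^esub> \<preceq> o'" using L.bottom_lower[of o'] oE unfolding c le by blast
  ultimately have "f \<cdot> z \<preceq> o'" using oE by (blast intro: le_trans idem_closed)
  then have 1: "is_zero S (f \<cdot> z)" using le_zero o' by metis
  have S: "f \<in> carrier S" "z \<in> carrier S" "e \<in> carrier S" using f z e by auto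
  have fze: "f \<preceq> e" "z \<preceq> e"
    using L.join_left[of f z] L.join_right[of f z] f z(1) unfolding c le z(3) by blast+
  then have "finite_compatible S {f, z}"
    using S by (intro finite_compatible_bounded[of _ e]) auto
  then obtain j where j: "is_join S j {f, z}" using join_exists by blast
  then have jp: "j \<in> carrier S" "f \<preceq> j" "z \<preceq> j" "j \<preceq> e" using is_join_pair_iff[OF S(1,2)] S fze by blast+
  have jE: "j \<in> \<E>" using idem_le[OF jp(4) e] .
  have "e \<preceq> j" using L.join_le[where x = f and y = z and z = j] jp jE f z(1) unfolding c le z(3) by blast
  then have "j = e" using le_antisym jp S by blast
  then show ?thesis using that z(1) 1 j by blast
qed

text \<open>Take \<open>t \<cdot> z\<close>, with \<open>z\<close> the complement of
  \<open>\<iota> s \<cdot> s\<close> in \<open>\<iota> t \<cdot> t\<close>. Then \<open>t\<close> is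
  the join of \<open>s\<close> and \<open>t \<cdot> z\<close>, so a prime filter through
  \<open>t\<close> contains one of them. It cannot contain both: a common lower bound is fixed by
  \<open>\<iota> s \<cdot> s\<close> and by \<open>z\<close>, whose product is zero.\<close>

lemma relative_difference:
  assumes st: "s \<preceq> t" and t: "t \<in> carrier S"
  obtains u where "u \<in> carrier S" "u \<preceq> t" "\<And>P. prime P \<Longrightarrow> u \<in> P \<longleftrightarrow> t \<in> P \<and> s \<notin> P"
proof -
  have s: "s \<in> carrier S" by (rule le_closed[OF st t])
  obtain z where z: "z \<in> \<E>" "is_zero S ((\<iota> s \<cdot> s) \<cdot> z)" "is_join S (\<iota> t \<cdot> t) {\<iota> s \<cdot> s, z}"
    by (rule idempotent_complement[of "\<iota> s \<cdot> s" "\<iota> t \<cdot> t"]) (use s t st in \<open>auto intro!: le_mul le_sinv\<close>)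
  have zS: "z \<in> carrier S" using z(1) by simp
  have "is_join S (t \<cdot> (\<iota> t \<cdot> t)) {t \<cdot> (\<iota> s \<cdot> s), t \<cdot> z}"
    using is_join_mul_left[OF _ zS z(3) t] s by simp
  then have j: "is_join S t {s, t \<cdot> z}" using t by (simp add: mul_sinv_cancel le_right[OF st t])
  have "t \<cdot> z \<in> P \<longleftrightarrow> t \<in> P \<and> s \<notin> P" if P: "prime P" for P
  proof
    note F = prime_filter[OF P]
    assume tz: "t \<cdot> z \<in> P"
    have "s \<notin> P"
    proof
      assume sP: "s \<in> P"
      then obtain c where c: "c \<in> P" "c \<preceq> s" "c \<preceq> t \<cdot> z" using filter_directed[OF F _ tz] by blast
      have cS: "c \<in> carrier S" by (rule filter_closed[OF F c(1)])
      have "c \<preceq> c \<cdot> (\<iota> s \<cdot> s) \<cdot> z"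
      proof -
        obtain k where k: "k \<in> \<E>" "c = t \<cdot> z \<cdot> k" using c(3) by (auto simp: natural_le_iff)
        have cz: "c \<cdot> z = c"
          unfolding k(2) using k(1) z(1) t idem_commute[OF k(1) z(1)] idem_idem_left[OF z(1), of k]
          by (simp add: mul_assoc)
        obtain l where l: "l \<in> \<E>" "c = s \<cdot> l" using c(2) by (auto simp: natural_le_iff)
        have "c \<cdot> (\<iota> s \<cdot> s) = c"
          unfolding l(2) using l(1) s idem_commute[OF l(1) sinv_mul_idem[OF s]]
          by (simp add: mul_assoc) (simp add: mul_sinv_cancel_left)
        then show ?thesis using cz cS by simp
      qed
      moreover have "is_zero S (c \<cdot> (\<iota> s \<cdot> s) \<cdot> z)"
        using z(2) cS s zS unfolding is_zero_def by (simp add: mul_assoc)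
      ultimately show False using c(1) le_zero filter_zero[OF F] by metis
    qed
    moreover have "t \<in> P" by (rule filter_up[OF F tz leI_right[OF z(1)] t])
    ultimately show "t \<in> P \<and> s \<notin> P" by blast
  next
    assume "t \<in> P \<and> s \<notin> P"
    then show "t \<cdot> z \<in> P" using prime_join2[OF P s _ j] t zS by blast
  qed
  then show ?thesis using that[of "t \<cdot> z"] leI_right[OF z(1)] t zS by blast
qed

end

section \<open>The universal property\<close>

locale prime_hom =
  S: inverse_semigroup_with_zero S + T: weakly_boolean_inverse_semigroup T
  for S :: "('a, 'm) semigrp_scheme" and T :: "('b, 'n) semigrp_scheme" +
  fixes \<theta> :: "'a \<Rightarrow> 'b"
  assumes hom: "\<theta> \<in> semigroup_hom S T"
    and prime_vimage: "T.prime P \<Longrightarrow> S.pfilter {s \<in> carrier S. \<theta> s \<in> P}"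
begin

abbreviation pre :: "'b set \<Rightarrow> 'a set" where "pre P \<equiv> {s \<in> carrier S. \<theta> s \<in> P}"

definition represents :: "'b \<Rightarrow> 'a set set \<Rightarrow> bool" where
  "represents t A \<longleftrightarrow> t \<in> carrier T \<and> (\<forall>P. T.prime P \<longrightarrow> (t \<in> P \<longleftrightarrow> pre P \<in> A))"

lemma hom_closed [simp]: "s \<in> carrier S \<Longrightarrow> \<theta> s \<in> carrier T"
  using hom unfolding semigroup_hom_def by blast

lemma hom_mul: "\<lbrakk>s \<in> carrier S; t \<in> carrier S\<rbrakk> \<Longrightarrow> \<theta> (s \<cdot>\<^bsub>S\<^esub> t) = \<theta> s \<cdot>\<^bsub>T\<^esub> \<theta> t"
  using hom unfolding semigroup_hom_def by blast

lemma hom_sinv: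
  assumes s: "s \<in> carrier S"
  shows "\<theta> (sinv S s) = sinv T (\<theta> s)"
proof (rule T.sinv_eqI[symmetric])
  show "\<theta> s \<cdot>\<^bsub>T\<^esub> \<theta> (sinv S s) \<cdot>\<^bsub>T\<^esub> \<theta> s = \<theta> s"
    using S.sinv_props[OF s] s by (metis S.mul_closed hom_mul)
  show "\<theta> (sinv S s) \<cdot>\<^bsub>T\<^esub> \<theta> s \<cdot>\<^bsub>T\<^esub> \<theta> (sinv S s) = \<theta> (sinv S s)"
    using S.sinv_props[OF s] s by (metis S.mul_closed hom_mul)
qed (use s in auto)

lemma hom_le:
  assumes "natural_le S s t" "t \<in> carrier S"
  shows "natural_le T (\<theta> s) (\<theta> t)"
proof -
  obtain e where e: "e \<in> idempotents S" "s = t \<cdot>\<^bsub>S\<^esub> e" using assms(1) unfolding S.natural_le_iff by blast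
  have eS: "e \<in> carrier S" using e(1) by (rule S.idem_closed)
  have "\<theta> e \<in> idempotents T"
    using hom_mul[OF eS eS] S.idem_idem[OF e(1)] eS by (intro T.idemI) auto
  then show ?thesis unfolding e(2) hom_mul[OF assms(2) eS] by (rule T.leI_right)
qed

lemma representsD: "\<lbrakk>represents t A; T.prime P\<rbrakk> \<Longrightarrow> t \<in> P \<longleftrightarrow> pre P \<in> A"
  unfolding represents_def by blast

lemma represents_closed: "represents t A \<Longrightarrow> t \<in> carrier T"
  unfolding represents_def by blast

lemma represents_unique: "\<lbrakk>represents s A; represents t A\<rbrakk> \<Longrightarrow> s = t"
  by (rule T.eq_by_primes) (simp_all add: represents_def)

lemma pre_nonempty:
  assumes "T.prime P"
  obtains p where "p \<in> carrier S" "\<theta> p \<in> P" "p \<in> pre P"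
  using S.filter_nonempty[OF prime_vimage[OF assms]] by blast

text \<open>One element \<open>p\<close> with \<open>\<theta> p \<in> P\<close> computes both sides;
  it exists because \<open>pre P\<close> is a filter and so non-empty. With the analogues for range
  and composite, \<open>pre\<close> acts as a functor into the universal groupoid.\<close>

lemma gdom_pre:
  assumes P: "T.prime P"
  shows "S.dm (pre P) = {x \<in> carrier S. \<theta> x \<in> T.dm P}"
proof -
  obtain p where p: "p \<in> carrier S" "\<theta> p \<in> P" "p \<in> pre P" using pre_nonempty[OF P] .
  show ?thesis
    unfolding S.gdom_filter[OF prime_vimage[OF P] p(3)] T.gdom_filter[OF T.prime_filter[OF P] p(2)]
    using p by (auto simp: hom_mul)
qed

lemma gran_pre:
  assumes P: "T.prime P"
  shows "S.rn (pre P) = {x \<in> carrier S. \<theta> x \<in> T.rn P}"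
proof -
  obtain p where p: "p \<in> carrier S" "\<theta> p \<in> P" "p \<in> pre P" using pre_nonempty[OF P] .
  show ?thesis
    unfolding S.gran_filter[OF prime_vimage[OF P] p(3)] T.gran_filter[OF T.prime_filter[OF P] p(2)]
    using p by (auto simp: hom_mul)
qed

lemma gcomp_pre:
  assumes P: "T.prime P" and Q: "T.prime Q" and PQ: "T.dm P = T.rn Q"
  shows "S.cp (pre P) (pre Q) = {x \<in> carrier S. \<theta> x \<in> T.cp P Q}"
proof -
  obtain q where q: "q \<in> carrier S" "\<theta> q \<in> Q" "q \<in> pre Q" using pre_nonempty[OF Q] .
  have d: "S.dm (pre P) = S.rn (pre Q)" using gdom_pre[OF P] gran_pre[OF Q] PQ by simp
  show ?thesis
    unfolding S.gcomp_filter_right[OF prime_vimage[OF P] prime_vimage[OF Q] d q(3)]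
      T.gcomp_filter_right[OF T.prime_filter[OF P] T.prime_filter[OF Q] PQ q(2)]
    using q by (auto simp: hom_mul hom_sinv)
qed

text \<open>Both directions factor \<open>P\<close>. If the product of \<open>s\<close> and
  \<open>t\<close> is in \<open>P\<close>, the factors of \<open>P\<close> through \<open>s\<close>
  and \<open>t\<close> are mapped by \<open>pre\<close>. Conversely, a factorization of
  \<open>pre P\<close> through \<open>f\<close> and \<open>g\<close> is lifted to one of
  \<open>P\<close> through \<open>\<theta> f\<close> and \<open>\<theta> g\<close>.\<close>

lemma represents_mul:
  assumes A: "A \<subseteq> {F. S.pfilter F}" and B: "B \<subseteq> {F. S.pfilter F}"
    and s: "represents s A" and t: "represents t B"
  shows "represents (s \<cdot>\<^bsub>T\<^esub> t) (S.smul A B)"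
proof -
  note ST = represents_closed[OF s] represents_closed[OF t]
  have "s \<cdot>\<^bsub>T\<^esub> t \<in> P \<longleftrightarrow> pre P \<in> S.smul A B" if P: "T.prime P" for P
  proof
    assume st: "s \<cdot>\<^bsub>T\<^esub> t \<in> P"
    note f = T.factor_filter[OF T.prime_filter[OF P] ST st]
    let ?Q = "{y \<in> carrier T. y \<cdot>\<^bsub>T\<^esub> t \<in> P}" and ?R = "{y \<in> carrier T. s \<cdot>\<^bsub>T\<^esub> y \<in> P}"
    have Q: "T.prime ?Q" by (rule T.prime_right_translate[OF P ST(2,1) st])
    have R: "T.prime ?R" by (rule T.prime_left_translate[OF P ST st])
    have "pre ?Q \<in> A" using f(5) representsD[OF s Q] by blast
    moreover have "pre ?R \<in> B" using f(6) representsD[OF t R] by blast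
    moreover have "S.dm (pre ?Q) = S.rn (pre ?R)" unfolding gdom_pre[OF Q] gran_pre[OF R] f(3) ..
    ultimately have "S.cp (pre ?Q) (pre ?R) \<in> S.smul A B" by (rule S.UG.subset_mulI)
    then show "pre P \<in> S.smul A B" unfolding gcomp_pre[OF Q R f(3)] f(4) .
  next
    assume "pre P \<in> S.smul A B"
    then obtain F G where FG: "F \<in> A" "G \<in> B" "S.dm F = S.rn G" "pre P = S.cp F G"
      by (rule S.UG.subset_mulE)
    have F: "S.pfilter F" and G: "S.pfilter G" using FG A B by auto
    obtain f g where fg: "f \<in> F" "g \<in> G" using S.filter_nonempty F G by metis
    have fgS: "f \<in> carrier S" "g \<in> carrier S" using fg F G S.filter_closed by auto
    note fac = S.gcomp_factors[OF F G FG(3) fg, folded FG(4)]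
    have "f \<cdot>\<^bsub>S\<^esub> g \<in> pre P" using S.mul_in_gcomp[OF F G FG(3) fg] FG(4) by simp
    then have fgP: "\<theta> f \<cdot>\<^bsub>T\<^esub> \<theta> g \<in> P" using fgS by (simp add: hom_mul)
    \<comment> \<open>The lifted factors: by unique factorization in \<open>S\<close> their
      preimages are exactly \<open>F\<close> and \<open>G\<close>, so they contain \<open>s\<close>
      and \<open>t\<close>.\<close>
    let ?Q = "{y \<in> carrier T. y \<cdot>\<^bsub>T\<^esub> \<theta> g \<in> P}" and ?R = "{y \<in> carrier T. \<theta> f \<cdot>\<^bsub>T\<^esub> y \<in> P}"
    have Q: "T.prime ?Q" by (rule T.prime_right_translate[OF P _ _ fgP]) (use fgS in auto)
    have R: "T.prime ?R" by (rule T.prime_left_translate[OF P _ _ fgP]) (use fgS in auto)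
    have "pre ?Q = F" by (subst fac(1)) (use fgS in \<open>auto simp: hom_mul\<close>)
    then have "s \<in> ?Q" using representsD[OF s Q] FG(1) by simp
    moreover have "pre ?R = G" by (subst fac(2)) (use fgS in \<open>auto simp: hom_mul\<close>)
    then have "t \<in> ?R" using representsD[OF t R] FG(2) by simp
    ultimately have sg: "s \<cdot>\<^bsub>T\<^esub> \<theta> g \<in> P" "\<theta> f \<cdot>\<^bsub>T\<^esub> t \<in> P" by auto
    have fgT: "\<theta> f \<in> carrier T" "\<theta> g \<in> carrier T" using fgS by auto
    \<comment> \<open>In this triple product \<open>\<theta> g\<close> and \<open>\<theta> f\<close>
      each meet their own inverse in the middle, which leaves an element below the product of
      \<open>s\<close> and \<open>t\<close>.\<close>
    have "s \<cdot>\<^bsub>T\<^esub> \<theta> g \<cdot>\<^bsub>T\<^esub> (sinv T (\<theta> f \<cdot>\<^bsub>T\<^esub> \<theta> g) \<cdot>\<^bsub>T\<^esub> (\<theta> f \<cdot>\<^bsub>T\<^esub> t)) \<in> P"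
      by (rule T.filter_triple[OF T.prime_filter[OF P] sg(1) fgP sg(2)])
    also have "s \<cdot>\<^bsub>T\<^esub> \<theta> g \<cdot>\<^bsub>T\<^esub> (sinv T (\<theta> f \<cdot>\<^bsub>T\<^esub> \<theta> g) \<cdot>\<^bsub>T\<^esub> (\<theta> f \<cdot>\<^bsub>T\<^esub> t)) =
        s \<cdot>\<^bsub>T\<^esub> (\<theta> g \<cdot>\<^bsub>T\<^esub> (sinv T (\<theta> g) \<cdot>\<^bsub>T\<^esub> (sinv T (\<theta> f) \<cdot>\<^bsub>T\<^esub> (\<theta> f \<cdot>\<^bsub>T\<^esub> t))))"
      using fgT ST by (simp add: T.sinv_mul T.mul_assoc)
    finally have 1: "s \<cdot>\<^bsub>T\<^esub> (\<theta> g \<cdot>\<^bsub>T\<^esub> (sinv T (\<theta> g) \<cdot>\<^bsub>T\<^esub> (sinv T (\<theta> f) \<cdot>\<^bsub>T\<^esub> (\<theta> f \<cdot>\<^bsub>T\<^esub> t)))) \<in> P" .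
    have "natural_le T (\<theta> g \<cdot>\<^bsub>T\<^esub> (sinv T (\<theta> g) \<cdot>\<^bsub>T\<^esub> (sinv T (\<theta> f) \<cdot>\<^bsub>T\<^esub> (\<theta> f \<cdot>\<^bsub>T\<^esub> t)))) t"
      by (rule T.le_trans[OF T.le_cancel_left T.le_cancel_left']) (use fgT ST in auto)
    then have "natural_le T (s \<cdot>\<^bsub>T\<^esub> (\<theta> g \<cdot>\<^bsub>T\<^esub> (sinv T (\<theta> g) \<cdot>\<^bsub>T\<^esub> (sinv T (\<theta> f) \<cdot>\<^bsub>T\<^esub> (\<theta> f \<cdot>\<^bsub>T\<^esub> t))))) (s \<cdot>\<^bsub>T\<^esub> t)"
      using ST by (intro T.le_mul_left) auto
    then show "s \<cdot>\<^bsub>T\<^esub> t \<in> P" using T.filter_up[OF T.prime_filter[OF P] 1] ST by blast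
  qed
  then show ?thesis unfolding represents_def using ST by blast
qed

lemma represents_sinv:
  assumes A: "A \<subseteq> {F. S.pfilter F}" and s: "represents s A"
  shows "represents (sinv T s) ((`) (sinv S) ` A)"
proof -
  note sT = represents_closed[OF s]
  have "sinv T s \<in> P \<longleftrightarrow> pre P \<in> (`) (sinv S) ` A" if P: "T.prime P" for P
  proof -
    have PT: "P \<subseteq> carrier T" using T.filter_closed[OF T.prime_filter[OF P]] by blast
    have pre: "pre (sinv T ` P) = sinv S ` pre P"
      unfolding T.sinv_image[OF PT] by (subst S.sinv_image) (auto simp: hom_sinv)
    have "sinv T s \<in> P \<longleftrightarrow> s \<in> sinv T ` P"
      unfolding T.sinv_image[OF PT] using sT by simp
    also have "\<dots> \<longleftrightarrow> sinv S ` pre P \<in> A"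
      using representsD[OF s T.prime_sinv[OF P]] unfolding pre .
    also have "\<dots> \<longleftrightarrow> pre P \<in> (`) (sinv S) ` A"
    proof
      assume "sinv S ` pre P \<in> A"
      moreover have "pre P = sinv S ` sinv S ` pre P" by (rule S.sinv_image_image[symmetric]) blast
      ultimately show "pre P \<in> (`) (sinv S) ` A" by (rule image_eqI[rotated])
    next
      assume "pre P \<in> (`) (sinv S) ` A"
      then obtain F where F: "F \<in> A" "pre P = sinv S ` F" by blast
      have "F \<subseteq> carrier S" using F(1) A S.filter_closed by blast
      then show "sinv S ` pre P \<in> A" unfolding F(2) using F(1) by (simp add: S.sinv_image_image)
    qed
    finally show ?thesis .
  qed
  then show ?thesis unfolding represents_def using sT by blast
qed

text \<open>A filter that is an identity of the universal groupoid contains the product of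
  \<open>sinv S p\<close> and \<open>p\<close> for each of its members \<open>p\<close>. So every
  prime filter through \<open>u\<close> contains an idempotent, which forces \<open>u\<close> to be
  one.\<close>

lemma represents_identities:
  assumes A: "A \<subseteq> identities (universal_groupoid S)" and u: "represents u A"
  shows "u \<in> idempotents T"
proof (rule T.idem_by_primes[OF represents_closed[OF u]])
  fix P assume P: "T.prime P" and "u \<in> P"
  then have "pre P \<in> identities (universal_groupoid S)" using representsD[OF u] A by blast
  then have d: "S.dm (pre P) = pre P" unfolding S.UG.identities_iff by blast
  obtain p where p: "p \<in> carrier S" "\<theta> p \<in> P" "p \<in> pre P" using pre_nonempty[OF P] .
  have "sinv S p \<cdot>\<^bsub>S\<^esub> p \<in> pre P" using S.sinv_mul_in_gdom[OF prime_vimage[OF P] p(3)] d by simp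
  then show "\<exists>e\<in>idempotents T. e \<in> P"
    using p T.sinv_mul_idem[of "\<theta> p"] by (auto simp: hom_mul hom_sinv)
qed

text \<open>The inverse of one piece times another consists of identities because the union is a
  bisection, so the corresponding products in \<open>T\<close> are idempotent. Recording that
  \<open>t\<close> is the join serves both the existence of representatives and the preservation of
  joins by the extension.\<close>

lemma represents_Union:
  assumes fin: "finite \<D>" and bis: "bisection (universal_groupoid S) (\<Union>\<D>)"
    and f: "\<And>D. D \<in> \<D> \<Longrightarrow> represents (f D) D"
  shows "\<exists>t. represents t (\<Union>\<D>) \<and> is_join T t (f ` \<D>)"
proof -
  have filters: "D \<subseteq> {F. S.pfilter F}" if "D \<in> \<D>" for D
    using S.UG.bisection_subset[OF bis] that by (auto simp: subset_iff)
  have ginv: "ginv (universal_groupoid S) ` D = (`) (sinv S) ` D" for D by simp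
  have inv_filters: "(`) (sinv S) ` D \<subseteq> {F. S.pfilter F}" if "D \<in> \<D>" for D
    using filters[OF that] S.sinv_filter by blast
  have "compatible T (f D) (f E)" if DE: "D \<in> \<D>" "E \<in> \<D>" for D E
  proof -
    have sub: "D \<subseteq> \<Union>\<D>" "E \<subseteq> \<Union>\<D>" using DE by auto
    have "S.smul ((`) (sinv S) ` D) E \<subseteq> S.smul ((`) (sinv S) ` \<Union>\<D>) (\<Union>\<D>)"
      by (rule S.UG.subset_mul_mono[OF image_mono[OF sub(1)] sub(2)])
    also have "\<dots> \<subseteq> identities (universal_groupoid S)"
      using bis unfolding bisection_def ginv by blast
    finally have "sinv T (f D) \<cdot>\<^bsub>T\<^esub> f E \<in> idempotents T"
      by (rule represents_identities)
        (rule represents_mul[OF inv_filters[OF DE(1)] filters[OF DE(2)]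
          represents_sinv[OF filters[OF DE(1)] f[OF DE(1)]] f[OF DE(2)]])
    moreover have "S.smul D ((`) (sinv S) ` E) \<subseteq> S.smul (\<Union>\<D>) ((`) (sinv S) ` \<Union>\<D>)"
      by (rule S.UG.subset_mul_mono[OF sub(1) image_mono[OF sub(2)]])
    then have "S.smul D ((`) (sinv S) ` E) \<subseteq> identities (universal_groupoid S)"
      using bis unfolding bisection_def ginv by blast
    then have "f D \<cdot>\<^bsub>T\<^esub> sinv T (f E) \<in> idempotents T"
      by (rule represents_identities)
        (rule represents_mul[OF filters[OF DE(1)] inv_filters[OF DE(2)] f[OF DE(1)]
          represents_sinv[OF filters[OF DE(2)] f[OF DE(2)]]])
    ultimately show ?thesis unfolding compatible_def by blast
  qed
  then have fc: "finite_compatible T (f ` \<D>)"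
    unfolding finite_compatible_def using fin represents_closed[OF f] by auto
  obtain t where t: "is_join T t (f ` \<D>)" using T.join_exists[OF fc] by blast
  have tT: "t \<in> carrier T" using T.is_join_closed[OF _ t] represents_closed[OF f] by blast
  have "t \<in> P \<longleftrightarrow> pre P \<in> \<Union>\<D>" if P: "T.prime P" for P
    using T.prime_join[OF fc t P] representsD[OF f P] by auto
  then show ?thesis using t tT unfolding represents_def by blast
qed

lemma represents_filters_at: "x \<in> carrier S \<Longrightarrow> represents (\<theta> x) (filters_at S x)"
  unfolding represents_def S.filters_at_iff using prime_vimage by simp

text \<open>Each induction step removes one \<open>y\<close> by a relative difference. The bound by
  \<open>\<theta> x\<close> is carried along so that \<open>t\<close> and \<open>\<theta> y\<close>
  have a common upper bound and hence a meet, the element \<open>?u\<close> that is subtracted from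
  \<open>t\<close>.\<close>

lemma represents_basic:
  assumes x: "x \<in> carrier S" and "finite Y" "\<forall>y\<in>Y. natural_le S y x"
  shows "\<exists>t. represents t (S.basic x Y) \<and> natural_le T t (\<theta> x)"
  using assms(2,3)
proof (induction Y)
  case empty
  then show ?case
    using represents_filters_at[OF x] x by (intro exI[of _ "\<theta> x"]) (simp add: S.basic_empty)
next
  case (insert y Y)
  then obtain t where t: "represents t (S.basic x Y)" "natural_le T t (\<theta> x)" by auto
  have yx: "natural_le S y x" using insert.prems by simp
  have yS: "y \<in> carrier S" by (rule S.le_closed[OF yx x])
  note tT = represents_closed[OF t(1)]
  let ?u = "t \<cdot>\<^bsub>T\<^esub> (sinv T (\<theta> y) \<cdot>\<^bsub>T\<^esub> \<theta> y)"
  have ut: "natural_le T ?u t" using tT yS by (intro T.leI_right) simp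
  have "natural_le T ?u (\<theta> x \<cdot>\<^bsub>T\<^esub> (sinv T (\<theta> y) \<cdot>\<^bsub>T\<^esub> \<theta> y))"
    using t(2) x yS by (intro T.le_mul_right) auto
  then have uy: "natural_le T ?u (\<theta> y)"
    using T.le_right[OF hom_le[OF yx x]] x by simp
  obtain v where v: "v \<in> carrier T" "natural_le T v t"
    "\<And>P. T.prime P \<Longrightarrow> v \<in> P \<longleftrightarrow> t \<in> P \<and> ?u \<notin> P"
    using T.relative_difference[OF ut tT] by blast
  have "v \<in> P \<longleftrightarrow> pre P \<in> S.basic x (insert y Y)" if P: "T.prime P" for P
  proof -
    note F = T.prime_filter[OF P]
    have "?u \<in> P \<longleftrightarrow> \<theta> y \<in> P" if "t \<in> P"
      using T.filter_up[OF F _ uy] T.filter_triple[OF F that] yS by auto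
    then have "v \<in> P \<longleftrightarrow> pre P \<in> S.basic x Y \<and> \<theta> y \<notin> P"
      using v(3)[OF P] representsD[OF t(1) P] by blast
    also have "\<dots> \<longleftrightarrow> pre P \<in> S.basic x (insert y Y)"
      unfolding S.basic_iff using yS by auto
    finally show ?thesis .
  qed
  moreover have "natural_le T v (\<theta> x)" using T.le_trans[OF v(2) t(2)] x by simp
  ultimately show ?case unfolding represents_def using v(1) by blast
qed

lemma represents_KB:
  assumes A: "A \<in> carrier (KB (universal_groupoid S))"
  shows "\<exists>t. represents t A"
proof -
  obtain \<D> where D: "finite \<D>" "\<D> \<subseteq> universal_basis S" "A = \<Union>\<D>"
    using A S.compact_open_basis_Union unfolding S.UG.KB_iff by metis
  have "\<forall>D\<in>\<D>. \<exists>t. represents t D"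
    using D(2) represents_basic unfolding S.universal_basis_iff subset_iff by blast
  then obtain f where "\<And>D. D \<in> \<D> \<Longrightarrow> represents (f D) D" by metis
  then show ?thesis
    using represents_Union[OF D(1)] S.UG.KB_bisection[OF A] unfolding D(3) by blast
qed

section \<open>The extension and its uniqueness\<close>

text \<open>Uniqueness of representatives justifies the description. \<open>restrict\<close> fixes
  the values outside the carrier, about which the homomorphism laws say nothing, so that uniqueness
  can be an equality of functions.\<close>

definition extension :: "'a set set \<Rightarrow> 'b" where
  "extension = restrict (\<lambda>A. THE t. represents t A) (carrier (KB (universal_groupoid S)))"

lemma extension_represents:
  assumes A: "A \<in> carrier (KB (universal_groupoid S))"
  shows "represents (extension A) A"
proof -
  have "\<exists>!t. represents t A" using represents_KB[OF A] represents_unique by blast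
  from theI'[OF this] show ?thesis using A by (simp add: extension_def)
qed

lemma extension_eqI:
  "\<lbrakk>A \<in> carrier (KB (universal_groupoid S)); represents t A\<rbrakk> \<Longrightarrow> extension A = t"
  using extension_represents represents_unique by blast

lemma KB_filters: "A \<in> carrier (KB (universal_groupoid S)) \<Longrightarrow> A \<subseteq> {F. S.pfilter F}"
  using S.UG.KB_subset S.carrier_universal by blast

text \<open>Multiplicativity and preservation of joins are both obtained by showing that the
  required value represents the right set.\<close>

lemma extension_hom: "extension \<in> distributive_hom (KB (universal_groupoid S)) T"
proof -
  have "extension (S.smul A B) = extension A \<cdot>\<^bsub>T\<^esub> extension B"
    if "A \<in> carrier (KB (universal_groupoid S))" "B \<in> carrier (KB (universal_groupoid S))" for A B
    using that by (intro extension_eqI S.UG.KB_mul_closed represents_mul extension_represents KB_filters)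
  moreover have "extension \<in> carrier (KB (universal_groupoid S)) \<rightarrow> carrier T"
    using extension_represents represents_closed by blast
  ultimately have "extension \<in> semigroup_hom (KB (universal_groupoid S)) T"
    unfolding semigroup_hom_def by simp
  moreover have "is_join T (extension A) (extension ` \<A>)"
    if fc: "finite_compatible (KB (universal_groupoid S)) \<A>"
      and j: "is_join (KB (universal_groupoid S)) A \<A>" for A \<A>
  proof -
    have A: "A = \<Union>\<A>" using j S.UG.is_join_KB[OF fc] by blast
    have KA: "A \<in> carrier (KB (universal_groupoid S))" unfolding A by (rule S.UG.Union_KB_closed[OF fc])
    have "\<exists>t. represents t (\<Union>\<A>) \<and> is_join T t (extension ` \<A>)"
    proof (rule represents_Union)
      show "finite \<A>" using fc unfolding finite_compatible_def by blast
      show "bisection (universal_groupoid S) (\<Union>\<A>)" using S.UG.KB_bisection[OF KA] A by simp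
      show "represents (extension D) D" if "D \<in> \<A>" for D
        using that fc extension_represents unfolding finite_compatible_def by blast
    qed
    then show ?thesis using extension_eqI[OF KA] A by blast
  qed
  ultimately show ?thesis unfolding distributive_hom_def by blast
qed

lemma filters_at_KB: "x \<in> carrier S \<Longrightarrow> filters_at S x \<in> carrier (KB (universal_groupoid S))"
  by (rule S.basis_KB[OF S.filters_at_basis])

lemma extension_filters_at: "x \<in> carrier S \<Longrightarrow> extension (filters_at S x) = \<theta> x"
  by (rule extension_eqI[OF filters_at_KB represents_filters_at])

context
  fixes h :: "'a set set \<Rightarrow> 'b"
  assumes h: "h \<in> distributive_hom (KB (universal_groupoid S)) T"
    and h_filters_at: "\<And>x. x \<in> carrier S \<Longrightarrow> h (filters_at S x) = \<theta> x"
begin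

lemma distributive_hom_closed: "A \<in> carrier (KB (universal_groupoid S)) \<Longrightarrow> h A \<in> carrier T"
  using h unfolding distributive_hom_def semigroup_hom_def by blast

lemma distributive_hom_mul:
  "\<lbrakk>A \<in> carrier (KB (universal_groupoid S)); B \<in> carrier (KB (universal_groupoid S))\<rbrakk>
    \<Longrightarrow> h (S.smul A B) = h A \<cdot>\<^bsub>T\<^esub> h B"
  using h unfolding distributive_hom_def semigroup_hom_def by simp

text \<open>A finite family inside one bisection is compatible with its union as join, and
  \<open>h\<close> preserves this join. The empty family is included and shows that
  \<open>h {}\<close> lies in no prime filter.\<close>

lemma distributive_hom_Union:
  assumes fin: "finite \<A>" and sub: "\<A> \<subseteq> carrier (KB (universal_groupoid S))"
    and A: "\<Union>\<A> \<in> carrier (KB (universal_groupoid S))" and P: "T.prime P"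
  shows "h (\<Union>\<A>) \<in> P \<longleftrightarrow> (\<exists>A\<in>\<A>. h A \<in> P)"
proof -
  have fc: "finite_compatible (KB (universal_groupoid S)) \<A>"
    unfolding finite_compatible_def
    using fin sub S.UG.compatible_KB_subset[OF _ _ S.UG.KB_bisection[OF A]] by blast
  then have j: "is_join T (h (\<Union>\<A>)) (h ` \<A>)"
    using h S.UG.is_join_KB[OF fc] unfolding distributive_hom_def by blast
  have hA: "h ` \<A> \<subseteq> carrier T" using sub distributive_hom_closed by blast
  have "finite_compatible T (h ` \<A>)"
    using fin T.is_join_upper[OF hA j] T.is_join_closed[OF hA j]
    by (intro T.finite_compatible_bounded[OF hA, of "h (\<Union>\<A>)"]) auto
  from T.prime_join[OF this j P] show ?thesis by blast
qed

text \<open>\<open>filters_at S x\<close> is the union of \<open>D\<close> and the sets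
  \<open>filters_at S y\<close> with \<open>y \<in> Y\<close>, and \<open>h\<close> is known on all
  of these except \<open>D\<close>. Membership of \<open>h D\<close> in \<open>P\<close> is
  therefore decided by exclusion, once \<open>h D\<close> and \<open>\<theta> y\<close> are shown
  never to lie in \<open>P\<close> together.\<close>

lemma distributive_hom_represents_basic:
  assumes D: "D \<in> universal_basis S"
  shows "represents (h D) D"
proof -
  obtain x Y where x: "x \<in> carrier S" and Y: "finite Y" "\<forall>y\<in>Y. natural_le S y x" and Dxy: "D = S.basic x Y"
    using D unfolding S.universal_basis_iff by blast
  have YS: "y \<in> carrier S" if "y \<in> Y" for y using that Y(2) S.le_closed x by blast
  have DK: "D \<in> carrier (KB (universal_groupoid S))" by (rule S.basis_KB[OF D])
  have "filters_at S y \<subseteq> filters_at S x" if "y \<in> Y" for y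
    using that Y(2) S.filter_up x by (auto simp: S.filters_at_iff)
  then have U: "\<Union>(insert D (filters_at S ` Y)) = filters_at S x"
    unfolding Dxy S.basic_def by auto
  have "h D \<in> P \<longleftrightarrow> pre P \<in> D" if P: "T.prime P" for P
  proof -
    note F = T.prime_filter[OF P]
    have "h (\<Union>(insert D (filters_at S ` Y))) \<in> P \<longleftrightarrow> (\<exists>A\<in>insert D (filters_at S ` Y). h A \<in> P)"
    proof (rule distributive_hom_Union[OF _ _ _ P])
      show "insert D (filters_at S ` Y) \<subseteq> carrier (KB (universal_groupoid S))"
        using DK YS filters_at_KB by blast
      show "\<Union>(insert D (filters_at S ` Y)) \<in> carrier (KB (universal_groupoid S))"
        unfolding U by (rule filters_at_KB[OF x])
    qed (use Y in auto)
    then have 1: "\<theta> x \<in> P \<longleftrightarrow> h D \<in> P \<or> (\<exists>y\<in>Y. \<theta> y \<in> P)"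
      unfolding U using h_filters_at x YS by auto
    have "h {} \<notin> P" using distributive_hom_Union[OF _ _ _ P, of "{}"] by (simp add: S.UG.KB_iff S.UG.bisection_iff)
    have 2: "\<theta> y \<notin> P" if y: "y \<in> Y" and hD: "h D \<in> P" for y
    proof
      assume yP: "\<theta> y \<in> P"
      \<comment> \<open>Multiplying \<open>D\<close> by the filters through \<open>?e\<close> cuts
        it down to its part below \<open>y\<close>, which is empty; if \<open>h D\<close> and
        \<open>\<theta> y\<close> were both in \<open>P\<close>, so would be
        \<open>h {}\<close>.\<close>
      let ?e = "sinv S y \<cdot>\<^bsub>S\<^esub> y"
      have eS: "?e \<in> carrier S" using YS[OF y] by simp
      have "h D \<cdot>\<^bsub>T\<^esub> (sinv T (\<theta> y) \<cdot>\<^bsub>T\<^esub> \<theta> y) \<in> P" by (rule T.filter_triple[OF F hD yP yP])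
      also have "h D \<cdot>\<^bsub>T\<^esub> (sinv T (\<theta> y) \<cdot>\<^bsub>T\<^esub> \<theta> y) = h D \<cdot>\<^bsub>T\<^esub> h (filters_at S ?e)"
        using YS[OF y] by (simp add: h_filters_at hom_mul hom_sinv)
      also have "\<dots> = h (S.smul D (filters_at S ?e))"
        by (rule distributive_hom_mul[OF DK filters_at_KB[OF eS], symmetric])
      also have "S.smul D (filters_at S ?e) = {}"
      proof -
        \<comment> \<open>Since \<open>x\<close> times \<open>?e\<close> is \<open>y\<close>, this
          basic set demands \<open>y\<close> while excluding \<open>y\<close> times
          \<open>?e\<close>, which is \<open>y\<close> again.\<close>
        have "S.smul D (filters_at S ?e) = S.basic (x \<cdot>\<^bsub>S\<^esub> ?e) ((\<lambda>y. y \<cdot>\<^bsub>S\<^esub> ?e) ` Y)"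
          using S.basic_mul[OF x eS Y(2), of "{}"] by (simp add: Dxy S.basic_empty)
        moreover have "x \<cdot>\<^bsub>S\<^esub> ?e = y" using S.le_right[of y x] Y(2) y x by blast
        moreover have "y = y \<cdot>\<^bsub>S\<^esub> ?e" using YS[OF y] by (simp add: S.mul_sinv_cancel)
        ultimately show ?thesis using y unfolding S.basic_def by auto
      qed
      finally show False using \<open>h {} \<notin> P\<close> by blast
    qed
    have "pre P \<in> D \<longleftrightarrow> \<theta> x \<in> P \<and> (\<forall>y\<in>Y. \<theta> y \<notin> P)"
      unfolding Dxy S.basic_iff using prime_vimage[OF P] x YS by auto
    then show ?thesis using 1 2 by blast
  qed
  then show ?thesis unfolding represents_def using distributive_hom_closed[OF DK] by blast
qed

lemma distributive_hom_represents:
  assumes A: "A \<in> carrier (KB (universal_groupoid S))"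
  shows "represents (h A) A"
proof -
  obtain \<D> where D: "finite \<D>" "\<D> \<subseteq> universal_basis S" "A = \<Union>\<D>"
    using A S.compact_open_basis_Union unfolding S.UG.KB_iff by metis
  have DK: "\<D> \<subseteq> carrier (KB (universal_groupoid S))" using D(2) S.basis_KB by blast
  have "h A \<in> P \<longleftrightarrow> pre P \<in> A" if P: "T.prime P" for P
  proof -
    have "h A \<in> P \<longleftrightarrow> (\<exists>D\<in>\<D>. h D \<in> P)"
      unfolding D(3) using distributive_hom_Union[OF D(1) DK _ P] A D(3) by blast
    also have "\<dots> \<longleftrightarrow> (\<exists>D\<in>\<D>. pre P \<in> D)"
      using representsD[OF distributive_hom_represents_basic P] D(2) by blast
    finally show ?thesis unfolding D(3) by blast
  qed
  then show ?thesis unfolding represents_def using distributive_hom_closed[OF A] by blast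
qed

end

end

theorem theorem5p7:
  fixes S :: "'a semigrp" and T :: "'b semigrp" and \<theta> :: "'a \<Rightarrow> 'b"
  assumes "inverse_semigroup_with_zero S"
    and "weakly_boolean_inverse_semigroup T"
    and "\<theta> \<in> semigroup_hom S T"
    and "\<And>P. is_prime_filter T P \<Longrightarrow> is_proper_filter S {s \<in> carrier S. \<theta> s \<in> P}"
  shows "\<exists>!h. h \<in> extensional (carrier (booleanization S))
           \<and> h \<in> distributive_hom (booleanization S) T
           \<and> (\<forall>s\<in>carrier S. h (beta S s) = \<theta> s)"
proof -
  interpret prime_hom S T \<theta>
    using assms by (simp add: prime_hom_def prime_hom_axioms_def)
  show ?thesis
    unfolding booleanization_def beta_def
  proof (intro ex1I conjI ballI)
    show "extension \<in> extensional (carrier (KB (universal_groupoid S)))"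
      by (simp add: extension_def)
    show "extension \<in> distributive_hom (KB (universal_groupoid S)) T" by (rule extension_hom)
    show "extension (filters_at S s) = \<theta> s" if "s \<in> carrier S" for s
      by (rule extension_filters_at[OF that])
  next
    fix h assume h: "h \<in> extensional (carrier (KB (universal_groupoid S)))
      \<and> h \<in> distributive_hom (KB (universal_groupoid S)) T
      \<and> (\<forall>s\<in>carrier S. h (filters_at S s) = \<theta> s)"
    show "h = extension"
    \<comment> \<open>Both functions are extensional, so agreement on the carrier suffices, and
      there both values represent \<open>A\<close>.\<close>
    proof (rule extensionalityI[of _ "carrier (KB (universal_groupoid S))"])
      fix A assume A: "A \<in> carrier (KB (universal_groupoid S))"
      then have "represents (h A) A" using h distributive_hom_represents by blast
      then show "h A = extension A" using extension_eqI[OF A] by simp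
    qed (use h in \<open>simp_all add: extension_def\<close>)
  qed
qed

end
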